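(* There is an absolute constant $C>0$ such that the following holds for all integers $n,p\ge 1$ and all $q\in\{1,2\}$. Let $X_1,\dots,X_n\in\mathbb{R}^p$ be centered i.i.d. random vectors, and suppose that $\nu_q=\max_{1\le j\le p}\big\|X_{1j}/\sqrt{\operatorname{var}(X_{1j})}\big\|_{\psi_q}$ is finite. Let $\rho$ be the smallest eigenvalue of the correlation matrix of $X_1$, and suppose that $\rho>0$. Let $Y\in\mathbb{R}^p$ be a centered Gaussian random vector with $\mathbb{E}[YY^{\top}]=\mathbb{E}[X_1X_1^{\top}]$. Then $$\sup_{A\in\mathscr{R}}\Big|\mathbb{P}\Big(\tfrac{1}{\sqrt n}\sum_{i=1}^n X_i\in A\Big)-\mathbb{P}(Y\in A)\Big|\ \le\ \frac{C\,\nu_q^4\,\mathrm{Log}^{r_q}(pn)\,\mathrm{Log}(n)}{\rho^{3/2}\,n^{1/2}},$$ where $r_1=6$ and $r_2=4$.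
   Context: An absolute constant does not depend on any other quantity (in particular not on $n$, $p$, $q$ or the distributions). $\mathrm{Log}(t)=\max\{\ln(t),1\}$ for $t>0$, and $\mathrm{Log}^{a}(t)=(\mathrm{Log}(t))^a$. For a random variable $U$ and $q\in\{1,2\}$, $\|U\|_{\psi_q}=\inf\{t>0:\mathbb{E}[\exp(|U|^q/t^q)]\le 2\}$. $\mathscr{R}$ is the class of all hyperrectangles in $\mathbb{R}^p$, i.e. all products $\prod_{j=1}^p\mathcal{I}_j$ of arbitrary intervals $\mathcal{I}_j\subset\mathbb{R}$ (bounded or unbounded, including zero, one or two endpoints). The correlation matrix of a random vector $V$ has entries $\operatorname{cov}(V_i,V_j)/\sqrt{\operatorname{var}(V_i)\operatorname{var}(V_j)}$, and is defined when all coordinate variances are positive. *)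

theory Defs
  imports "HOL-Probability.Probability" "Jordan_Normal_Form.Char_Poly"
begin

text \<open>
  The dimension \<open>p\<close> is quantified inside the theorem, so vectors in \<open>p\<close>-space are
  functions \<open>nat \<Rightarrow> real\<close> on the index set \<open>{..<p}\<close>. Coordinates and samples are
  numbered from 0.
\<close>

definition Rp :: "nat \<Rightarrow> (nat \<Rightarrow> real) measure" where
  "Rp p = (\<Pi>\<^sub>M j\<in>{..<p}. borel)"

definition Log :: "real \<Rightarrow> real" where
  "Log t = max (ln t) 1"

text \<open>The infimum is taken in \<open>ennreal\<close>, so it is \<open>\<top>\<close> if no \<open>t\<close> qualifies.\<close>

definition psi_norm :: "nat \<Rightarrow> 'a measure \<Rightarrow> ('a \<Rightarrow> real) \<Rightarrow> ennreal" where
  "psi_norm q M U =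
     Inf {ennreal t | t. 0 < t \<and> (\<integral>\<^sup>+ \<omega>. ennreal (exp (\<bar>U \<omega>\<bar> ^ q / t ^ q)) \<partial>M) \<le> 2}"

definition max_psi_norm :: "nat \<Rightarrow> 'a measure \<Rightarrow> nat \<Rightarrow> ('a \<Rightarrow> nat \<Rightarrow> real) \<Rightarrow> ennreal" where
  "max_psi_norm q M p V =
     (MAX j\<in>{..<p}. psi_norm q M (\<lambda>\<omega>. V \<omega> j / sqrt (prob_space.variance M (\<lambda>\<omega>. V \<omega> j))))"

definition covariance :: "'a measure \<Rightarrow> ('a \<Rightarrow> real) \<Rightarrow> ('a \<Rightarrow> real) \<Rightarrow> real" where
  "covariance M U W = prob_space.expectation M
     (\<lambda>\<omega>. (U \<omega> - prob_space.expectation M U) * (W \<omega> - prob_space.expectation M W))"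

definition correlation_matrix :: "'a measure \<Rightarrow> nat \<Rightarrow> ('a \<Rightarrow> nat \<Rightarrow> real) \<Rightarrow> real mat" where
  "correlation_matrix M p V = mat p p (\<lambda>(i, j).
     covariance M (\<lambda>\<omega>. V \<omega> i) (\<lambda>\<omega>. V \<omega> j) /
     sqrt (prob_space.variance M (\<lambda>\<omega>. V \<omega> i) * prob_space.variance M (\<lambda>\<omega>. V \<omega> j)))"

text \<open>Only used for real symmetric matrices of positive dimension, whose eigenvalues form a
  nonempty finite set.\<close>

definition smallest_eigenvalue :: "real mat \<Rightarrow> real" where
  "smallest_eigenvalue A = Min {k. eigenvalue A k}"

text \<open>\<^const>\<open>is_interval\<close> on the reals covers open, closed, half-open, bounded and unbounded
  intervals.\<close>

definition hyperrectangles :: "nat \<Rightarrow> (nat \<Rightarrow> real) set set" where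
  "hyperrectangles p = {PiE {..<p} I | I. \<forall>j<p. is_interval (I j)}"

text \<open>Every linear combination of the coordinates is univariate normal; the almost surely
  constant case is the normal law with variance 0.\<close>

definition gaussian_vector :: "'a measure \<Rightarrow> nat \<Rightarrow> ('a \<Rightarrow> nat \<Rightarrow> real) \<Rightarrow> bool" where
  "gaussian_vector M p Y \<longleftrightarrow>
     Y \<in> M \<rightarrow>\<^sub>M Rp p \<and>
     (\<forall>a :: nat \<Rightarrow> real. \<exists>\<mu> \<sigma>.
        0 < \<sigma> \<and> distributed M lborel (\<lambda>\<omega>. \<Sum>j<p. a j * Y \<omega> j) (normal_density \<mu> \<sigma>) \<or>
        (AE \<omega> in M. (\<Sum>j<p. a j * Y \<omega> j) = \<mu>))"

definition iid :: "'a measure \<Rightarrow> nat \<Rightarrow> nat \<Rightarrow> (nat \<Rightarrow> 'a \<Rightarrow> nat \<Rightarrow> real) \<Rightarrow> bool" where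
  "iid M n p X \<longleftrightarrow>
     prob_space.indep_vars M (\<lambda>_. Rp p) X {..<n} \<and>
     (\<forall>i<n. distr M (Rp p) (X i) = distr M (Rp p) (X 0))"

definition centered :: "'a measure \<Rightarrow> nat \<Rightarrow> ('a \<Rightarrow> nat \<Rightarrow> real) \<Rightarrow> bool" where
  "centered M p V \<longleftrightarrow>
     (\<forall>j<p. integrable M (\<lambda>\<omega>. V \<omega> j) \<and> prob_space.expectation M (\<lambda>\<omega>. V \<omega> j) = 0)"

definition normalized_sum :: "nat \<Rightarrow> nat \<Rightarrow> (nat \<Rightarrow> 'a \<Rightarrow> nat \<Rightarrow> real) \<Rightarrow> 'a \<Rightarrow> nat \<Rightarrow> real" where
  "normalized_sum n p X \<omega> = (\<lambda>j\<in>{..<p}. 1 / sqrt (real n) * (\<Sum>i<n. X i \<omega> j))"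

text \<open>
  \<open>clt_constant C TYPE('a) TYPE('b)\<close>: the bound holds with the constant \<open>C\<close> for all \<open>n\<close>,
  \<open>p\<close>, \<open>q\<close> and all \<open>X\<close>, \<open>Y\<close> living on arbitrary probability spaces \<open>M\<close> and \<open>N\<close> over the
  types \<open>'a\<close> and \<open>'b\<close>. Only the law of \<open>Y\<close> matters, so \<open>Y\<close> may live on a space of its own
  (\<open>M = N\<close> is allowed). The two types are explicit arguments because HOL cannot quantify over
  types after an existential quantifier for \<open>C\<close>.
\<close>

definition clt_constant :: "real \<Rightarrow> 'a itself \<Rightarrow> 'b itself \<Rightarrow> bool" where
  "clt_constant C (_ :: 'a itself) (_ :: 'b itself) \<longleftrightarrow>
     (\<forall>(n :: nat) (p :: nat) (q :: nat) (M :: 'a measure) (N :: 'b measure) X Y.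
        1 \<le> n \<longrightarrow> 1 \<le> p \<longrightarrow> q \<in> {1, 2} \<longrightarrow>
        prob_space M \<longrightarrow> prob_space N \<longrightarrow>
        iid M n p X \<longrightarrow> centered M p (X 0) \<longrightarrow>
        (\<forall>j<p. integrable M (\<lambda>\<omega>. (X 0 \<omega> j)\<^sup>2) \<and> 0 < prob_space.variance M (\<lambda>\<omega>. X 0 \<omega> j)) \<longrightarrow>
        max_psi_norm q M p (X 0) < \<top> \<longrightarrow>
        0 < smallest_eigenvalue (correlation_matrix M p (X 0)) \<longrightarrow>
        gaussian_vector N p Y \<longrightarrow> centered N p Y \<longrightarrow>
        (\<forall>i<p. \<forall>j<p. prob_space.expectation N (\<lambda>\<omega>. Y \<omega> i * Y \<omega> j) =
                       prob_space.expectation M (\<lambda>\<omega>. X 0 \<omega> i * X 0 \<omega> j)) \<longrightarrow>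
        (SUP A\<in>hyperrectangles p.
           \<bar>measure M {\<omega> \<in> space M. normalized_sum n p X \<omega> \<in> A} -
            measure N {\<omega> \<in> space N. Y \<omega> \<in> A}\<bar>)
        \<le> C * (enn2real (max_psi_norm q M p (X 0))) ^ 4
             * Log (real (p * n)) ^ (if q = 1 then 6 else 4) * Log (real n)
          / (smallest_eigenvalue (correlation_matrix M p (X 0)) powr (3 / 2) * sqrt (real n)))"

end

theory Submission
  imports Defs "HOL-Real_Asymp.Real_Asymp"
begin

text \<open>Rescale the coordinates to variance one, and let \<open>\<gamma>\<close> be the normal limit law. Its covariance matrix
dominates \<open>\<rho>\<close> times the identity, so \<open>\<gamma>\<close> is the convolution of \<open>N(0, \<rho> I)\<close> with another centered
normal law \<open>W\<close>. The independent coordinates of \<open>N(0, \<rho> I)\<close> are the noise that smooths every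
indicator of a box; a little extra noise of variance \<open>\<epsilon>\<^sup>2\<close> keeps the last steps of the argument smooth.

The summands are exchanged for normal ones one at a time (\<open>path\<close>). When \<open>k\<close> of them are still
original, the other ones carry the noise \<open>N(0, \<rho> (n - k) / n I)\<close>, and averaging the indicator of a box
over all the noise gives \<open>box_mass\<close>, a product of normal masses of intervals at scale \<open>\<sigma>\<close> with
\<open>\<sigma>\<^sup>2 = \<epsilon>\<^sup>2 + \<rho> (n - k) / n\<close>. First and second moments agree, so one exchange costs a third order
Taylor remainder. For a product, the sum of the absolute values of all \<open>p\<^sup>3\<close> third partial derivatives
is only of order \<open>\<sigma>\<close> to the power \<open>-3\<close> times a power of \<open>Log (p n)\<close>, and it is negligible at points
whose distance from the boundary exceeds \<open>\<sigma>\<close> times a root of that logarithm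
(\<open>box_mass_expansion\<close>). An exchange therefore costs the probability that the partial sum falls into
a thin shell around the boundary (\<open>lindeberg_step\<close>).

A shell is a difference of two boxes. For the partial sum of \<open>k\<close> terms its probability is at most the
one under \<open>\<gamma>\<close>, which is proportional to the width of the shell (\<open>gauss_anticoncentration\<close>), plus
twice the error of the normal approximation for sample size \<open>k\<close>. This turns the telescoping sum into
a recursion (\<open>recursion\<close>): the error for \<open>n\<close> is at most \<open>D / 4\<close> plus the desired rate, where \<open>D\<close> bounds
the errors for \<open>n / 2 \<le> k < n\<close>, provided \<open>\<epsilon>\<close> is a large multiple of \<open>1 / sqrt n\<close>. For \<open>k < n / 2\<close> the
noise is of order one and nothing has to be known about the partial sum. Induction on \<open>n\<close> finishes
the proof for boxes (\<open>box_approximation\<close>), and monotone limits reach all hyperrectangles.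

The factors of the rate: summing the squares of \<open>1 / \<sigma>\<close> over the steps yields \<open>Log n / \<rho>\<close>, and the
anti-concentration of \<open>\<gamma>\<close> another \<open>1 / sqrt \<rho>\<close>. Three derivatives, the width of the shell and the
anti-concentration contribute one root of \<open>Log (p n)\<close> each, five altogether; the third moment of the
largest coordinate contributes \<open>\<nu>\<^sup>3\<close> and three powers of the \<open>q\<close>-th root of \<open>Log (p n)\<close>.\<close>

section \<open>Laws on p-space and their characteristic functions\<close>

text \<open>Normalising the weights turns them into densities, and the hypothesis says that the two resulting
laws of \<open>u\<close> and \<open>v\<close> have the same characteristic function. Weights are what allows this one-dimensional
uniqueness theorem to be applied to one coordinate after another.\<close>

lemma weighted_char_unique:
  fixes P :: "'x measure" and Q :: "'y measure" and f u :: "'x \<Rightarrow> real" and g v :: "'y \<Rightarrow> real"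
  assumes P: "prob_space P" and Q: "prob_space Q"
    and m[measurable]: "f \<in> borel_measurable P" "u \<in> borel_measurable P"
      "g \<in> borel_measurable Q" "v \<in> borel_measurable Q"
    and f: "\<And>x. x \<in> space P \<Longrightarrow> 0 \<le> f x \<and> f x \<le> K"
    and g: "\<And>y. y \<in> space Q \<Longrightarrow> 0 \<le> g y \<and> g y \<le> K"
    and eq: "\<And>s c. (\<integral>x. f x * cos (s * u x + c) \<partial>P) = (\<integral>y. g y * cos (s * v y + c) \<partial>Q)"
    and B[measurable]: "B \<in> sets borel"
  shows "(\<integral>x. f x * indicator B (u x) \<partial>P) = (\<integral>y. g y * indicator B (v y) \<partial>Q)"
proof -
  interpret P: prob_space P by fact
  interpret Q: prob_space Q by fact
  define m where "m = (\<integral>x. f x \<partial>P)"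
  obtain x0 where "x0 \<in> space P" using P.not_empty by blast
  with f have K: "0 \<le> K" by (meson order_trans)
  have mQ: "m = (\<integral>y. g y \<partial>Q)" using eq[of 0 0] by (simp add: m_def)
  have intf: "integrable P f"
    by (rule P.integrable_const_bound[of _ K]) (use f in \<open>auto intro!: AE_I2\<close>)
  have intg: "integrable Q g"
    by (rule Q.integrable_const_bound[of _ K]) (use g in \<open>auto intro!: AE_I2\<close>)
  have m0: "0 \<le> m" unfolding m_def using f by (intro Bochner_Integration.integral_nonneg) auto
  show ?thesis
  proof (cases "m = 0")
    case True
    have "AE x in P. f x = 0"
      using integral_nonneg_eq_0_iff_AE[OF intf] f True by (auto simp: m_def)
    moreover have "AE x in Q. g x = 0"
      using integral_nonneg_eq_0_iff_AE[OF intg] g True by (auto simp: mQ)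
    ultimately have "(\<integral>x. f x * indicator B (u x) \<partial>P) = 0" "(\<integral>y. g y * indicator B (v y) \<partial>Q) = 0"
      by (intro integral_eq_zero_AE; auto)+
    then show ?thesis by simp
  next
    case False
    with m0 have m: "0 < m" by simp
    define M1 where "M1 = distr (density P (\<lambda>x. ennreal (f x / m))) borel u"
    define M2 where "M2 = distr (density Q (\<lambda>x. ennreal (g x / m))) borel v"
    have "prob_space (density P (\<lambda>x. ennreal (f x / m)))"
    proof (rule prob_spaceI)
      have "emeasure (density P (\<lambda>x. ennreal (f x / m))) (space P) = (\<integral>\<^sup>+x. ennreal (f x / m) \<partial>P)"
        by (simp add: emeasure_density cong: nn_integral_cong)
      also have "\<dots> = ennreal (\<integral>x. f x / m \<partial>P)"
        using f m intf by (intro nn_integral_eq_integral) (auto intro!: AE_I2)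
      also have "\<dots> = 1" using m by (simp add: m_def)
      finally show "emeasure (density P (\<lambda>x. ennreal (f x / m))) (space (density P (\<lambda>x. ennreal (f x / m)))) = 1"
        by simp
    qed
    then have r1: "real_distribution M1" unfolding M1_def
      by (intro prob_space.real_distribution_distr) auto
    have "prob_space (density Q (\<lambda>x. ennreal (g x / m)))"
    proof (rule prob_spaceI)
      have "emeasure (density Q (\<lambda>x. ennreal (g x / m))) (space Q) = (\<integral>\<^sup>+x. ennreal (g x / m) \<partial>Q)"
        by (simp add: emeasure_density cong: nn_integral_cong)
      also have "\<dots> = ennreal (\<integral>x. g x / m \<partial>Q)"
        using g m intg by (intro nn_integral_eq_integral) (auto intro!: AE_I2)
      also have "\<dots> = 1" using m by (simp add: mQ)
      finally show "emeasure (density Q (\<lambda>x. ennreal (g x / m))) (space (density Q (\<lambda>x. ennreal (g x / m)))) = 1"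
        by simp
    qed
    then have r2: "real_distribution M2" unfolding M2_def
      by (intro prob_space.real_distribution_distr) auto
    have c1: "char M1 s = (CLINT x|P. (f x / m) *\<^sub>R iexp (s * u x))" for s
      unfolding char_def M1_def using f m
      by (subst integral_distr) (auto intro!: integral_density AE_I2 simp: )
    have c2: "char M2 s = (CLINT x|Q. (g x / m) *\<^sub>R iexp (s * v x))" for s
      unfolding char_def M2_def using g m
      by (subst integral_distr) (auto intro!: integral_density AE_I2 simp: )
    have i1: "integrable P (\<lambda>x. (f x / m) *\<^sub>R iexp (s * u x))" for s
      by (rule P.integrable_const_bound[of _ "K / m"]) (use f m in \<open>auto intro!: AE_I2 divide_right_mono\<close>)
    have i2: "integrable Q (\<lambda>x. (g x / m) *\<^sub>R iexp (s * v x))" for s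
      by (rule Q.integrable_const_bound[of _ "K / m"]) (use g m in \<open>auto intro!: AE_I2 divide_right_mono\<close>)
    have "char M1 s = char M2 s" for s
    proof (rule complex_eqI)
      have "(\<integral>x. f x / m * cos (s * u x) \<partial>P) = (\<integral>y. g y / m * cos (s * v y) \<partial>Q)"
        using eq[of s 0] by simp
      then show "Re (char M1 s) = Re (char M2 s)"
        unfolding c1 c2 by (subst (1 2) integral_Re[symmetric]) (use i1 i2 in \<open>auto simp: Re_exp\<close>)
      have "(\<integral>x. f x / m * sin (s * u x) \<partial>P) = (\<integral>y. g y / m * sin (s * v y) \<partial>Q)"
        using eq[of s "- pi/2"] by (simp add: cos_add cos_diff)
      then show "Im (char M1 s) = Im (char M2 s)"
        unfolding c1 c2 by (subst (1 2) integral_Im[symmetric]) (use i1 i2 in \<open>auto simp: Im_exp\<close>)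
    qed
    then have "M1 = M2" using Levy_uniqueness[OF r1 r2] by (auto simp: fun_eq_iff)
    then have e: "emeasure M1 B = emeasure M2 B" by simp
    have e1: "emeasure M1 B = ennreal ((\<integral>x. f x * indicator B (u x) \<partial>P) / m)"
    proof -
      have "emeasure M1 B = (\<integral>\<^sup>+x. ennreal (f x / m * indicator B (u x)) \<partial>P)"
        unfolding M1_def by (simp add: emeasure_distr emeasure_density)
          (auto intro!: nn_integral_cong simp: indicator_def)
      also have "\<dots> = ennreal (\<integral>x. f x / m * indicator B (u x) \<partial>P)"
        using f m by (intro nn_integral_eq_integral P.integrable_const_bound[of _ "K / m"])
          (use K in \<open>auto intro!: AE_I2 divide_right_mono divide_nonneg_nonneg simp: indicator_def\<close>)
      also have "(\<integral>x. f x / m * indicator B (u x) \<partial>P) = (\<integral>x. f x * indicator B (u x) \<partial>P) / m"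
        by simp
      finally show ?thesis .
    qed
    have e2: "emeasure M2 B = ennreal ((\<integral>x. g x * indicator B (v x) \<partial>Q) / m)"
    proof -
      have "emeasure M2 B = (\<integral>\<^sup>+x. ennreal (g x / m * indicator B (v x)) \<partial>Q)"
        unfolding M2_def by (simp add: emeasure_distr emeasure_density)
          (auto intro!: nn_integral_cong simp: indicator_def)
      also have "\<dots> = ennreal (\<integral>x. g x / m * indicator B (v x) \<partial>Q)"
        using g m by (intro nn_integral_eq_integral Q.integrable_const_bound[of _ "K / m"])
          (use K in \<open>auto intro!: AE_I2 divide_right_mono divide_nonneg_nonneg simp: indicator_def\<close>)
      also have "(\<integral>x. g x / m * indicator B (v x) \<partial>Q) = (\<integral>x. g x * indicator B (v x) \<partial>Q) / m"
        by simp
      finally show ?thesis .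
    qed
    have n1: "0 \<le> (\<integral>x. f x * indicator B (u x) \<partial>P)"
      using f by (intro Bochner_Integration.integral_nonneg) auto
    have n2: "0 \<le> (\<integral>x. g x * indicator B (v x) \<partial>Q)"
      using g by (intro Bochner_Integration.integral_nonneg) auto
    from e n1 n2 m show ?thesis unfolding e1 e2 by (simp add: ennreal_inj)
  qed
qed

definition law :: "nat \<Rightarrow> (nat \<Rightarrow> real) measure \<Rightarrow> bool" where
  "law p P \<longleftrightarrow> prob_space P \<and> sets P = sets (Rp p)"

definition padd :: "nat \<Rightarrow> (nat \<Rightarrow> real) \<Rightarrow> (nat \<Rightarrow> real) \<Rightarrow> nat \<Rightarrow> real" where
  "padd p x y = (\<lambda>j\<in>{..<p}. x j + y j)"

definition conv :: "nat \<Rightarrow> (nat \<Rightarrow> real) measure \<Rightarrow> (nat \<Rightarrow> real) measure \<Rightarrow> (nat \<Rightarrow> real) measure" where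
  "conv p P Q = distr (P \<Otimes>\<^sub>M Q) (Rp p) (\<lambda>(x, y). padd p x y)"

definition scal :: "nat \<Rightarrow> real \<Rightarrow> (nat \<Rightarrow> real) measure \<Rightarrow> (nat \<Rightarrow> real) measure" where
  "scal p c P = distr P (Rp p) (\<lambda>x. \<lambda>j\<in>{..<p}. c * x j)"

definition char_fun :: "nat \<Rightarrow> (nat \<Rightarrow> real) measure \<Rightarrow> (nat \<Rightarrow> real) \<Rightarrow> complex" where
  "char_fun p P a = (CLINT x|P. cis (\<Sum>j<p. a j * x j))"

lemma law_space: "law p P \<Longrightarrow> space P = space (Rp p)"
  by (auto simp: law_def dest: sets_eq_imp_space_eq)

lemma law_measurable: "law p P \<Longrightarrow> measurable P N = measurable (Rp p) N"
  by (rule measurable_cong_sets) (auto simp: law_def)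

lemma component_Rp[measurable]: "j < p \<Longrightarrow> (\<lambda>x. x j) \<in> borel_measurable (Rp p)"
  unfolding Rp_def by measurable

lemma component_law: "law p P \<Longrightarrow> j < p \<Longrightarrow> (\<lambda>x. x j) \<in> borel_measurable P"
  by (simp add: law_measurable)

lemma restrict_Rp:
  assumes "\<And>j. j < p \<Longrightarrow> (\<lambda>x. f x j) \<in> borel_measurable M"
  shows "(\<lambda>x. \<lambda>j\<in>{..<p}. f x j) \<in> M \<rightarrow>\<^sub>M Rp p"
  unfolding Rp_def using assms by (intro measurable_restrict) auto

lemma padd_measurable:
  assumes "law p P" "law p Q"
  shows "(\<lambda>(x, y). padd p x y) \<in> P \<Otimes>\<^sub>M Q \<rightarrow>\<^sub>M Rp p"
proof -
  have [measurable]: "(\<lambda>x. x j) \<in> borel_measurable P" "(\<lambda>x. x j) \<in> borel_measurable Q" if "j < p" for j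
    using assms that by (auto intro: component_law)
  show ?thesis unfolding padd_def split_beta by (intro restrict_Rp) measurable
qed

lemma law_conv: assumes "law p P" "law p Q" shows "law p (conv p P Q)"
proof -
  interpret P: prob_space P using assms by (simp add: law_def)
  interpret Q: prob_space Q using assms by (simp add: law_def)
  interpret PQ: pair_prob_space P Q ..
  show ?thesis unfolding law_def conv_def
    using padd_measurable[OF assms] by (auto intro!: PQ.prob_space_distr)
qed

lemma law_distr: "prob_space M \<Longrightarrow> f \<in> M \<rightarrow>\<^sub>M Rp p \<Longrightarrow> law p (distr M (Rp p) f)"
  by (auto simp: law_def intro!: prob_space.prob_space_distr)

lemma scal_measurable: "law p P \<Longrightarrow> (\<lambda>x. \<lambda>j\<in>{..<p}. c * x j) \<in> P \<rightarrow>\<^sub>M Rp p"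
  by (intro restrict_Rp borel_measurable_times component_law) auto

lemma law_scal: "law p P \<Longrightarrow> law p (scal p c P)"
  unfolding scal_def by (intro law_distr scal_measurable) (auto simp: law_def)

lemma integral_conv:
  fixes f :: "_ \<Rightarrow> 'b::{banach, second_countable_topology}"
  assumes "law p P" "law p Q" and f[measurable]: "f \<in> borel_measurable (Rp p)" and b: "\<And>x. norm (f x) \<le> K"
  shows "integral\<^sup>L (conv p P Q) f = (\<integral>x. (\<integral>y. f (padd p x y) \<partial>Q) \<partial>P)"
proof -
  interpret P: prob_space P using assms by (simp add: law_def)
  interpret Q: prob_space Q using assms by (simp add: law_def)
  interpret PQ: pair_prob_space P Q ..
  note [measurable] = padd_measurable[OF assms(1,2)]
  have "integral\<^sup>L (conv p P Q) f = (\<integral>z. f ((\<lambda>(x, y). padd p x y) z) \<partial>(P \<Otimes>\<^sub>M Q))"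
    unfolding conv_def by (intro integral_distr) auto
  also have "\<dots> = (\<integral>x. (\<integral>y. f ((\<lambda>(x, y). padd p x y) (x, y)) \<partial>Q) \<partial>P)"
    by (intro PQ.integral_fst'[symmetric] PQ.integrable_const_bound[of _ K]) (auto simp: b)
  finally show ?thesis by simp
qed

lemma char_fun_conv:
  assumes "law p P" "law p Q" shows "char_fun p (conv p P Q) a = char_fun p P a * char_fun p Q a"
proof -
  have "char_fun p (conv p P Q) a = (\<integral>x. (\<integral>y. cis (\<Sum>j<p. a j * padd p x y j) \<partial>Q) \<partial>P)"
    unfolding char_fun_def cis_conv_exp by (subst integral_conv[OF assms, where K=1]) (auto simp: )
  also have "\<dots> = (\<integral>x. (\<integral>y. cis (\<Sum>j<p. a j * x j) * cis (\<Sum>j<p. a j * y j) \<partial>Q) \<partial>P)"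
    by (simp add: cis_mult padd_def sum.distrib[symmetric] algebra_simps)
  also have "\<dots> = char_fun p P a * char_fun p Q a" by (simp add: char_fun_def)
  finally show ?thesis .
qed

lemma char_fun_distr:
  assumes [measurable]: "f \<in> M \<rightarrow>\<^sub>M Rp p"
  shows "char_fun p (distr M (Rp p) f) a = (CLINT x|M. cis (\<Sum>j<p. a j * f x j))"
  unfolding char_fun_def cis_conv_exp by (subst integral_distr) auto

lemma char_fun_scal: assumes "law p P" shows "char_fun p (scal p c P) a = char_fun p P (\<lambda>j. c * a j)"
  unfolding scal_def by (subst char_fun_distr[OF scal_measurable[OF assms]]) (simp add: char_fun_def ac_simps)

lemma cos_char_fun:
  assumes "law p P"
  shows "(\<integral>x. cos ((\<Sum>j<p. a j * x j) + c) \<partial>P) = Re (cis c * char_fun p P a)"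
proof -
  interpret prob_space P using assms by (simp add: law_def)
  note [measurable] = component_law[OF assms]
  have i: "integrable P (\<lambda>x. cis ((\<Sum>j<p. a j * x j) + c))"
    unfolding cis_conv_exp by (rule integrable_const_bound[of _ 1]) auto
  have "(\<integral>x. cos ((\<Sum>j<p. a j * x j) + c) \<partial>P) = (\<integral>x. Re (cis ((\<Sum>j<p. a j * x j) + c)) \<partial>P)" by simp
  also have "\<dots> = Re (CLINT x|P. cis ((\<Sum>j<p. a j * x j) + c))" by (rule integral_Re[OF i])
  also have "(CLINT x|P. cis ((\<Sum>j<p. a j * x j) + c)) = (CLINT x|P. cis c * cis (\<Sum>j<p. a j * x j))"
    by (simp add: cis_mult add.commute)
  finally show ?thesis by (simp add: char_fun_def)
qed

lemma cos_prod: "cos x * cos y = (cos (x + y) + cos (x - y :: real)) / 2"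
  by (simp add: cos_add cos_diff)

text \<open>The characteristic functions are the case \<open>k = 0\<close>; at \<open>k = p\<close> only indicators of product sets are
left. In the step, the factor of coordinate \<open>k\<close> is split off the cosine and exchanged for an
indicator by \<open>weighted_char_unique\<close>. Weights have to be nonnegative, so the cosine of the remaining
coordinates enters as \<open>1 + cos\<close>, and the contribution of the summand \<open>1\<close> is subtracted at the end.\<close>

lemma char_fun_unique_aux:
  assumes P: "law p P" and Q: "law p Q" and eq: "\<And>a. char_fun p P a = char_fun p Q a"
    and "k \<le> p" and B: "\<And>j. B j \<in> sets (borel :: real measure)"
  shows "(\<integral>x. (\<Prod>j<k. indicator (B j) (x j)) * cos ((\<Sum>j\<in>{k..<p}. a j * x j) + c) \<partial>P) =
         (\<integral>x. (\<Prod>j<k. indicator (B j) (x j)) * cos ((\<Sum>j\<in>{k..<p}. a j * x j) + c) \<partial>Q)"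
  using \<open>k \<le> p\<close>
proof (induction k arbitrary: a c)
  case 0
  show ?case using eq by (simp add: cos_char_fun[OF P] cos_char_fun[OF Q] lessThan_atLeast0[symmetric])
next
  case (Suc k)
  then have kp: "k < p" by simp
  interpret P: prob_space P using P by (simp add: law_def)
  interpret Q: prob_space Q using Q by (simp add: law_def)
  note [measurable] = component_law[OF P] component_law[OF Q] B
  let ?w = "\<lambda>x. (\<Prod>j<k. indicator (B j) (x j)) :: real"
  let ?t = "\<lambda>a x. (\<Sum>j\<in>{Suc k..<p}. a j * x j) :: real"
  have w01: "0 \<le> ?w x \<and> ?w x \<le> 1" for x by (auto intro!: prod_nonneg prod_le_1)
  have split: "(\<Sum>j\<in>{k..<p}. b j * x j) = b k * x k + ?t b x" for b x
    using kp by (simp add: sum.atLeast_Suc_lessThan)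
  note IH = Suc.IH[OF less_imp_le[OF kp]]
  have wI: "integrable M (\<lambda>x. ?w x * cos (g x))"
    if "law p M" "g \<in> borel_measurable M" for M and g :: "_ \<Rightarrow> real"
  proof -
    interpret M: prob_space M using that by (simp add: law_def)
    note [measurable] = component_law[OF that(1)] that(2)
    show ?thesis
      by (rule M.integrable_const_bound[of _ 1], rule AE_I2) (use kp w01 in \<open>auto simp: abs_mult intro!: mult_le_one\<close>)
  qed
  have e0: "(\<integral>x. ?w x * cos (s * x k + d) \<partial>P) = (\<integral>x. ?w x * cos (s * x k + d) \<partial>Q)" for s d
    using IH[of "\<lambda>j. if j = k then s else 0" d] unfolding split by simp
  have e1: "(\<integral>x. ?w x * cos (s * x k + ?t a x + d) \<partial>P) = (\<integral>x. ?w x * cos (s * x k + ?t a x + d) \<partial>Q)" for s d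
  proof -
    have [simp]: "?t (\<lambda>j. if j = k then s else a j) x = ?t a x" for x by (intro sum.cong) auto
    show ?thesis using IH[of "\<lambda>j. if j = k then s else a j" d] unfolding split by simp
  qed
  have e1': "(\<integral>x. ?w x * cos (- ?t a x + (s * x k + d)) \<partial>P) = (\<integral>x. ?w x * cos (- ?t a x + (s * x k + d)) \<partial>Q)" for s d
    using e1[of "-s" "-d"] cos_minus[of "- ?t a x + (s * x k + d)" for x]
    by (simp add: algebra_simps)
  have m0: "(\<lambda>x. ?w x) \<in> borel_measurable P" "(\<lambda>x. ?w x) \<in> borel_measurable Q"
     "(\<lambda>x. x k) \<in> borel_measurable P" "(\<lambda>x. x k) \<in> borel_measurable Q"
     "(\<lambda>x. ?t a x) \<in> borel_measurable P" "(\<lambda>x. ?t a x) \<in> borel_measurable Q"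
    using kp by (auto intro!: borel_measurable_prod borel_measurable_sum borel_measurable_times borel_measurable_indicator'
      component_law[OF P] component_law[OF Q] B measurable_compose[OF component_law[OF P] borel_measurable_indicator]
      measurable_compose[OF component_law[OF Q] borel_measurable_indicator])
  note [measurable] = m0
  have r0: "(\<integral>x. ?w x * indicator (B k) (x k) \<partial>P) = (\<integral>x. ?w x * indicator (B k) (x k) \<partial>Q)"
    by (rule weighted_char_unique[where K=1]) (use P.prob_space_axioms Q.prob_space_axioms w01 e0 B in auto)
  have r1: "(\<integral>x. (?w x * (1 + cos (?t a x + c))) * indicator (B k) (x k) \<partial>P) =
            (\<integral>x. (?w x * (1 + cos (?t a x + c))) * indicator (B k) (x k) \<partial>Q)"
  proof (rule weighted_char_unique[where K=2])
    have c1: "0 \<le> 1 + cos t" "1 + cos t \<le> 2" for t :: real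
      using cos_ge_minus_one[of t] cos_le_one[of t] by linarith+
    show "0 \<le> ?w x * (1 + cos (?t a x + c)) \<and> ?w x * (1 + cos (?t a x + c)) \<le> 2" for x
      using w01[of x] c1[of "?t a x + c"] mult_mono[of "?w x" 1 "1 + cos (?t a x + c)" 2] by auto
    then show "0 \<le> ?w x * (1 + cos (?t a x + c)) \<and> ?w x * (1 + cos (?t a x + c)) \<le> 2" for x .
    fix s d
    have ex: "?w x * (1 + cos (?t a x + c)) * cos (s * x k + d) = ?w x * cos (s * x k + d) +
       (?w x * cos (s * x k + ?t a x + (c + d)) + ?w x * cos (- ?t a x + (s * x k + (d - c)))) / 2" for x
    proof -
      have "cos (?t a x + c) * cos (s * x k + d) = (cos (s * x k + ?t a x + (c + d)) + cos (- ?t a x + (s * x k + (d - c)))) / 2"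
        proof -
        have 1: "s * x k + d + (?t a x + c) = s * x k + ?t a x + (c + d)" by simp
        have 2: "s * x k + d - (?t a x + c) = - ?t a x + (s * x k + (d - c))" by simp
        show ?thesis by (subst mult.commute) (simp only: cos_prod 1 2)
      qed
      moreover have "w * (1 + C) * D = w * D + (w * A + w * B) / 2" if "C * D = (A + B) / 2" for w A B C D :: real
      proof -
        have "w * (1 + C) * D = w * D + w * (C * D)" by (simp add: algebra_simps)
        then show ?thesis unfolding that by (simp add: algebra_simps)
      qed
      ultimately show ?thesis by blast
    qed
    show "(\<integral>x. ?w x * (1 + cos (?t a x + c)) * cos (s * x k + d) \<partial>P) =
          (\<integral>x. ?w x * (1 + cos (?t a x + c)) * cos (s * x k + d) \<partial>Q)"
    proof -
      have lin: "(\<integral>x. D x + (A x + B x) / 2 \<partial>M) = (\<integral>x. D x \<partial>M) + ((\<integral>x. A x \<partial>M) + (\<integral>x. B x \<partial>M)) / 2"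
        if "integrable M A" "integrable M B" "integrable M D" for M and A B D :: "(nat \<Rightarrow> real) \<Rightarrow> real"
        using that by simp
      have mP: "(\<lambda>x. s * x k + d) \<in> borel_measurable P" "(\<lambda>x. s * x k + ?t a x + (c + d)) \<in> borel_measurable P"
         "(\<lambda>x. - ?t a x + (s * x k + (d - c))) \<in> borel_measurable P" by measurable
      have mQ: "(\<lambda>x. s * x k + d) \<in> borel_measurable Q" "(\<lambda>x. s * x k + ?t a x + (c + d)) \<in> borel_measurable Q"
         "(\<lambda>x. - ?t a x + (s * x k + (d - c))) \<in> borel_measurable Q" by measurable
      show ?thesis unfolding ex lin[OF wI[OF P mP(2)] wI[OF P mP(3)] wI[OF P mP(1)]]
          lin[OF wI[OF Q mQ(2)] wI[OF Q mQ(3)] wI[OF Q mQ(1)]]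
        unfolding e0 e1 e1' ..
    qed
  qed (use P.prob_space_axioms Q.prob_space_axioms B in auto)
  have ex: "(\<Prod>j<Suc k. indicator (B j) (x j)) * cos (?t a x + c) =
     (?w x * (1 + cos (?t a x + c))) * indicator (B k) (x k) - ?w x * indicator (B k) (x k)" for x
    by (simp add: algebra_simps)
  have i: "integrable M (\<lambda>x. (?w x * (1 + cos (?t a x + c))) * indicator (B k) (x k))"
          "integrable M (\<lambda>x. ?w x * indicator (B k) (x k))" if "law p M" for M
  proof -
    interpret M: prob_space M using that by (simp add: law_def)
    note [measurable] = component_law[OF that(1)]
    have m1[measurable]: "(\<lambda>x. ?w x) \<in> borel_measurable M" "(\<lambda>x. x k) \<in> borel_measurable M"
       "(\<lambda>x. ?t a x) \<in> borel_measurable M"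
      using kp by (auto intro!: borel_measurable_prod borel_measurable_sum borel_measurable_times component_law[OF that(1)]
      measurable_compose[OF component_law[OF that(1)] borel_measurable_indicator] B)
    have c1: "\<bar>1 + cos t\<bar> \<le> 2" for t :: real
      using cos_ge_minus_one[of t] cos_le_one[of t] by linarith
    show "integrable M (\<lambda>x. (?w x * (1 + cos (?t a x + c))) * indicator (B k) (x k))"
    proof (rule M.integrable_const_bound[of _ 2], rule AE_I2)
      fix x
      have "\<bar>?w x\<bar> * \<bar>1 + cos (?t a x + c)\<bar> \<le> 1 * 2" using w01[of x] by (intro mult_mono c1) auto
      then show "norm ((?w x * (1 + cos (?t a x + c))) * indicator (B k) (x k)) \<le> 2"
        by (cases "x k \<in> B k") (simp_all add: abs_mult)
    qed (rule borel_measurable_times m1 borel_measurable_add borel_measurable_const borel_measurable_continuous_on[OF continuous_on_cos[OF continuous_on_id]] measurable_compose[OF m1(2) borel_measurable_indicator[OF B]])+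
    show "integrable M (\<lambda>x. ?w x * indicator (B k) (x k))"
      using w01 by (intro M.integrable_const_bound[of _ 1] AE_I2 borel_measurable_times m1
        measurable_compose[OF m1(2) borel_measurable_indicator[OF B]]) (auto simp: abs_mult indicator_def)
  qed
  show ?case unfolding ex using i[OF P] i[OF Q] r0 r1 by simp
qed

theorem char_fun_unique:
  assumes P: "law p P" and Q: "law p Q" and eq: "\<And>a. char_fun p P a = char_fun p Q a"
  shows "P = Q"
proof (rule measure_eqI_PiM_finite[of "{..<p}" _ "\<lambda>_. borel"])
  interpret P: prob_space P using P by (simp add: law_def)
  interpret Q: prob_space Q using Q by (simp add: law_def)
  show "sets P = sets (\<Pi>\<^sub>M i\<in>{..<p}. borel)" "sets Q = sets (\<Pi>\<^sub>M i\<in>{..<p}. borel)"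
    using P Q by (auto simp: law_def Rp_def)
  show "emeasure P (Pi\<^sub>E {..<p} A) = emeasure Q (Pi\<^sub>E {..<p} A)" if A: "\<And>i. i \<in> {..<p} \<Longrightarrow> A i \<in> sets borel" for A
  proof -
    define B where "B j = (if j < p then A j else {})" for j
    have B: "B j \<in> sets borel" for j using A by (auto simp: B_def)
    have e: "emeasure M (Pi\<^sub>E {..<p} A) = ennreal (\<integral>x. (\<Prod>j<p. indicator (B j) (x j)) * cos ((\<Sum>j\<in>{p..<p}. 0 * x j) + 0) \<partial>M)"
      if M: "law p M" for M
    proof -
      interpret M: prob_space M using M by (simp add: law_def)
      have S: "Pi\<^sub>E {..<p} A \<in> sets M" using M A by (auto simp: law_def Rp_def)
      have "(\<integral>x. (\<Prod>j<p. indicator (B j) (x j)) * cos ((\<Sum>j\<in>{p..<p}. 0 * x j) + 0) \<partial>M) = (\<integral>x. indicator (Pi\<^sub>E {..<p} A) x \<partial>M)"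
        using law_space[OF M]
        by (intro Bochner_Integration.integral_cong) (auto simp: indicator_def B_def prod_zero_iff PiE_iff Rp_def space_PiM split: if_splits)
      also have "\<dots> = measure M (Pi\<^sub>E {..<p} A)" using S by simp
      finally show ?thesis by (simp add: M.emeasure_eq_measure)
    qed
    show ?thesis unfolding e[OF P] e[OF Q] using char_fun_unique_aux[OF P Q eq order_refl B, where a="\<lambda>_. 0" and c=0] by simp
  qed
  show "range (\<lambda>_::nat. space (Pi\<^sub>M {..<p} (\<lambda>_. borel :: real measure))) \<subseteq> prod_algebra {..<p} (\<lambda>_. borel)"
    using space_in_prod_algebra[of "{..<p}" "\<lambda>_. borel :: real measure"] by (auto simp: space_PiM)
  show "emeasure P (space (Pi\<^sub>M {..<p} (\<lambda>_. borel :: real measure))) \<noteq> \<infinity>"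
    by (simp add: P.emeasure_eq_measure)
qed simp_all

section \<open>The univariate normal distribution function\<close>

definition Phi :: "real \<Rightarrow> real" where "Phi t = measure std_normal_distribution {..t}"

abbreviation phi :: "real \<Rightarrow> real" where "phi \<equiv> std_normal_density"

interpretation N1: real_distribution std_normal_distribution by (rule real_dist_normal_dist)

lemma measure_std_normal: "a \<le> b \<Longrightarrow> measure std_normal_distribution {a..b} = integral {a..b} phi"
proof -
  have "measure std_normal_distribution {a..b} = (\<integral>x. indicator {a..b} x \<partial>std_normal_distribution)" by simp
  also have "\<dots> = (\<integral>x. phi x * indicator {a..b} x \<partial>lborel)"
    by (subst integral_real_density) auto
  also have "\<dots> = (LINT x:{a..b}|lborel. phi x)" by (simp add: set_lebesgue_integral_def mult.commute)
  also have "\<dots> = integral {a..b} phi"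
    by (rule set_borel_integral_eq_integral(2))
       (unfold set_integrable_def, rule integrable_mult_indicator, auto)
  finally show ?thesis .
qed

lemma measure_std_normal_point: "measure std_normal_distribution {a} = 0"
  using measure_std_normal[of a a] by simp

lemma measure_Icc_Phi: "a \<le> b \<Longrightarrow> measure std_normal_distribution {a..b} = Phi b - Phi a"
proof -
  assume ab: "a \<le> b"
  have "Phi b = measure std_normal_distribution ({..<a} \<union> {a..b})" unfolding Phi_def using ab
    by (intro arg_cong[where f="measure _"]) auto
  also have "\<dots> = measure std_normal_distribution {..<a} + measure std_normal_distribution {a..b}"
    by (rule N1.finite_measure_Union) auto
  also have "measure std_normal_distribution {..<a} = Phi a"
  proof -
    have "Phi a = measure std_normal_distribution ({..<a} \<union> {a})" unfolding Phi_def
      by (intro arg_cong[where f="measure _"]) auto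
    also have "\<dots> = measure std_normal_distribution {..<a} + measure std_normal_distribution {a}"
      by (rule N1.finite_measure_Union) auto
    finally show ?thesis by (simp add: measure_std_normal_point)
  qed
  finally show ?thesis by simp
qed

lemma phi_cont: "continuous_on A phi"
  unfolding std_normal_density_def by (intro continuous_intros) auto

lemma Phi_deriv: "(Phi has_real_derivative phi t) (at t)"
proof -
  have "((\<lambda>x. integral {t-1..x} phi) has_real_derivative phi t) (at t within {t-1..t+1})"
    by (rule integral_has_real_derivative) (auto intro: phi_cont)
  then have "((\<lambda>x. integral {t-1..x} phi + Phi (t-1)) has_real_derivative phi t) (at t)"
    by (auto simp: at_within_Icc_at intro!: derivative_eq_intros)
  then show ?thesis
  proof (rule has_field_derivative_transform_within_open)
    show "open {t-1<..<t+1}" "t \<in> {t-1<..<t+1}" by auto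
    show "\<And>x. x \<in> {t - 1<..<t + 1} \<Longrightarrow> integral {t - 1..x} phi + Phi (t - 1) = Phi x"
      by (subst measure_std_normal[symmetric]) (auto simp: measure_Icc_Phi)
  qed
qed

lemma Phi_deriv'[derivative_intros]:
  "(f has_real_derivative d) (at x within A) \<Longrightarrow> ((\<lambda>x. Phi (f x)) has_real_derivative phi (f x) * d) (at x within A)"
  by (rule DERIV_chain2[OF Phi_deriv])

lemma phi_deriv'[derivative_intros]:
  assumes "(f has_real_derivative d) (at x within A)"
  shows "((\<lambda>x. phi (f x)) has_real_derivative (- f x * phi (f x)) * d) (at x within A)"
proof (rule DERIV_chain2[OF _ assms])
  show "(phi has_real_derivative - f x * phi (f x)) (at (f x))"
    unfolding std_normal_density_def
    by (auto intro!: derivative_eq_intros simp: field_simps)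
qed

lemma Phi_lim_top: "(Phi \<longlongrightarrow> 1) at_top"
  using N1.cdf_lim_at_top_prob by (simp add: cdf_def Phi_def[abs_def])

lemma Phi_lim_bot: "(Phi \<longlongrightarrow> 0) at_bot"
  using N1.cdf_lim_at_bot by (simp add: cdf_def Phi_def[abs_def])

lemma Phi_mono: "x \<le> y \<Longrightarrow> Phi x \<le> Phi y"
  unfolding Phi_def by (intro N1.finite_measure_mono) auto

lemma Phi_bounds: "0 \<le> Phi x" "Phi x \<le> 1"
  by (auto simp: Phi_def)

lemma phi_pos: "0 < phi t" by (simp add: normal_density_pos)

lemma phi_minus: "phi (- t) = phi t" by (simp add: std_normal_density_def)

lemma Phi_minus: "Phi (- t) = 1 - Phi t"
proof -
  let ?f = "\<lambda>t. Phi t + Phi (- t)"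
  have "(?f has_real_derivative 0) (at x)" for x
    by (auto intro!: derivative_eq_intros simp: phi_minus)
  then have c: "?f x = ?f t" for x by (rule DERIV_isconst_all[rule_format])
  have "(?f \<longlongrightarrow> 1 + 0) at_top"
    by (intro tendsto_add Phi_lim_top filterlim_compose[OF Phi_lim_bot filterlim_uminus_at_bot_at_top])
  moreover have "(?f \<longlongrightarrow> ?f t) at_top" by (subst c) simp
  ultimately have "?f t = 1" using tendsto_unique[of at_top ?f] by (simp add: trivial_limit_at_top_linorder)
  then show ?thesis by simp
qed

lemma phi_sqrt2: "phi (t / sqrt 2) = exp (t\<^sup>2 / 4) * phi t"
proof -
  have "exp (- (t\<^sup>2 / 4)) = exp (t\<^sup>2 / 4) * exp (- (t\<^sup>2 / 2))" by (simp add: exp_add[symmetric])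
  then show ?thesis by (simp add: std_normal_density_def power_divide field_simps)
qed

lemma Phi_sqrt2_top: "((\<lambda>t. Phi (t / sqrt 2)) \<longlongrightarrow> 1) at_top"
  by (rule filterlim_compose[OF Phi_lim_top]) real_asymp

lemma Phi_sqrt2_bot: "((\<lambda>t. Phi (t / sqrt 2)) \<longlongrightarrow> 0) at_bot"
  by (rule filterlim_compose[OF Phi_lim_bot]) real_asymp

lemma tendsto_mono_limits:
  fixes f :: "real \<Rightarrow> real"
  assumes "mono f"
  shows "(f \<longlongrightarrow> l) at_top \<Longrightarrow> f x \<le> l" "(f \<longlongrightarrow> m) at_bot \<Longrightarrow> m \<le> f x"
proof -
  show "f x \<le> l" if "(f \<longlongrightarrow> l) at_top"
    by (rule tendsto_lowerbound[OF that]) (auto intro: eventually_at_top_linorderI[of x] monoD[OF assms])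
  show "m \<le> f x" if "(f \<longlongrightarrow> m) at_bot"
    by (rule tendsto_upperbound[OF that]) (auto intro: eventually_at_bot_linorderI[of x] monoD[OF assms])
qed

text \<open>Both \<open>T + G\<close> and \<open>T - G\<close> are increasing for the distribution function
\<open>T t = c * Phi t + sqrt 2 * d * Phi (t / sqrt 2)\<close>. Hence increments of \<open>G\<close> over \<open>{x..y}\<close> are bounded by those of
\<open>T\<close>, and, as \<open>G\<close> vanishes at both ends of the line, also by the increments of \<open>T\<close> over the complement of
\<open>{x..y}\<close>. The second density has heavier tails and absorbs the part of \<open>G'\<close> far from the origin.\<close>

lemma Phi_majorant:
  assumes d: "\<And>t. (G has_real_derivative G' t) (at t)"
    and b: "\<And>t. \<bar>G' t\<bar> \<le> c * phi t + d * phi (t / sqrt 2)"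
    and c: "0 \<le> c" "0 \<le> d" and lim: "(G \<longlongrightarrow> 0) at_top" "(G \<longlongrightarrow> 0) at_bot"
    and "x \<le> y"
  shows "\<bar>G y - G x\<bar> \<le> c * min (Phi y - Phi x) (1 - (Phi y - Phi x)) + 3 * d"
proof -
  \<comment> \<open>the factor \<open>sqrt 2\<close> turns \<open>phi (t / sqrt 2)\<close> into the derivative of \<open>Phi (t / sqrt 2)\<close>\<close>
  define T where "T t = c * Phi t + (sqrt 2 * d) * Phi (t / sqrt 2)" for t
  have T': "(T has_real_derivative c * phi t + d * phi (t / sqrt 2)) (at t)" for t
    unfolding T_def by (auto intro!: derivative_eq_intros simp: )
  have Ttop: "(T \<longlongrightarrow> c * 1 + (sqrt 2 * d) * 1) at_top" unfolding T_def
    by (intro tendsto_intros Phi_lim_top Phi_sqrt2_top)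
  have Tbot: "(T \<longlongrightarrow> c * 0 + (sqrt 2 * d) * 0) at_bot" unfolding T_def
    by (intro tendsto_intros Phi_lim_bot Phi_sqrt2_bot)
  have m1: "mono (\<lambda>t. T t + G t)"
  proof (rule monoI)
    fix u v :: real assume "u \<le> v"
    then show "T u + G u \<le> T v + G v"
    proof (rule DERIV_nonneg_imp_nondecreasing)
      fix t
      show "\<exists>y. ((\<lambda>t. T t + G t) has_real_derivative y) (at t) \<and> 0 \<le> y"
        using b[of t] DERIV_add[OF T' d, of t] by (auto simp: abs_le_iff intro!: exI)
    qed
  qed
  have m2: "mono (\<lambda>t. T t - G t)"
  proof (rule monoI)
    fix u v :: real assume "u \<le> v"
    then show "T u - G u \<le> T v - G v"
    proof (rule DERIV_nonneg_imp_nondecreasing)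
      fix t
      show "\<exists>y. ((\<lambda>t. T t - G t) has_real_derivative y) (at t) \<and> 0 \<le> y"
        using b[of t] DERIV_diff[OF T' d, of t] by (auto simp: abs_le_iff intro!: exI)
    qed
  qed
  have l1: "T t + G t \<le> c * 1 + (sqrt 2 * d) * 1 + 0" "c * 0 + (sqrt 2 * d) * 0 + 0 \<le> T t + G t" for t
    by (rule tendsto_mono_limits[OF m1] tendsto_add Ttop Tbot lim)+
  have l2: "T t - G t \<le> c * 1 + (sqrt 2 * d) * 1 - 0" "c * 0 + (sqrt 2 * d) * 0 - 0 \<le> T t - G t" for t
    by (rule tendsto_mono_limits[OF m2] tendsto_diff Ttop Tbot lim)+
  have Gy: "\<bar>G y\<bar> \<le> c * (1 - Phi y) + sqrt 2 * d * (1 - Phi (y / sqrt 2))"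
    using l1(1)[of y] l2(1)[of y] by (auto simp: abs_le_iff T_def algebra_simps)
  have Gx: "\<bar>G x\<bar> \<le> c * Phi x + sqrt 2 * d * Phi (x / sqrt 2)"
    using l1(2)[of x] l2(2)[of x] by (auto simp: abs_le_iff T_def algebra_simps)
  have Gxy: "\<bar>G y - G x\<bar> \<le> T y - T x"
    using monoD[OF m1 \<open>x \<le> y\<close>] monoD[OF m2 \<open>x \<le> y\<close>] by (auto simp: abs_le_iff)
  have s2: "sqrt 2 * d \<le> 3/2 * d" by (intro mult_right_mono real_le_lsqrt c) (auto simp: power2_eq_square)
  have 1: "sqrt 2 * d * z \<le> 3/2 * d" if "0 \<le> z" "z \<le> 1" for z
    by (rule order_trans[OF mult_left_le s2]) (use that c in auto)
  have "\<bar>G y - G x\<bar> \<le> c * (Phi y - Phi x) + 3 * d"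
    using Gxy 1[of "Phi (y / sqrt 2) - Phi (x / sqrt 2)"] Phi_bounds[of "y / sqrt 2"] Phi_bounds[of "x / sqrt 2"]
      Phi_mono[of "x / sqrt 2" "y / sqrt 2"] \<open>x \<le> y\<close> c by (auto simp: T_def algebra_simps divide_right_mono)
  moreover have "\<bar>G y - G x\<bar> \<le> c * (1 - (Phi y - Phi x)) + 3 * d"
    using Gx Gy 1[of "Phi (x / sqrt 2)"] 1[of "1 - Phi (y / sqrt 2)"] Phi_bounds[of "y / sqrt 2"] Phi_bounds[of "x / sqrt 2"]
    abs_triangle_ineq4[of "G y" "G x"] by (simp add: algebra_simps)
  ultimately show ?thesis by (auto simp: min_def)
qed

lemma cube_le_exp: "4 * \<bar>t\<bar>^3 \<le> 256 * exp (t\<^sup>2 / 8 :: real)"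
proof -
  define u where "u = t\<^sup>2 / 8"
  have u: "0 \<le> u" by (simp add: u_def)
  have "1 + u + u^2 / 2 \<le> exp u" by (rule exp_lower_Taylor_quadratic[OF u])
  moreover have "\<bar>t\<bar>^3 \<le> (t^2 + t^4) / 2"
  proof -
    have "0 \<le> \<bar>t\<bar>^2 * (\<bar>t\<bar> - 1)\<^sup>2" by simp
    also have "\<dots> = t^2 + t^4 - 2 * \<bar>t\<bar>^3"
      by (cases "t \<ge> 0") (simp_all add: power2_eq_square power3_eq_cube power4_eq_xxxx algebra_simps)
    finally show ?thesis by simp
  qed
  moreover have "t^2 = 8 * u" "t^4 = 64 * u^2" by (auto simp: u_def power_divide power_mult[symmetric])
  ultimately show ?thesis unfolding u_def[symmetric] using u by (simp)
qed

lemma exp_split_tail: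
  fixes s t :: real
  assumes "1 \<le> s" "s \<le> \<bar>t\<bar>"
  shows "4 * \<bar>t\<bar>^3 \<le> 256 * exp (- s\<^sup>2 / 8) * exp (t\<^sup>2 / 4)"
proof -
  have "s\<^sup>2 \<le> t\<^sup>2" using assms by (metis abs_ge_zero abs_le_square_iff abs_of_nonneg order_trans zero_le_one)
  then have "exp (t\<^sup>2 / 8) \<le> exp (- s\<^sup>2 / 8 + t\<^sup>2 / 4)" by simp
  also have "\<dots> = exp (- s\<^sup>2 / 8) * exp (t\<^sup>2 / 4)" by (rule exp_add)
  finally show ?thesis using cube_le_exp[of t] by linarith
qed

text \<open>The derivatives of the normal density are Hermite polynomials times the density. Up to \<open>s\<close> in absolute
value the polynomial of degree \<open>m\<close> is at most \<open>(2 * s) ^ m\<close>; beyond \<open>s\<close> it is charged to the wider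
normal density, at a price that decays with \<open>s\<close>.\<close>

lemma hermite_bounds:
  fixes s t :: real
  assumes s: "1 \<le> s"
  defines "d \<equiv> 256 * exp (- s\<^sup>2 / 8)"
  shows "\<bar>- t * phi t\<bar> \<le> 2 * s * phi t + d * phi (t / sqrt 2)"
    "\<bar>(t\<^sup>2 - 1) * phi t\<bar> \<le> (2 * s)\<^sup>2 * phi t + d * phi (t / sqrt 2)"
    "\<bar>(3 * t - t^3) * phi t\<bar> \<le> (2 * s)^3 * phi t + d * phi (t / sqrt 2)"
proof -
  have d: "0 \<le> d * exp (t\<^sup>2 / 4)" unfolding d_def by simp
  have t: "4 * \<bar>t\<bar>^3 \<le> d * exp (t\<^sup>2 / 4)" if "\<not> \<bar>t\<bar> \<le> s"
    unfolding d_def using exp_split_tail[of s t] that s by simp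
  have p1: "\<bar>t\<bar> \<le> \<bar>t\<bar>^3" "t\<^sup>2 \<le> \<bar>t\<bar>^3" "1 \<le> \<bar>t\<bar>^3" if "\<not> \<bar>t\<bar> \<le> s"
    using s that power_increasing[of 1 3 "\<bar>t\<bar>"] power_increasing[of 2 3 "\<bar>t\<bar>"] power_increasing[of 0 3 "\<bar>t\<bar>"] by auto
  have s1: "s \<le> s^3" "1 \<le> s\<^sup>2" using s power_increasing[of 1 3 s] by auto
  have ts: "t\<^sup>2 \<le> s\<^sup>2" "\<bar>t\<bar>^3 \<le> s^3" if "\<bar>t\<bar> \<le> s"
    using that s power_mono[of "\<bar>t\<bar>" s 2] power_mono[of "\<bar>t\<bar>" s 3] by auto
  have 1: "\<bar>- t\<bar> \<le> 2 * s + d * exp (t\<^sup>2 / 4)"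
    using d t p1 s by (cases "\<bar>t\<bar> \<le> s") auto
  have 2: "\<bar>t\<^sup>2 - 1\<bar> \<le> (2 * s)\<^sup>2 + d * exp (t\<^sup>2 / 4)"
  proof -
    have "\<bar>t\<^sup>2 - 1\<bar> \<le> t\<^sup>2 + 1" by (cases "1 \<le> t\<^sup>2") (auto simp: abs_if)
    moreover have "0 \<le> (2 * s)\<^sup>2" by simp
    ultimately show ?thesis using d t p1 s1 ts by (cases "\<bar>t\<bar> \<le> s") (auto simp: power_mult_distrib)
  qed
  have 3: "\<bar>3 * t - t^3\<bar> \<le> (2 * s)^3 + d * exp (t\<^sup>2 / 4)"
  proof -
    have "\<bar>3 * t - t^3\<bar> \<le> 3 * \<bar>t\<bar> + \<bar>t\<bar>^3" using abs_triangle_ineq4[of "3*t" "t^3"] by (simp add: power_abs abs_mult)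
    moreover have "(2 * s)^3 = 8 * s^3" "0 \<le> s^3" using s by (simp_all add: power_mult_distrib)
    ultimately show ?thesis using d t p1 s1 ts by (cases "\<bar>t\<bar> \<le> s") linarith+
  qed
  have m: "\<bar>a * phi t\<bar> \<le> b * phi t + d * phi (t / sqrt 2)" if "\<bar>a\<bar> \<le> b + d * exp (t\<^sup>2 / 4)" for a b
    using mult_right_mono[OF that, of "phi t"] phi_pos[of t] unfolding phi_sqrt2 by (simp add: abs_mult algebra_simps)
  show "\<bar>- t * phi t\<bar> \<le> 2 * s * phi t + d * phi (t / sqrt 2)"
    "\<bar>(t\<^sup>2 - 1) * phi t\<bar> \<le> (2 * s)\<^sup>2 * phi t + d * phi (t / sqrt 2)"
    "\<bar>(3 * t - t^3) * phi t\<bar> \<le> (2 * s)^3 * phi t + d * phi (t / sqrt 2)"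
    by (rule m 1 2 3)+
qed

text \<open>At distance \<open>s\<close> the normal tails are below the tolerance \<open>\<tau>\<close>. Later \<open>s\<close> is a root of \<open>Log (p n)\<close> and
\<open>\<tau> = 1 / (p n)\<close>, so that \<open>p\<close> coordinates together stay below \<open>1 / n\<close>.\<close>

definition tail_bound :: "real \<Rightarrow> real \<Rightarrow> bool" where
  "tail_bound s \<tau> \<longleftrightarrow> 1 \<le> s \<and> 0 < \<tau> \<and> 768 * exp (- s\<^sup>2 / 8) \<le> \<tau>"

lemma Phi_tail:
  assumes "0 \<le> s" shows "1 - Phi s \<le> 2 * exp (- s\<^sup>2 / 4)"
proof -
  define G where "G t = sqrt 2 * exp (- s\<^sup>2 / 4) * Phi (t / sqrt 2) - Phi t" for t
  have G': "(G has_real_derivative exp (- s\<^sup>2 / 4) * phi (t / sqrt 2) - phi t) (at t)" for t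
    unfolding G_def by (auto intro!: derivative_eq_intros)
  have "G s \<le> G t" if "s \<le> t" for t
  proof (rule DERIV_nonneg_imp_nondecreasing[OF that], intro exI conjI, rule G')
    fix x assume "s \<le> x"
    then have "s\<^sup>2 \<le> x\<^sup>2" using assms by (intro power_mono)
    then have "1 \<le> exp (- s\<^sup>2 / 4) * exp (x\<^sup>2 / 4)" by (simp add: exp_add[symmetric])
    then show "0 \<le> exp (- s\<^sup>2 / 4) * phi (x / sqrt 2) - phi x"
      unfolding phi_sqrt2 using phi_pos[of x] mult_right_mono[of 1 _ "phi x"] by (simp add: mult.assoc)
  qed
  moreover have "(G \<longlongrightarrow> sqrt 2 * exp (- s\<^sup>2 / 4) * 1 - 1) at_top"
    unfolding G_def by (intro tendsto_intros Phi_lim_top Phi_sqrt2_top)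
  ultimately have "G s \<le> sqrt 2 * exp (- s\<^sup>2 / 4) * 1 - 1"
    by (intro tendsto_lowerbound[where F=at_top and f=G]) (auto intro: eventually_at_top_linorderI[of s])
  moreover have "0 \<le> sqrt 2 * exp (- s\<^sup>2 / 4) * Phi (s / sqrt 2)" by (intro mult_nonneg_nonneg Phi_bounds) auto
  moreover have "sqrt 2 * exp (- s\<^sup>2 / 4) \<le> 2 * exp (- s\<^sup>2 / 4)"
    by (intro mult_right_mono real_le_lsqrt) auto
  ultimately show ?thesis unfolding G_def by linarith
qed

lemma tail_bound_Phi:
  assumes "tail_bound s \<tau>" shows "1 - Phi s \<le> \<tau> / 2" "Phi (- s) \<le> \<tau> / 2"
proof -
  have "exp (- s\<^sup>2 / 4) \<le> exp (- s\<^sup>2 / 8)" "0 \<le> exp (- s\<^sup>2 / 8)" by simp_all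
  moreover have "0 \<le> s" "768 * exp (- s\<^sup>2 / 8) \<le> \<tau>" using assms by (auto simp: tail_bound_def)
  ultimately show "1 - Phi s \<le> \<tau> / 2"
    using Phi_tail[of s] by linarith
  then show "Phi (- s) \<le> \<tau> / 2" by (simp add: Phi_minus)
qed

lemma exp_15_2: "exp (15/2) \<le> (1900 :: real)"
proof -
  have e: "exp 1 \<le> (2719/1000::real)" using e_less_272 e_approx_32 by (simp add: abs_if split: if_splits)
  have "exp (15/2 :: real) ^ 2 = exp 1 ^ 15" by (simp add: exp_of_nat_mult[symmetric] power2_eq_square exp_add[symmetric])
  also have "\<dots> \<le> (2719/1000) ^ 15" by (intro power_mono e) simp
  also have "\<dots> \<le> (1900::real) ^ 2" by (simp add: power_divide)
  finally show ?thesis by (rule power2_le_imp_le) simp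
qed

text \<open>On the relevant range the normal density changes by at most a constant factor over a distance of
order \<open>1 / s\<close>, so the mass just below \<open>c\<close> is comparable to its length times \<open>s\<close> times the mass above \<open>c\<close>.\<close>

lemma Phi_hazard:
  assumes T: "tail_bound s \<tau>" and e: "0 \<le> e" "e * s \<le> 1"
  shows "Phi c - Phi (c - 2 * e) \<le> 3800 * (e * s) * (1 - Phi c) + \<tau>"
proof -
  have s: "1 \<le> s" and \<tau>: "0 < \<tau>" using T by (auto simp: tail_bound_def)
  note tl = tail_bound_Phi[OF T]
  have nn: "0 \<le> 3800 * (e * s) * (1 - Phi c)" using e s Phi_bounds by (intro mult_nonneg_nonneg) auto
  consider "c - 2 * e \<ge> s" | "c \<le> - s" | "c - 2 * e < s" "- s < c" by linarith
  then show ?thesis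
  proof cases
    case 1
    then show ?thesis using Phi_mono[OF 1] Phi_bounds(2)[of c] tl nn \<tau> by linarith
  next
    case 2
    then show ?thesis using Phi_mono[OF 2] Phi_bounds(1)[of "c - 2 * e"] tl nn \<tau> by linarith
  next
    case 3
    define lo where "lo = max (c - 2 * e) (- s)"
    define hi where "hi = min c s"
    have lh: "lo \<le> hi" using 3 e s by (auto simp: lo_def hi_def)
    have a1: "Phi c - Phi hi \<le> \<tau> / 2" using tl \<tau> Phi_bounds(2)[of c] by (auto simp: hi_def min_def)
    have a2: "Phi lo - Phi (c - 2 * e) \<le> \<tau> / 2" using tl \<tau> Phi_bounds(1)[of "c - 2*e"] by (auto simp: lo_def max_def)
    have "Phi hi - Phi lo \<le> 2 * e * (1900 * (s * (1 - Phi c)))"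
    proof (cases "lo = hi")
      case True then show ?thesis using e s Phi_bounds by (auto intro!: mult_nonneg_nonneg)
    next
      case False
      with lh have "lo < hi" by simp
      then obtain z where z: "lo < z" "z < hi" "Phi hi - Phi lo = (hi - lo) * phi z"
        using MVT2[of lo hi Phi phi] Phi_deriv by auto
      obtain w where w: "c < w" "w < c + 1 / s" "Phi (c + 1/s) - Phi c = 1 / s * phi w"
        using MVT2[of c "c + 1/s" Phi phi] Phi_deriv s by auto
      have zw: "z \<le> w" using z w by (auto simp: hi_def)
      have is1: "1 / s \<le> 1" "0 < 1/s" using s by auto
      have e1: "e \<le> 1 / s" using e s by (simp add: field_simps)
      have wz: "w - z \<le> 3 / s" using z w e1 by (auto simp: lo_def)
      have "(w - z) * (w + z) \<le> 15"
      proof (cases "w + z \<ge> 0")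
        case True
        have "z \<le> s" using z by (auto simp: hi_def)
        moreover have "3 / s \<le> 3" using s by (simp add: field_simps)
        ultimately have "w + z \<le> 5 * s" using wz s by linarith
        then have "(w - z) * (w + z) \<le> (3 / s) * (5 * s)" using wz zw True s by (intro mult_mono) auto
        then show ?thesis using s by simp
      next
        case False
        then have "(w - z) * (w + z) \<le> 0" using zw by (intro mult_nonneg_nonpos) auto
        then show ?thesis by simp
      qed
      then have "- z\<^sup>2 / 2 \<le> 15/2 + - w\<^sup>2 / 2" by (simp add: power2_eq_square algebra_simps)
      then have "exp (- z\<^sup>2 / 2) \<le> exp (15/2) * exp (- w\<^sup>2 / 2)" by (simp add: exp_add[symmetric])
      also have "\<dots> \<le> 1900 * exp (- w\<^sup>2 / 2)" by (intro mult_right_mono exp_15_2) auto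
      finally have "phi z \<le> 1900 * phi w" by (simp add: std_normal_density_def field_simps)
      also have "phi w = s * (Phi (c + 1/s) - Phi c)" using w s by simp
      also have "1900 * \<dots> \<le> 1900 * (s * (1 - Phi c))" using s Phi_bounds by (intro mult_left_mono) auto
      finally have pz: "phi z \<le> 1900 * (s * (1 - Phi c))" .
      show ?thesis unfolding z(3) using pz lh phi_pos[of z] e
        by (intro mult_mono) (auto simp: lo_def hi_def)
    qed
    with a1 a2 show ?thesis by (simp add: algebra_simps)
  qed
qed

section \<open>Smoothed boxes\<close>

fun dPhi :: "nat \<Rightarrow> real \<Rightarrow> real" where
  "dPhi 0 t = Phi t"
| "dPhi (Suc 0) t = phi t"
| "dPhi (Suc (Suc 0)) t = - t * phi t"
| "dPhi (Suc (Suc (Suc k))) t = (t\<^sup>2 - 1) * phi t"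

lemma dPhi_deriv:
  assumes "k < 3"
  shows "(dPhi k has_real_derivative dPhi (Suc k) t) (at t)"
proof -
  from assms consider "k = 0" | "k = 1" | "k = 2" by linarith
  then show ?thesis
  proof cases
    case 1
    then show ?thesis using Phi_deriv[of t] by (simp add: dPhi.simps[abs_def])
  next
    case 2
    have e: "dPhi k = phi" using 2 by (auto simp: fun_eq_iff)
    show ?thesis unfolding e using 2 by (auto intro!: derivative_eq_intros)
  next
    case 3
    have e: "dPhi k = (\<lambda>t. - t * phi t)" using 3 by (auto simp: fun_eq_iff numeral_2_eq_2)
    show ?thesis unfolding e using 3
      by (auto intro!: derivative_eq_intros simp: numeral_2_eq_2 algebra_simps)
  qed
qed

text \<open>The mass of the interval from \<open>a\<close> to \<open>b\<close> under the normal law with mean \<open>x\<close> and deviation \<open>\<sigma>\<close>,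
differentiated \<open>k\<close> times in \<open>x\<close>. Empty intervals (\<open>b < a\<close>) are admitted, which spares all case
distinctions when boxes are shrunk.\<close>

definition ival_mass_deriv :: "nat \<Rightarrow> real \<Rightarrow> real \<Rightarrow> real \<Rightarrow> real \<Rightarrow> real" where
  "ival_mass_deriv k \<sigma> a b x = (if a \<le> b then (- 1 / \<sigma>) ^ k * (dPhi k ((b - x) / \<sigma>) - dPhi k ((a - x) / \<sigma>)) else 0)"

abbreviation ival_mass :: "real \<Rightarrow> real \<Rightarrow> real \<Rightarrow> real \<Rightarrow> real" where "ival_mass \<equiv> ival_mass_deriv 0"

lemma ival_mass_deriv_step:
  assumes "\<sigma> > 0" "k < 3"
  shows "(ival_mass_deriv k \<sigma> a b has_real_derivative ival_mass_deriv (Suc k) \<sigma> a b x) (at x)"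
proof (cases "a \<le> b")
  case True
  have d: "((\<lambda>x. dPhi k ((c - x) / \<sigma>)) has_real_derivative dPhi (Suc k) ((c - x) / \<sigma>) * (- 1 / \<sigma>)) (at x)" for c
    by (rule DERIV_chain2[OF dPhi_deriv[OF assms(2)]]) (use assms in \<open>auto intro!: derivative_eq_intros\<close>)
  have "((\<lambda>x. (- 1 / \<sigma>) ^ k * (dPhi k ((b - x) / \<sigma>) - dPhi k ((a - x) / \<sigma>))) has_real_derivative
     (- 1 / \<sigma>) ^ k * (dPhi (Suc k) ((b - x) / \<sigma>) * (- 1 / \<sigma>) - dPhi (Suc k) ((a - x) / \<sigma>) * (- 1 / \<sigma>))) (at x)"
    by (intro DERIV_cmult DERIV_diff d)
  then show ?thesis using True by (simp add: ival_mass_deriv_def[abs_def] algebra_simps diff_divide_distrib)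
qed (simp add: ival_mass_deriv_def[abs_def])

lemma ival_mass_bounds:
  assumes "\<sigma> > 0" shows "0 \<le> ival_mass \<sigma> a b x" "ival_mass \<sigma> a b x \<le> 1"
  using assms Phi_mono[of "(a - x) / \<sigma>" "(b - x) / \<sigma>"] Phi_bounds[of "(a - x) / \<sigma>"] Phi_bounds[of "(b - x) / \<sigma>"]
  by (auto simp: ival_mass_deriv_def divide_right_mono)

lemma dPhi_lim:
  assumes "k \<in> {1,2,3}" shows "(dPhi k \<longlongrightarrow> 0) at_top" "(dPhi k \<longlongrightarrow> 0) at_bot"
proof -
  have p: "phi = (\<lambda>x. exp (- x\<^sup>2 / 2) / sqrt (2 * pi))" by (simp add: std_normal_density_def fun_eq_iff)
  from assms consider "k = 1" | "k = 2" | "k = 3" by auto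
  then have "(dPhi k \<longlongrightarrow> 0) at_top \<and> (dPhi k \<longlongrightarrow> 0) at_bot"
  proof cases
    case 1
    have e: "dPhi k = phi" using 1 by (auto simp: fun_eq_iff)
    show ?thesis unfolding e p by (intro conjI; real_asymp)
  next
    case 2
    have e: "dPhi k = (\<lambda>t. - t * phi t)" using 2 by (auto simp: fun_eq_iff numeral_2_eq_2)
    show ?thesis unfolding e p by (intro conjI; real_asymp)
  next
    case 3
    have e: "dPhi k = (\<lambda>t. (t\<^sup>2 - 1) * phi t)" using 3 by (auto simp: fun_eq_iff numeral_3_eq_3)
    show ?thesis unfolding e p by (intro conjI; real_asymp)
  qed
  then show "(dPhi k \<longlongrightarrow> 0) at_top" "(dPhi k \<longlongrightarrow> 0) at_bot" by auto
qed

text \<open>A derivative of the mass is an integral of a Hermite polynomial over the interval, and minus its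
integral over the complement. So it is small if either the mass or the complementary mass is small,
and \<open>min f (1 - f) + \<tau>\<close> is at most \<open>(f + \<tau>) * (2 * (1 - f + \<tau>))\<close>. The latter form is multiplicative in
\<open>f + \<tau>\<close>, as products require.\<close>

lemma ival_mass_deriv_bound:
  assumes T: "tail_bound s \<tau>" and \<sigma>: "\<sigma> > 0" and k: "k \<in> {1,2,3}"
  shows "\<bar>ival_mass_deriv k \<sigma> a b x\<bar> \<le> (2 * s / \<sigma>) ^ k * ((ival_mass \<sigma> a b x + \<tau>) * (2 * (1 - ival_mass \<sigma> a b x + \<tau>)))"
proof (cases "a \<le> b")
  case False
  have "0 \<le> s" "0 \<le> \<tau>" using T by (auto simp: tail_bound_def)
  then show ?thesis using False \<sigma> by (auto simp: ival_mass_deriv_def intro!: mult_nonneg_nonneg)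
next
  case True
  have s: "1 \<le> s" and \<tau>: "0 < \<tau>" and d: "768 * exp (- s\<^sup>2 / 8) \<le> \<tau>" using T by (auto simp: tail_bound_def)
  define f where "f = ival_mass \<sigma> a b x"
  define u v where "u = (a - x) / \<sigma>" and "v = (b - x) / \<sigma>"
  have uv: "u \<le> v" using True \<sigma> by (simp add: u_def v_def divide_right_mono)
  have f: "f = Phi v - Phi u" using True by (simp add: f_def ival_mass_deriv_def u_def v_def)
  have f01: "0 \<le> f" "f \<le> 1" using ival_mass_bounds[OF \<sigma>] by (auto simp: f_def)
  define G' where "G' t = (if k = 1 then - t * phi t else if k = 2 then (t\<^sup>2 - 1) * phi t else (3 * t - t^3) * phi t)" for t
  have GD: "(dPhi k has_real_derivative G' t) (at t)" for t
  proof (cases "k = 3")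
    case True
    have e: "dPhi k = (\<lambda>t. (t\<^sup>2 - 1) * phi t)" using True by (auto simp: fun_eq_iff numeral_3_eq_3)
    show ?thesis unfolding e G'_def using True
      by (auto intro!: derivative_eq_intros simp: algebra_simps power2_eq_square power3_eq_cube)
  next
    case False
    with k have "k = 1 \<or> k = 2" by auto
    then show ?thesis using dPhi_deriv[of k t] by (auto simp: G'_def numeral_2_eq_2)
  qed
  have Gb: "\<bar>G' t\<bar> \<le> (2 * s) ^ k * phi t + 256 * exp (- s\<^sup>2 / 8) * phi (t / sqrt 2)" for t
    using hermite_bounds[OF s, of t] k by (auto simp: G'_def)
  have "\<bar>dPhi k v - dPhi k u\<bar> \<le> (2 * s) ^ k * min (Phi v - Phi u) (1 - (Phi v - Phi u)) + 3 * (256 * exp (- s\<^sup>2 / 8))"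
    by (rule Phi_majorant[OF GD Gb _ _ dPhi_lim[OF k] uv]) (use s in auto)
  also have "\<dots> \<le> (2 * s) ^ k * min f (1 - f) + (2 * s) ^ k * \<tau>"
  proof -
    have "1 \<le> (2 * s) ^ k" using s by (intro one_le_power) auto
    then have "1 * \<tau> \<le> (2 * s) ^ k * \<tau>" using \<tau> by (intro mult_right_mono) auto
    then show ?thesis using d by (simp add: f)
  qed
  also have "\<dots> = (2 * s) ^ k * (min f (1 - f) + \<tau>)" by (simp add: algebra_simps)
  also have "\<dots> \<le> (2 * s) ^ k * ((f + \<tau>) * (2 * (1 - f + \<tau>)))"
  proof (rule mult_left_mono)
    show "min f (1 - f) + \<tau> \<le> (f + \<tau>) * (2 * (1 - f + \<tau>))"
    proof (cases "f \<le> 1/2")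
      case True
      then have "(f + \<tau>) * 1 \<le> (f + \<tau>) * (2 * (1 - f + \<tau>))" using f01 \<tau> by (intro mult_left_mono) auto
      then show ?thesis by auto
    next
      case False
      then have "1 * (1 - f + \<tau>) \<le> (2 * (f + \<tau>)) * (1 - f + \<tau>)" using f01 \<tau> by (intro mult_right_mono) auto
      then show ?thesis by (auto simp: algebra_simps)
    qed
  qed (use s in auto)
  finally have "(1 / \<sigma>) ^ k * \<bar>dPhi k v - dPhi k u\<bar> \<le> (1 / \<sigma>) ^ k * ((2 * s) ^ k * ((f + \<tau>) * (2 * (1 - f + \<tau>))))"
    using \<sigma> by (intro mult_left_mono) auto
  moreover have "\<bar>ival_mass_deriv k \<sigma> a b x\<bar> = (1 / \<sigma>) ^ k * \<bar>dPhi k v - dPhi k u\<bar>"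
    using True \<sigma> by (simp add: ival_mass_deriv_def u_def v_def abs_mult power_abs)
  moreover have "(1 / \<sigma>) ^ k * ((2 * s) ^ k * z) = (2 * s / \<sigma>) ^ k * z" for z
    by (simp add: power_mult_distrib power_divide)
  ultimately show ?thesis by (simp only: f_def)
qed

text \<open>Along a line, the \<open>k\<close>-th derivative of each factor is at most \<open>K ^ k\<close> times \<open>F\<close> times \<open>q\<close>. The Leibniz rule
adds one factor at a time and keeps the derivatives of the product below \<open>H\<close> times the Touchard
polynomials \<open>Q\<close>, \<open>Q + Q\<^sup>2\<close>, \<open>Q + 3 Q\<^sup>2 + Q\<^sup>3\<close>: the number of factors enters only through the sum \<open>Q\<close>. The
first two derivatives at the origin are a linear and a quadratic form in the direction.\<close>

lemma leibniz_prod_bound: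
  fixes f :: "nat \<Rightarrow> nat \<Rightarrow> real \<Rightarrow> real" and F q :: "nat \<Rightarrow> real \<Rightarrow> real"
  assumes "finite J" and K: "0 \<le> K"
    and d: "\<And>j k x. j \<in> J \<Longrightarrow> k < 3 \<Longrightarrow> (f j k has_real_derivative f j (Suc k) x) (at x)"
    and f0: "\<And>j x. j \<in> J \<Longrightarrow> \<bar>f j 0 x\<bar> \<le> F j x"
    and fk: "\<And>j k x. j \<in> J \<Longrightarrow> k \<in> {1,2,3} \<Longrightarrow> \<bar>f j k x\<bar> \<le> K ^ k * (F j x * q j x)"
    and q: "\<And>j x. j \<in> J \<Longrightarrow> 0 \<le> q j x"
  shows "\<exists>\<alpha> \<beta>. \<forall>x m. (\<forall>j\<in>J. \<bar>x j\<bar> \<le> m) \<longrightarrow> (\<exists>g1 g2 g3.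
     (\<forall>t. ((\<lambda>t. \<Prod>j\<in>J. f j 0 (w j + t * x j)) has_real_derivative g1 t) (at t) \<and>
          (g1 has_real_derivative g2 t) (at t) \<and> (g2 has_real_derivative g3 t) (at t) \<and>
          (let H = (\<Prod>j\<in>J. F j (w j + t * x j)); Q = (\<Sum>j\<in>J. q j (w j + t * x j)) in
            \<bar>g1 t\<bar> \<le> (K * m) * (H * Q) \<and> \<bar>g2 t\<bar> \<le> (K * m)^2 * (H * (Q + Q^2)) \<and>
            \<bar>g3 t\<bar> \<le> (K * m)^3 * (H * (Q + 3 * Q^2 + Q^3)))) \<and>
     g1 0 = (\<Sum>j\<in>J. \<alpha> j * x j) \<and> g2 0 = (\<Sum>i\<in>J. \<Sum>j\<in>J. \<beta> i j * (x i * x j)))"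
  using assms(1) d f0 fk q
proof (induction J rule: finite_induct)
  case empty
  show ?case by (intro exI[of _ "\<lambda>_. 0"] allI impI exI[of _ "\<lambda>_ _. 0"]) (simp add: Let_def)
next
  case (insert i J)
  obtain \<alpha> \<beta> where IH: "\<And>x m. (\<forall>j\<in>J. \<bar>x j\<bar> \<le> m) \<Longrightarrow> (\<exists>g1 g2 g3.
     (\<forall>t. ((\<lambda>t. \<Prod>j\<in>J. f j 0 (w j + t * x j)) has_real_derivative g1 t) (at t) \<and>
          (g1 has_real_derivative g2 t) (at t) \<and> (g2 has_real_derivative g3 t) (at t) \<and>
          (let H = (\<Prod>j\<in>J. F j (w j + t * x j)); Q = (\<Sum>j\<in>J. q j (w j + t * x j)) in
            \<bar>g1 t\<bar> \<le> (K * m) * (H * Q) \<and> \<bar>g2 t\<bar> \<le> (K * m)^2 * (H * (Q + Q^2)) \<and>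
            \<bar>g3 t\<bar> \<le> (K * m)^3 * (H * (Q + 3 * Q^2 + Q^3)))) \<and>
     g1 0 = (\<Sum>j\<in>J. \<alpha> j * x j) \<and> g2 0 = (\<Sum>i\<in>J. \<Sum>j\<in>J. \<beta> i j * (x i * x j)))"
    using insert.IH insert.prems by (atomize_elim) (blast)
  define G0 where "G0 = (\<Prod>j\<in>J. f j 0 (w j))"
  define a' where "a' j = (if j = i then f i 1 (w i) * G0 else f i 0 (w i) * \<alpha> j)" for j
  define b' where "b' k j = (if k = i then (if j = i then f i 2 (w i) * G0 else 2 * f i 1 (w i) * \<alpha> j)
      else if j = i then 0 else f i 0 (w i) * \<beta> k j)" for k j
  show ?case
  proof (intro exI[of _ a'] exI[of _ b'] allI impI)
    fix x :: "nat \<Rightarrow> real" and m assume x: "\<forall>j\<in>insert i J. \<bar>x j\<bar> \<le> m"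
    then have xJ: "\<forall>j\<in>J. \<bar>x j\<bar> \<le> m" and xi: "\<bar>x i\<bar> \<le> m" by auto
    have m: "0 \<le> m" using xi by linarith
    let ?G = "\<lambda>t. \<Prod>j\<in>J. f j 0 (w j + t * x j)"
    let ?H = "\<lambda>t. \<Prod>j\<in>J. F j (w j + t * x j)"
    let ?Q = "\<lambda>t. \<Sum>j\<in>J. q j (w j + t * x j)"
    let ?u = "\<lambda>t. w i + t * x i"
    obtain g1 g2 g3 where
       g: "\<And>t. (?G has_real_derivative g1 t) (at t)" "\<And>t. (g1 has_real_derivative g2 t) (at t)"
         "\<And>t. (g2 has_real_derivative g3 t) (at t)"
       and gb: "\<And>t. \<bar>g1 t\<bar> \<le> (K * m) * (?H t * ?Q t)" "\<And>t. \<bar>g2 t\<bar> \<le> (K * m)^2 * (?H t * (?Q t + (?Q t)^2))"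
            "\<And>t. \<bar>g3 t\<bar> \<le> (K * m)^3 * (?H t * (?Q t + 3 * (?Q t)^2 + (?Q t)^3))"
       and g0: "g1 0 = (\<Sum>j\<in>J. \<alpha> j * x j)" "g2 0 = (\<Sum>i\<in>J. \<Sum>j\<in>J. \<beta> i j * (x i * x j))"
      using IH[OF xJ] by (auto simp: Let_def)
    have F0: "\<And>j u. j \<in> J \<Longrightarrow> 0 \<le> F j u" using insert.prems(2) by (meson abs_ge_zero insertI2 order_trans)
    have Fi: "0 \<le> F i u" for u using insert.prems(2)[of i u] by (meson abs_ge_zero insertI1 order_trans)
    have qi: "0 \<le> q i u" for u using insert.prems(4)[of i u] by simp
    have H0: "0 \<le> ?H t" for t by (intro prod_nonneg) (auto intro: F0)
    have Q0: "0 \<le> ?Q t" for t by (intro sum_nonneg) (auto intro: insert.prems(4))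
    have GH: "\<bar>?G t\<bar> \<le> ?H t" for t unfolding abs_prod by (intro prod_mono) (auto intro: insert.prems(2))
    have fd: "((\<lambda>t. f i k (?u t)) has_real_derivative f i (Suc k) (?u t) * x i) (at t)" if "k < 3" for k t
      by (rule DERIV_chain2[OF insert.prems(1)[OF _ that]]) (auto intro!: derivative_eq_intros)
    let ?f = "\<lambda>k t. f i k (?u t)"
    define h1 where "h1 t = ?f 1 t * x i * ?G t + ?f 0 t * g1 t" for t
    define h2 where "h2 t = ?f 2 t * (x i)^2 * ?G t + 2 * (?f 1 t * x i * g1 t) + ?f 0 t * g2 t" for t
    define h3 where "h3 t = ?f 3 t * (x i)^3 * ?G t + 3 * (?f 2 t * (x i)^2 * g1 t) + 3 * (?f 1 t * x i * g2 t) + ?f 0 t * g3 t" for t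
    have d0: "((\<lambda>t. \<Prod>j\<in>insert i J. f j 0 (w j + t * x j)) has_real_derivative h1 t) (at t)" for t
    proof -
      have "((\<lambda>t. ?f 0 t * ?G t) has_real_derivative h1 t) (at t)"
        by (rule DERIV_cong[OF DERIV_mult[OF fd g(1)]]) (auto simp: h1_def)
      then show ?thesis using insert.hyps by simp
    qed
    have d1: "(h1 has_real_derivative h2 t) (at t)" for t
      unfolding h1_def
      by (rule DERIV_cong[OF DERIV_add[OF DERIV_mult[OF DERIV_mult[OF fd DERIV_const] g(1)] DERIV_mult[OF fd g(2)]]])
         (auto simp: h2_def algebra_simps power2_eq_square numeral_2_eq_2)
    have d2: "(h2 has_real_derivative h3 t) (at t)" for t
      unfolding h2_def
      by (rule DERIV_cong[OF DERIV_add[OF DERIV_add[OF DERIV_mult[OF DERIV_mult[OF fd DERIV_const] g(1)]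
              DERIV_cmult[OF DERIV_mult[OF DERIV_mult[OF fd DERIV_const] g(2)]]] DERIV_mult[OF fd g(3)]]])
         (auto simp: h3_def algebra_simps power2_eq_square power3_eq_cube numeral_2_eq_2 numeral_3_eq_3)
    \<comment> \<open>\<open>A ^ k\<close> is the size of \<open>k\<close> derivatives in a direction with entries at most \<open>m\<close>\<close>
    define A where "A = K * m"
    have A: "0 \<le> A" using K m by (simp add: A_def)
    have fb: "\<bar>?f k t * (x i)^k\<bar> \<le> A ^ k * (F i (?u t) * q i (?u t))" if "k \<in> {1,2,3}" for k t
    proof -
      have "\<bar>?f k t * (x i)^k\<bar> \<le> (K ^ k * (F i (?u t) * q i (?u t))) * m ^ k"
        unfolding abs_mult power_abs using that xi K Fi qi
        by (intro mult_mono insert.prems(3) power_mono) auto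
      then show ?thesis by (simp add: A_def power_mult_distrib mult_ac)
    qed
    have fb0: "\<bar>?f 0 t\<bar> \<le> F i (?u t)" for t by (rule insert.prems(2)) simp
    have main: "\<bar>h1 t\<bar> \<le> A * ((F i (?u t) * ?H t) * (q i (?u t) + ?Q t)) \<and>
       \<bar>h2 t\<bar> \<le> A^2 * ((F i (?u t) * ?H t) * ((q i (?u t) + ?Q t) + (q i (?u t) + ?Q t)^2)) \<and>
       \<bar>h3 t\<bar> \<le> A^3 * ((F i (?u t) * ?H t) * ((q i (?u t) + ?Q t) + 3 * (q i (?u t) + ?Q t)^2 + (q i (?u t) + ?Q t)^3))" for t
    proof -
      define Fi' qq H Q where "Fi' = F i (?u t)" and "qq = q i (?u t)" and "H = ?H t" and "Q = ?Q t"
      note defs = this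
      have nn: "0 \<le> Fi'" "0 \<le> qq" "0 \<le> H" "0 \<le> Q" using Fi qi H0 Q0 by (auto simp: defs)
      have p1: "\<bar>?f k t * (x i)^k * y\<bar> \<le> A ^ k * (Fi' * qq) * Y" if "k \<in> {1,2,3}" "\<bar>y\<bar> \<le> Y" for k y Y
        unfolding abs_mult[of _ y] using fb[OF that(1), of t] that nn A
        by (intro mult_mono) (auto simp: defs)
      have p0: "\<bar>?f 0 t * y\<bar> \<le> Fi' * Y" if "\<bar>y\<bar> \<le> Y" for y Y
        unfolding abs_mult[of _ y] using fb0[of t] that nn A by (intro mult_mono) (auto simp: defs)
      have GH': "\<bar>?G t\<bar> \<le> H" using GH by (simp add: defs)
      have gb': "\<bar>g1 t\<bar> \<le> A * (H * Q)" "\<bar>g2 t\<bar> \<le> A^2 * (H * (Q + Q^2))"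
            "\<bar>g3 t\<bar> \<le> A^3 * (H * (Q + 3 * Q^2 + Q^3))" using gb[of t] by (auto simp: defs A_def)
      have "\<bar>h1 t\<bar> \<le> A ^ 1 * (Fi' * qq) * H + Fi' * (A * (H * Q))"
        using p1[OF _ GH', of 1] p0[OF gb'(1)] by (simp add: h1_def)
      also have "\<dots> = A * ((Fi' * H) * (qq + Q))" by (simp add: algebra_simps)
      finally have r1: "\<bar>h1 t\<bar> \<le> A * ((Fi' * H) * (qq + Q))" .
      have "\<bar>h2 t\<bar> \<le> A ^ 2 * (Fi' * qq) * H + 2 * (A ^ 1 * (Fi' * qq) * (A * (H * Q))) + Fi' * (A^2 * (H * (Q + Q^2)))"
        using p1[OF _ GH', of 2] p1[OF _ gb'(1), of 1] p0[OF gb'(2)] by (simp add: h2_def)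
      also have "\<dots> = A^2 * ((Fi' * H) * (qq + 2 * qq * Q + Q + Q^2))" by (simp add: algebra_simps power2_eq_square)
      also have "\<dots> \<le> A^2 * ((Fi' * H) * ((qq + Q) + (qq + Q)^2))" using nn
        by (intro mult_left_mono) (auto simp: power2_eq_square algebra_simps)
      finally have r2: "\<bar>h2 t\<bar> \<le> A^2 * ((Fi' * H) * ((qq + Q) + (qq + Q)^2))" .
      have "\<bar>h3 t\<bar> \<le> A ^ 3 * (Fi' * qq) * H + 3 * (A ^ 2 * (Fi' * qq) * (A * (H * Q))) +
          3 * (A ^ 1 * (Fi' * qq) * (A^2 * (H * (Q + Q^2)))) + Fi' * (A^3 * (H * (Q + 3 * Q^2 + Q^3)))"
        using p1[OF _ GH', of 3] p1[OF _ gb'(1), of 2] p1[OF _ gb'(2), of 1] p0[OF gb'(3)] by (simp add: h3_def)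
      also have "\<dots> = A^3 * ((Fi' * H) * (qq + 6 * qq * Q + 3 * qq * Q^2 + Q + 3 * Q^2 + Q^3))"
        by (simp add: algebra_simps power2_eq_square power3_eq_cube)
      also have "\<dots> \<le> A^3 * ((Fi' * H) * ((qq + Q) + 3 * (qq + Q)^2 + (qq + Q)^3))" using nn A
        by (intro mult_left_mono) (auto simp: power2_eq_square power3_eq_cube algebra_simps)
      finally have r3: "\<bar>h3 t\<bar> \<le> A^3 * ((Fi' * H) * ((qq + Q) + 3 * (qq + Q)^2 + (qq + Q)^3))" .
      show ?thesis using r1 r2 r3 by (simp add: defs)
    qed
    have h10: "h1 0 = (\<Sum>j\<in>insert i J. a' j * x j)"
    proof -
      have "(\<Sum>j\<in>J. a' j * x j) = (\<Sum>j\<in>J. f i 0 (w i) * (\<alpha> j * x j))" using insert.hyps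
        by (intro sum.cong) (auto simp: a'_def)
      then show ?thesis using insert.hyps g0 by (simp add: h1_def a'_def G0_def sum_distrib_left[symmetric])
    qed
    have h20: "h2 0 = (\<Sum>k\<in>insert i J. \<Sum>j\<in>insert i J. b' k j * (x k * x j))"
    proof -
      have 1: "(\<Sum>j\<in>J. b' i j * (x i * x j)) = (\<Sum>j\<in>J. 2 * (f i 1 (w i) * x i) * (\<alpha> j * x j))" using insert.hyps
        by (intro sum.cong) (auto simp: b'_def)
      have "(\<Sum>j\<in>insert i J. b' k j * (x k * x j)) = (\<Sum>j\<in>J. f i 0 (w i) * (\<beta> k j * (x k * x j)))" if "k \<in> J" for k
      proof -
        have "(\<Sum>j\<in>J. b' k j * (x k * x j)) = (\<Sum>j\<in>J. f i 0 (w i) * (\<beta> k j * (x k * x j)))"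
          using insert.hyps that by (intro sum.cong) (auto simp: b'_def)
        moreover have "b' k i = 0" using insert.hyps that by (auto simp: b'_def)
        ultimately show ?thesis using insert.hyps by simp
      qed
      then have 2: "(\<Sum>k\<in>J. \<Sum>j\<in>insert i J. b' k j * (x k * x j)) = (\<Sum>k\<in>J. \<Sum>j\<in>J. f i 0 (w i) * (\<beta> k j * (x k * x j)))"
        by simp
      have "(\<Sum>k\<in>insert i J. \<Sum>j\<in>insert i J. b' k j * (x k * x j)) =
         (b' i i * (x i * x i) + (\<Sum>j\<in>J. b' i j * (x i * x j))) + (\<Sum>k\<in>J. \<Sum>j\<in>insert i J. b' k j * (x k * x j))"
        by (simp only: sum.insert[OF insert.hyps])
      also have "\<dots> = h2 0" unfolding 1 2 sum_distrib_left[symmetric] g0[symmetric]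
        by (simp add: h2_def G0_def b'_def power2_eq_square)
      finally show ?thesis by simp
    qed
    show "\<exists>g1 g2 g3.
     (\<forall>t. ((\<lambda>t. \<Prod>j\<in>insert i J. f j 0 (w j + t * x j)) has_real_derivative g1 t) (at t) \<and>
          (g1 has_real_derivative g2 t) (at t) \<and> (g2 has_real_derivative g3 t) (at t) \<and>
          (let H = (\<Prod>j\<in>insert i J. F j (w j + t * x j)); Q = (\<Sum>j\<in>insert i J. q j (w j + t * x j)) in
            \<bar>g1 t\<bar> \<le> (K * m) * (H * Q) \<and> \<bar>g2 t\<bar> \<le> (K * m)^2 * (H * (Q + Q^2)) \<and>
            \<bar>g3 t\<bar> \<le> (K * m)^3 * (H * (Q + 3 * Q^2 + Q^3)))) \<and>
     g1 0 = (\<Sum>j\<in>insert i J. a' j * x j) \<and> g2 0 = (\<Sum>k\<in>insert i J. \<Sum>j\<in>insert i J. b' k j * (x k * x j))"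
      using d0 d1 d2 main h10 h20 insert.hyps unfolding A_def[symmetric] Let_def
      by (intro exI[of _ h1] exI[of _ h2] exI[of _ h3]) simp
  qed
qed

definition in_box :: "nat \<Rightarrow> (nat \<Rightarrow> real) \<Rightarrow> (nat \<Rightarrow> real) \<Rightarrow> (nat \<Rightarrow> real) \<Rightarrow> bool" where
  "in_box p a b w \<longleftrightarrow> (\<forall>j<p. a j \<le> w j \<and> w j \<le> b j)"

definition shell :: "nat \<Rightarrow> (nat \<Rightarrow> real) \<Rightarrow> (nat \<Rightarrow> real) \<Rightarrow> real \<Rightarrow> (nat \<Rightarrow> real) \<Rightarrow> bool" where
  "shell p a b e w \<longleftrightarrow> in_box p (\<lambda>j. a j - e) (\<lambda>j. b j + e) w \<and> \<not> in_box p (\<lambda>j. a j + e) (\<lambda>j. b j - e) w"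

definition box_mass :: "nat \<Rightarrow> real \<Rightarrow> (nat \<Rightarrow> real) \<Rightarrow> (nat \<Rightarrow> real) \<Rightarrow> (nat \<Rightarrow> real) \<Rightarrow> real" where
  "box_mass p \<sigma> a b w = (\<Prod>j<p. ival_mass \<sigma> (a j) (b j) (w j))"

lemma ival_mass_inside:
  assumes T: "tail_bound s \<tau>" and \<sigma>: "\<sigma> > 0" and x: "a + \<sigma> * s \<le> x" "x \<le> b - \<sigma> * s"
  shows "1 - ival_mass \<sigma> a b x \<le> \<tau>"
proof -
  have s: "1 \<le> s" using T by (auto simp: tail_bound_def)
  have "0 \<le> \<sigma> * s" using s \<sigma> by simp
  then have ab: "a \<le> b" using x by linarith
  have "s \<le> (b - x) / \<sigma>" "(a - x) / \<sigma> \<le> - s" using x \<sigma> by (auto simp: field_simps)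
  then have "Phi s \<le> Phi ((b - x) / \<sigma>)" "Phi ((a - x) / \<sigma>) \<le> Phi (- s)" by (auto intro: Phi_mono)
  then show ?thesis using ab tail_bound_Phi[OF T] by (simp add: ival_mass_deriv_def)
qed

lemma ival_mass_outside:
  assumes T: "tail_bound s \<tau>" and \<sigma>: "\<sigma> > 0" and x: "x < a - \<sigma> * s \<or> b + \<sigma> * s < x"
  shows "ival_mass \<sigma> a b x \<le> \<tau>"
proof -
  have \<tau>: "0 < \<tau>" using T by (auto simp: tail_bound_def)
  consider "x < a - \<sigma> * s" | "b + \<sigma> * s < x" using x by auto
  then show ?thesis
  proof cases
    case 1
    then have "s \<le> (a - x) / \<sigma>" using \<sigma> by (auto simp: field_simps)
    then have "Phi s \<le> Phi ((a - x) / \<sigma>)" by (rule Phi_mono)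
    then show ?thesis using \<tau> tail_bound_Phi[OF T] Phi_bounds(2)[of "(b-x)/\<sigma>"] by (auto simp: ival_mass_deriv_def)
  next
    case 2
    then have "(b - x) / \<sigma> \<le> - s" using \<sigma> by (auto simp: field_simps)
    then have "Phi ((b - x) / \<sigma>) \<le> Phi (- s)" by (rule Phi_mono)
    then show ?thesis using \<tau> tail_bound_Phi[OF T] Phi_bounds(1)[of "(a-x)/\<sigma>"] by (auto simp: ival_mass_deriv_def)
  qed
qed

lemma cubic_le_exp:
  fixes Q :: real assumes "0 \<le> Q" shows "Q + 3 * Q^2 + Q^3 \<le> 48 * exp (Q / 2)"
proof -
  have "(\<Sum>k<4. (Q/2) ^ k /\<^sub>R fact k) \<le> exp (Q / 2)"
    unfolding exp_def using assms by (intro sum_le_suminf summable_exp_generic) auto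
  then have "1 + Q / 2 + (Q/2)^2 / 2 + (Q/2)^3 / 6 \<le> exp (Q / 2)"
    by (simp add: eval_nat_numeral fact_numeral)
  then show ?thesis using assms by (simp add: power_divide) (use zero_le_power2[of Q] zero_le_power[OF assms, of 3] in linarith)
qed

lemma exp_2_3: "exp 2 \<le> (15/2 :: real)" "exp 3 \<le> (41/2 :: real)"
proof -
  have e: "exp 1 \<le> (272/100::real)" using e_less_272 by simp
  have "exp 2 = exp (1::real) ^ 2" "exp 3 = exp (1::real) ^ 3" by (simp_all add: exp_of_nat_mult[symmetric])
  moreover have "exp 1 ^ 2 \<le> (272/100::real)^2" "exp 1 ^ 3 \<le> (272/100::real)^3" by (intro power_mono e; simp)+
  ultimately show "exp 2 \<le> (15/2 :: real)" "exp 3 \<le> (41/2 :: real)" by (simp_all add: power_divide)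
qed

text \<open>Since \<open>f + \<tau> \<le> exp (f - 1 + \<tau>)\<close>, the product \<open>H\<close> is at most a constant times \<open>exp (- Q / 2)\<close>, which beats
every polynomial in \<open>Q\<close>. Well inside the box \<open>Q\<close> itself is tiny; well outside, one of the factors of \<open>H\<close> is.\<close>

lemma weight_bound:
  fixes f :: "nat \<Rightarrow> real"
  assumes f: "\<And>j. j < p \<Longrightarrow> 0 \<le> f j \<and> f j \<le> 1" and \<tau>: "0 < \<tau>" "real p * \<tau> \<le> 1"
  defines "H \<equiv> (\<Prod>j<p. f j + \<tau>)" and "Q \<equiv> (\<Sum>j<p. 2 * (1 - f j + \<tau>))"
  shows "H * (Q + 3 * Q^2 + Q^3) \<le> 360"
    "(\<And>j. j < p \<Longrightarrow> 1 - f j \<le> \<tau>) \<Longrightarrow> H * (Q + 3 * Q^2 + Q^3) \<le> 2000 * (real p * \<tau>)"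
    "\<exists>j<p. f j \<le> \<tau> \<Longrightarrow> H * (Q + 3 * Q^2 + Q^3) \<le> 2000 * (real p * \<tau>)"
proof -
  have Q0: "0 \<le> Q" unfolding Q_def using f \<tau> by (intro sum_nonneg) auto
  have H0: "0 \<le> H" unfolding H_def using f \<tau> by (intro prod_nonneg) (auto intro: add_nonneg_nonneg)
  have le: "(\<Prod>j\<in>J. f j + \<tau>) \<le> exp (\<Sum>j\<in>J. f j - 1 + \<tau>)" if "J \<subseteq> {..<p}" for J
    unfolding exp_sum[OF finite_subset[OF that finite_lessThan]]
  proof (rule prod_mono)
    fix j assume "j \<in> J"
    then have "0 \<le> f j + \<tau>" using f[of j] \<tau> that by auto
    moreover have "f j + \<tau> \<le> exp (f j - 1 + \<tau>)" using exp_ge_add_one_self[of "f j - 1 + \<tau>"] by simp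
    ultimately show "0 \<le> f j + \<tau> \<and> f j + \<tau> \<le> exp (f j - 1 + \<tau>)" by simp
  qed
  have sQ: "(\<Sum>j<p. f j - 1 + \<tau>) = 2 * (real p * \<tau>) - Q / 2"
  proof -
    have "Q / 2 = (\<Sum>j<p. 1 - f j + \<tau>)" unfolding Q_def sum_distrib_left[symmetric] by simp
    then show ?thesis by (simp add: sum.distrib sum_subtractf algebra_simps)
  qed
  have "H \<le> exp (2 * (real p * \<tau>) - Q / 2)" using le[of "{..<p}"] sQ by (simp add: H_def)
  also have "\<dots> \<le> exp (2 - Q / 2)" using \<tau> by simp
  finally have "H \<le> exp (2 - Q / 2)" .
  then have "H * (Q + 3 * Q^2 + Q^3) \<le> exp (2 - Q / 2) * (48 * exp (Q / 2))"
    using Q0 by (intro mult_mono cubic_le_exp) auto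
  also have "\<dots> = 48 * exp 2" by (simp add: exp_diff)
  also have "\<dots> \<le> 360" using exp_2_3 by simp
  finally show "H * (Q + 3 * Q^2 + Q^3) \<le> 360" .
  show "H * (Q + 3 * Q^2 + Q^3) \<le> 2000 * (real p * \<tau>)" if "\<And>j. j < p \<Longrightarrow> 1 - f j \<le> \<tau>"
  proof -
    have "H \<le> (\<Prod>j<p. exp \<tau>)" unfolding H_def
    proof (rule prod_mono)
      fix j assume "j \<in> {..<p}"
      then have "0 \<le> f j" "f j \<le> 1" using f by auto
      then show "0 \<le> f j + \<tau> \<and> f j + \<tau> \<le> exp \<tau>" using \<tau> exp_ge_add_one_self[of \<tau>] by linarith
    qed
    also have "\<dots> = exp (real p * \<tau>)" by (simp add: exp_of_nat_mult[symmetric])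
    also have "\<dots> \<le> exp 1" using \<tau> by simp
    also have "\<dots> \<le> 3" by (rule exp_le)
    finally have H3: "H \<le> 3" .
    have "Q \<le> (\<Sum>j<p. 4 * \<tau>)" unfolding Q_def
    proof (rule sum_mono)
      fix j assume "j \<in> {..<p}"
      then have "1 - f j \<le> \<tau>" using that by simp
      then show "2 * (1 - f j + \<tau>) \<le> 4 * \<tau>" by simp
    qed
    then have Q4: "Q \<le> 4 * (real p * \<tau>)" by simp
    then have Q44: "Q \<le> 4" using \<tau> by simp
    have "Q + 3 * Q^2 + Q^3 = Q * (1 + 3 * Q + Q * Q)" by (simp add: algebra_simps power2_eq_square power3_eq_cube)
    also have "\<dots> \<le> (4 * (real p * \<tau>)) * (1 + 3 * 4 + 4 * 4)" using Q0 Q4 Q44 \<tau>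
      by (intro mult_mono add_mono order_refl) auto
    finally have "H * (Q + 3 * Q^2 + Q^3) \<le> 3 * ((4 * (real p * \<tau>)) * (1 + 3 * 4 + 4 * 4))"
      using H0 H3 Q0 by (intro mult_mono) auto
    moreover have "0 \<le> real p * \<tau>" using \<tau> by simp
    ultimately show ?thesis by simp
  qed
  show "H * (Q + 3 * Q^2 + Q^3) \<le> 2000 * (real p * \<tau>)" if ex: "\<exists>j<p. f j \<le> \<tau>"
  proof -
    obtain i where i: "i < p" "f i \<le> \<tau>" using ex by auto
    have "H = (f i + \<tau>) * (\<Prod>j\<in>{..<p} - {i}. f j + \<tau>)" unfolding H_def
      using i by (intro prod.remove) auto
    also have "\<dots> \<le> (2 * \<tau>) * exp (\<Sum>j\<in>{..<p} - {i}. f j - 1 + \<tau>)" using i f \<tau>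
      by (intro mult_mono le prod_nonneg) (auto intro: add_nonneg_nonneg)
    also have "(\<Sum>j\<in>{..<p} - {i}. f j - 1 + \<tau>) = (\<Sum>j<p. f j - 1 + \<tau>) - (f i - 1 + \<tau>)"
      using i sum.remove[of "{..<p}" i "\<lambda>j. f j - 1 + \<tau>"] by simp
    also have "\<dots> \<le> 3 - Q / 2" unfolding sQ using f[OF i(1)] \<tau> by simp
    finally have "H \<le> (2 * \<tau>) * exp (3 - Q / 2)" using \<tau> by simp
    then have "H * (Q + 3 * Q^2 + Q^3) \<le> ((2 * \<tau>) * exp (3 - Q / 2)) * (48 * exp (Q / 2))"
      using Q0 \<tau> by (intro mult_mono cubic_le_exp) auto
    also have "\<dots> = (96 * exp 3) * \<tau>" by (simp add: exp_diff)
    also have "\<dots> \<le> 2000 * \<tau>" using exp_2_3 \<tau> by (intro mult_right_mono) auto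
    also have "\<dots> \<le> 2000 * (real p * \<tau>)" using i \<tau> by (auto simp: mult_le_cancel_right1)
    finally show ?thesis .
  qed
qed

lemma third_order_remainder:
  fixes g :: "real \<Rightarrow> real"
  assumes "\<And>t. (g has_real_derivative g1 t) (at t)" "\<And>t. (g1 has_real_derivative g2 t) (at t)"
    "\<And>t. (g2 has_real_derivative g3 t) (at t)" and b: "\<And>t. 0 \<le> t \<Longrightarrow> t \<le> 1 \<Longrightarrow> \<bar>g3 t\<bar> \<le> B"
  shows "\<bar>g 1 - g 0 - g1 0 - g2 0 / 2\<bar> \<le> B / 6"
proof -
  define diff where "diff m = (if m = 0 then g else if m = 1 then g1 else if m = 2 then g2 else g3)" for m :: nat
  have "\<exists>t>0. t < 1 \<and> g 1 = (\<Sum>m<3. diff m 0 / fact m * 1 ^ m) + diff 3 t / fact 3 * 1 ^ 3"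
  proof (rule Maclaurin)
    show "\<forall>m t. m < 3 \<and> 0 \<le> t \<and> t \<le> 1 \<longrightarrow> (diff m has_real_derivative diff (Suc m) t) (at t)"
      using assms(1-3) by (auto simp: diff_def numeral_3_eq_3 less_Suc_eq)
  qed (auto simp: diff_def)
  then obtain t where "0 < t" "t < 1" "g 1 = g 0 + g1 0 + g2 0 / 2 + g3 t / 6"
    by (auto simp: diff_def eval_nat_numeral fact_numeral)
  then show ?thesis using b[of t] by simp
qed

text \<open>Outside the shell of width \<open>\<sigma> * s + m\<close> around the boundary, no point of the segment from \<open>w\<close> to \<open>w + x\<close>
comes within \<open>\<sigma> * s\<close> of the boundary, and the third derivative is negligible on it.\<close>

lemma box_mass_expansion:
  assumes T: "tail_bound s \<tau>" and \<sigma>: "\<sigma> > 0" and p: "real p * \<tau> \<le> 1"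
  shows "\<exists>\<alpha> \<beta>. \<forall>x m. (\<forall>j<p. \<bar>x j\<bar> \<le> m) \<longrightarrow> 0 \<le> m \<longrightarrow>
    \<bar>box_mass p \<sigma> a b (\<lambda>j. w j + x j) - box_mass p \<sigma> a b w - (\<Sum>j<p. \<alpha> j * x j) - (\<Sum>i<p. \<Sum>j<p. \<beta> i j * (x i * x j)) / 2\<bar>
     \<le> (2 * s / \<sigma>)^3 * m^3 * (60 * of_bool (shell p a b (\<sigma> * s + m) w) + 334 * (real p * \<tau>))"
proof -
  define K where "K = 2 * s / \<sigma>"
  have \<tau>: "0 < \<tau>" and s: "1 \<le> s" using T by (auto simp: tail_bound_def)
  have K: "0 \<le> K" using s \<sigma> by (simp add: K_def)
  define f where "f j k = ival_mass_deriv k \<sigma> (a j) (b j)" for j k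
  define F where "F j x = f j 0 x + \<tau>" for j x
  define q where "q j x = 2 * (1 - f j 0 x + \<tau>)" for j x
  have f01: "0 \<le> f j 0 x" "f j 0 x \<le> 1" for j x using ival_mass_bounds[OF \<sigma>] by (auto simp: f_def)
  obtain \<alpha> \<beta> where *: "\<And>x m. (\<forall>j\<in>{..<p}. \<bar>x j\<bar> \<le> m) \<Longrightarrow> (\<exists>g1 g2 g3.
     (\<forall>t. ((\<lambda>t. \<Prod>j\<in>{..<p}. f j 0 (w j + t * x j)) has_real_derivative g1 t) (at t) \<and>
          (g1 has_real_derivative g2 t) (at t) \<and> (g2 has_real_derivative g3 t) (at t) \<and>
          (let H = (\<Prod>j\<in>{..<p}. F j (w j + t * x j)); Q = (\<Sum>j\<in>{..<p}. q j (w j + t * x j)) in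
            \<bar>g1 t\<bar> \<le> (K * m) * (H * Q) \<and> \<bar>g2 t\<bar> \<le> (K * m)^2 * (H * (Q + Q^2)) \<and>
            \<bar>g3 t\<bar> \<le> (K * m)^3 * (H * (Q + 3 * Q^2 + Q^3)))) \<and>
     g1 0 = (\<Sum>j\<in>{..<p}. \<alpha> j * x j) \<and> g2 0 = (\<Sum>i\<in>{..<p}. \<Sum>j\<in>{..<p}. \<beta> i j * (x i * x j)))"
  proof (atomize_elim, rule leibniz_prod_bound)
    show "(f j k has_real_derivative f j (Suc k) x) (at x)" if "k < 3" for j k x
      unfolding f_def by (rule ival_mass_deriv_step[OF \<sigma> that])
    show "\<bar>f j 0 x\<bar> \<le> F j x" for j x using f01[of j x] \<tau> by (simp add: F_def)
    show "\<bar>f j k x\<bar> \<le> K ^ k * (F j x * q j x)" if "k \<in> {1,2,3}" for j k x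
      using ival_mass_deriv_bound[OF T \<sigma> that] by (simp add: f_def F_def q_def K_def)
    show "0 \<le> q j x" for j x using f01[of j x] \<tau> by (simp add: q_def)
  qed (use K in auto)
  show ?thesis
  proof (intro exI[of _ \<alpha>] exI[of _ \<beta>] allI impI)
    fix x :: "nat \<Rightarrow> real" and m assume x: "\<forall>j<p. \<bar>x j\<bar> \<le> m" and m: "0 \<le> (m::real)"
    define g where "g t = (\<Prod>j<p. f j 0 (w j + t * x j))" for t
    obtain g1 g2 g3 where G: "\<forall>t. ((\<lambda>t. \<Prod>j\<in>{..<p}. f j 0 (w j + t * x j)) has_real_derivative g1 t) (at t) \<and>
          (g1 has_real_derivative g2 t) (at t) \<and> (g2 has_real_derivative g3 t) (at t) \<and>
          (let H = (\<Prod>j\<in>{..<p}. F j (w j + t * x j)); Q = (\<Sum>j\<in>{..<p}. q j (w j + t * x j)) in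
            \<bar>g1 t\<bar> \<le> (K * m) * (H * Q) \<and> \<bar>g2 t\<bar> \<le> (K * m)^2 * (H * (Q + Q^2)) \<and>
            \<bar>g3 t\<bar> \<le> (K * m)^3 * (H * (Q + 3 * Q^2 + Q^3)))" and
      g0: "g1 0 = (\<Sum>j<p. \<alpha> j * x j)" "g2 0 = (\<Sum>i<p. \<Sum>j<p. \<beta> i j * (x i * x j))"
      using *[of x m] x unfolding lessThan_iff by blast
    have g: "\<And>t. (g has_real_derivative g1 t) (at t)" "\<And>t. (g1 has_real_derivative g2 t) (at t)"
       "\<And>t. (g2 has_real_derivative g3 t) (at t)"
      using G unfolding g_def[abs_def] by blast+
    have gb: "let H = (\<Prod>j\<in>{..<p}. F j (w j + t * x j)); Q = (\<Sum>j\<in>{..<p}. q j (w j + t * x j)) in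
            \<bar>g3 t\<bar> \<le> (K * m)^3 * (H * (Q + 3 * Q^2 + Q^3))" for t using G unfolding Let_def by blast
    let ?R = "360 * of_bool (shell p a b (\<sigma> * s + m) w) + 2000 * (real p * \<tau>) :: real"
    have B: "\<bar>g3 t\<bar> \<le> (K * m)^3 * ?R" if t: "0 \<le> t" "t \<le> 1" for t
    proof -
      define z where "z j = w j + t * x j" for j
      have zw: "\<bar>z j - w j\<bar> \<le> m" if "j < p" for j
      proof -
        have "\<bar>t * x j\<bar> \<le> 1 * m" unfolding abs_mult using t x that by (intro mult_mono) auto
        then show ?thesis by (simp add: z_def)
      qed
      define H Q where "H = (\<Prod>j<p. f j 0 (z j) + \<tau>)" and "Q = (\<Sum>j<p. 2 * (1 - f j 0 (z j) + \<tau>))"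
      have ff: "0 \<le> f j 0 (z j) \<and> f j 0 (z j) \<le> 1" for j using f01 by auto
      note W = weight_bound[of p "\<lambda>j. f j 0 (z j)", OF ff \<tau> p, folded H_def Q_def]
      have "H * (Q + 3 * Q^2 + Q^3) \<le> ?R"
      proof (cases "shell p a b (\<sigma> * s + m) w")
        case True
        have "0 \<le> real p * \<tau>" using \<tau> by simp
        then show ?thesis using W(1) True by simp
      next
        case False
        then consider j where "j < p" "w j < a j - (\<sigma> * s + m) \<or> w j > b j + (\<sigma> * s + m)" |
           "\<And>j. j < p \<Longrightarrow> a j + (\<sigma> * s + m) \<le> w j \<and> w j \<le> b j - (\<sigma> * s + m)"
          unfolding shell_def in_box_def by (meson linorder_not_le)
        then have "H * (Q + 3 * Q^2 + Q^3) \<le> 2000 * (real p * \<tau>)"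
        proof cases
          case (1 j)
          then have "z j < a j - \<sigma> * s \<or> b j + \<sigma> * s < z j" using zw[of j] by (auto simp: abs_le_iff)
          from ival_mass_outside[OF T \<sigma> this] have "\<exists>j<p. f j 0 (z j) \<le> \<tau>" using 1 by (auto simp: f_def)
          then show ?thesis by (rule W(3))
        next
          case 2
          show ?thesis
          proof (rule W(2))
            fix j assume j: "j < p"
            have "a j + \<sigma> * s \<le> z j" "z j \<le> b j - \<sigma> * s" using 2[OF j] zw[OF j] by (auto simp: abs_le_iff)
            from ival_mass_inside[OF T \<sigma> this] show "1 - f j 0 (z j) \<le> \<tau>" by (simp add: f_def)
          qed
        qed
        then show ?thesis by simp
      qed
      moreover have "\<bar>g3 t\<bar> \<le> (K * m)^3 * (H * (Q + 3 * Q^2 + Q^3))"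
        using gb[of t] by (simp add: Let_def H_def Q_def z_def F_def q_def)
      moreover have "0 \<le> (K * m)^3" using K m by simp
      ultimately show ?thesis by (meson mult_left_mono order_trans)
    qed
    have e: "box_mass p \<sigma> a b (\<lambda>j. w j + x j) = g 1" "box_mass p \<sigma> a b w = g 0"
      by (simp_all add: box_mass_def g_def f_def)
    have "\<bar>g 1 - g 0 - g1 0 - g2 0 / 2\<bar> \<le> (K * m)^3 * ?R / 6"
      by (rule third_order_remainder[OF g B])
    also have "\<dots> = (K * m)^3 * (60 * of_bool (shell p a b (\<sigma> * s + m) w) + 2000/6 * (real p * \<tau>))"
      by (simp add: algebra_simps)
    also have "\<dots> \<le> (K * m)^3 * (60 * of_bool (shell p a b (\<sigma> * s + m) w) + 334 * (real p * \<tau>))"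
      using K m \<tau> by (intro mult_left_mono add_left_mono mult_right_mono) auto
    finally show "\<bar>box_mass p \<sigma> a b (\<lambda>j. w j + x j) - box_mass p \<sigma> a b w - (\<Sum>j<p. \<alpha> j * x j) - (\<Sum>i<p. \<Sum>j<p. \<beta> i j * (x i * x j)) / 2\<bar>
     \<le> (2 * s / \<sigma>)^3 * m^3 * (60 * of_bool (shell p a b (\<sigma> * s + m) w) + 334 * (real p * \<tau>))"
      unfolding e g0 K_def[symmetric] power_mult_distrib .
  qed
qed

section \<open>Gaussian laws and boxes\<close>

definition pbox :: "nat \<Rightarrow> (nat \<Rightarrow> real) \<Rightarrow> (nat \<Rightarrow> real) \<Rightarrow> (nat \<Rightarrow> real) set" where
  "pbox p a b = {w \<in> space (Rp p). in_box p a b w}"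

definition std_gauss :: "nat \<Rightarrow> (nat \<Rightarrow> real) measure" where
  "std_gauss p = (\<Pi>\<^sub>M j\<in>{..<p}. std_normal_distribution)"

lemma space_Rp: "space (Rp p) = PiE {..<p} (\<lambda>_. UNIV)"
  by (simp add: Rp_def space_PiM)

lemma in_box_measurable[measurable]: "Measurable.pred (Rp p) (in_box p a b)"
  unfolding in_box_def Rp_def by measurable

lemma shell_measurable[measurable]: "Measurable.pred (Rp p) (shell p a b e)"
  unfolding shell_def by measurable

lemma box_sets[measurable]: "pbox p a b \<in> sets (Rp p)"
  unfolding pbox_def by measurable

lemma in_box_mono: "in_box p a b w \<Longrightarrow> (\<And>j. j < p \<Longrightarrow> a' j \<le> a j) \<Longrightarrow> (\<And>j. j < p \<Longrightarrow> b j \<le> b' j) \<Longrightarrow> in_box p a' b' w"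
  unfolding in_box_def by (meson order_trans)

lemma law_box: "law p P \<Longrightarrow> pbox p a b \<in> sets P"
  using box_sets by (auto simp: law_def)

lemma sets_std_gauss: "sets (std_gauss p) = sets (Rp p)"
  unfolding std_gauss_def Rp_def by (rule sets_PiM_cong) auto

lemma law_std_gauss: "law p (std_gauss p)"
  unfolding law_def using sets_std_gauss by (auto simp: std_gauss_def intro!: prob_space_PiM N1.prob_space_axioms)

lemma char_std_normal: "(CLINT x|std_normal_distribution. cis (c * x)) = exp (- of_real (c\<^sup>2) / 2)"
proof -
  have "(CLINT x|std_normal_distribution. cis (c * x)) = char std_normal_distribution c"
    by (simp add: char_def cis_conv_exp mult.commute)
  also have "\<dots> = complex_of_real (exp (- (c\<^sup>2) / 2))" by (simp add: char_std_normal_distribution)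
  also have "\<dots> = exp (of_real (- (c\<^sup>2) / 2))" by (rule exp_of_real[symmetric])
  finally show ?thesis by (simp only: of_real_divide of_real_minus of_real_numeral)
qed

lemma char_fun_std_gauss: "char_fun p (std_gauss p) a = exp (- of_real (\<Sum>j<p. (a j)\<^sup>2) / 2)"
proof -
  interpret product_prob_space "\<lambda>_. std_normal_distribution" "{..<p}" by standard
  have "char_fun p (std_gauss p) a = (CLINT x|std_gauss p. (\<Prod>j<p. cis (a j * x j)))"
    unfolding char_fun_def by (simp add: cis_conv_exp exp_sum sum_distrib_left)
  also have "\<dots> = (\<Prod>j<p. (CLINT x|std_normal_distribution. cis (a j * x)))"
    unfolding std_gauss_def
  proof (rule product_integral_prod)
    show "integrable std_normal_distribution (\<lambda>x. cis (a i * x))" for i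
      by (rule N1.integrable_const_bound[of _ 1]) (auto simp: cis_conv_exp)
  qed simp
  also have "\<dots> = exp (- of_real (\<Sum>j<p. (a j)\<^sup>2) / 2)"
    unfolding char_std_normal by (simp add: exp_sum[symmetric] sum_negf sum_divide_distrib)
  finally show ?thesis .
qed

definition lin_normal :: "nat \<Rightarrow> (nat \<Rightarrow> nat \<Rightarrow> real) \<Rightarrow> (nat \<Rightarrow> real) measure" where
  "lin_normal p B = distr (std_gauss p) (Rp p) (\<lambda>z. \<lambda>j\<in>{..<p}. \<Sum>k<p. B j k * z k)"

lemma lin_normal:
  shows law_lin_normal: "law p (lin_normal p B)"
    and char_fun_lin_normal: "char_fun p (lin_normal p B) a = exp (- of_real (\<Sum>k<p. (\<Sum>j<p. a j * B j k)\<^sup>2) / 2)"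
proof -
  have m: "(\<lambda>z. \<lambda>j\<in>{..<p}. \<Sum>k<p. B j k * z k) \<in> std_gauss p \<rightarrow>\<^sub>M Rp p"
    by (intro restrict_Rp borel_measurable_sum borel_measurable_times component_law[OF law_std_gauss]) auto
  show "law p (lin_normal p B)" unfolding lin_normal_def
    by (intro law_distr m) (use law_std_gauss in \<open>auto simp: law_def\<close>)
  have "char_fun p (lin_normal p B) a = (CLINT z|std_gauss p. cis (\<Sum>j<p. a j * (\<Sum>k<p. B j k * z k)))"
    unfolding lin_normal_def by (subst char_fun_distr[OF m]) (simp)
  also have "(\<lambda>z. \<Sum>j<p. a j * (\<Sum>k<p. B j k * z k)) = (\<lambda>z. \<Sum>k<p. (\<Sum>j<p. a j * B j k) * z k)"
    unfolding sum_distrib_left sum_distrib_right by (subst sum.swap) (simp add: mult.assoc)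
  then have "(CLINT z|std_gauss p. cis (\<Sum>j<p. a j * (\<Sum>k<p. B j k * z k))) = char_fun p (std_gauss p) (\<lambda>k. \<Sum>j<p. a j * B j k)"
    unfolding char_fun_def by (simp add: fun_eq_iff)
  finally show "char_fun p (lin_normal p B) a = exp (- of_real (\<Sum>k<p. (\<Sum>j<p. a j * B j k)\<^sup>2) / 2)"
    by (simp add: char_fun_std_gauss)
qed

lemma measure_normal_interval:
  assumes "\<sigma> > 0"
  shows "measure std_normal_distribution {z. a \<le> x + \<sigma> * z \<and> x + \<sigma> * z \<le> b} = ival_mass \<sigma> a b x"
proof -
  have e: "{z. a \<le> x + \<sigma> * z \<and> x + \<sigma> * z \<le> b} = {(a - x) / \<sigma>..(b - x) / \<sigma>}"
    using assms by (auto simp: field_simps)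
  show ?thesis
  proof (cases "a \<le> b")
    case True
    then show ?thesis unfolding e using assms by (subst measure_Icc_Phi) (auto simp: ival_mass_deriv_def divide_right_mono)
  next
    case False
    then have e0: "{z. a \<le> x + \<sigma> * z \<and> x + \<sigma> * z \<le> b} = {}" by auto
    show ?thesis unfolding e0 using False by (simp add: ival_mass_deriv_def)
  qed
qed

lemma box_mass_prob:
  assumes "\<sigma> > 0"
  shows "measure (std_gauss p) {z \<in> space (std_gauss p). in_box p a b (\<lambda>j. x j + \<sigma> * z j)} = box_mass p \<sigma> a b x"
proof -
  interpret finite_product_prob_space "\<lambda>_. std_normal_distribution" "{..<p}" by standard (rule finite_lessThan)
  have "{z \<in> space (std_gauss p). in_box p a b (\<lambda>j. x j + \<sigma> * z j)} =
     PiE {..<p} (\<lambda>j. {z. a j \<le> x j + \<sigma> * z \<and> x j + \<sigma> * z \<le> b j})"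
    unfolding law_space[OF law_std_gauss] space_Rp
    by (rule Set.set_eqI) (simp only: mem_Collect_eq PiE_iff in_box_def lessThan_iff UNIV_I Ball_def simp_thms, meson)
  then have "measure (std_gauss p) {z \<in> space (std_gauss p). in_box p a b (\<lambda>j. x j + \<sigma> * z j)} =
     (\<Prod>j<p. measure std_normal_distribution {z. a j \<le> x j + \<sigma> * z \<and> x j + \<sigma> * z \<le> b j})"
    unfolding std_gauss_def by (simp add: prob_times)
  then show ?thesis by (simp add: measure_normal_interval[OF assms] box_mass_def)
qed

lemma box_mass_bounds: "\<sigma> > 0 \<Longrightarrow> 0 \<le> box_mass p \<sigma> a b x \<and> box_mass p \<sigma> a b x \<le> 1"
  unfolding box_mass_def by (auto intro!: prod_nonneg prod_le_1 ival_mass_bounds)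

lemma box_mass_measurable:
  assumes "\<sigma> > 0" "\<And>j. j < p \<Longrightarrow> (\<lambda>x. f x j) \<in> borel_measurable M"
  shows "(\<lambda>x. box_mass p \<sigma> a b (f x)) \<in> borel_measurable M"
proof -
  have "ival_mass_deriv 0 \<sigma> a b \<in> borel_measurable borel" for a b
    by (rule borel_measurable_continuous_onI)
       (intro continuous_at_imp_continuous_on ballI DERIV_isCont[OF ival_mass_deriv_step] assms; simp)
  from measurable_compose[OF assms(2) this] show ?thesis unfolding box_mass_def
    by (intro borel_measurable_prod) auto
qed

lemma law_box_mass_measurable: "law p P \<Longrightarrow> \<sigma> > 0 \<Longrightarrow> box_mass p \<sigma> a b \<in> borel_measurable P"
  using box_mass_measurable[of \<sigma> p "\<lambda>x. x" P a b] component_law by auto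

lemma conv_box:
  assumes "law p P" "law p Q"
  shows "measure (conv p P Q) (pbox p a b) = (\<integral>x. measure Q {y \<in> space Q. in_box p a b (\<lambda>j. x j + y j)} \<partial>P)"
proof -
  have "measure (conv p P Q) (pbox p a b) = (\<integral>x. indicator (pbox p a b) x \<partial>conv p P Q)"
    using law_box[OF law_conv[OF assms]] by simp
  also have "\<dots> = (\<integral>x. (\<integral>y. indicator (pbox p a b) (padd p x y) \<partial>Q) \<partial>P)"
    by (rule integral_conv[OF assms, where K=1]) (auto simp: indicator_def)
  also have "\<dots> = (\<integral>x. measure Q {y \<in> space Q. in_box p a b (\<lambda>j. x j + y j)} \<partial>P)"
  proof (intro Bochner_Integration.integral_cong refl)
    fix x
    have "(\<integral>y. indicator (pbox p a b) (padd p x y) \<partial>Q) = (\<integral>y. indicator {y \<in> space Q. in_box p a b (\<lambda>j. x j + y j)} y \<partial>Q :: real)"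
      by (intro Bochner_Integration.integral_cong refl) (auto simp: indicator_def pbox_def padd_def in_box_def space_Rp)
    also have "\<dots> = measure Q ({y \<in> space Q. in_box p a b (\<lambda>j. x j + y j)} \<inter> space Q)"
      by (rule Bochner_Integration.integral_indicator)
    also have "{y \<in> space Q. in_box p a b (\<lambda>j. x j + y j)} \<inter> space Q = {y \<in> space Q. in_box p a b (\<lambda>j. x j + y j)}" by auto
    finally show "(\<integral>y. indicator (pbox p a b) (padd p x y) \<partial>Q) = measure Q {y \<in> space Q. in_box p a b (\<lambda>j. x j + y j)}" .
  qed
  finally show ?thesis .
qed

lemma measure_scal:
  assumes "law p P"
  shows "measure (scal p c P) {y \<in> space (scal p c P). in_box p a b (\<lambda>j. x j + y j)} =
         measure P {z \<in> space P. in_box p a b (\<lambda>j. x j + c * z j)}"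
proof -
  have s: "space (scal p c P) = space (Rp p)" by (rule law_space[OF law_scal[OF assms]])
  have e: "{y \<in> space (Rp p). in_box p a b (\<lambda>j. x j + y j)} = pbox p (\<lambda>j. a j - x j) (\<lambda>j. b j - x j)"
    by (auto simp: pbox_def in_box_def algebra_simps)
  show ?thesis unfolding s unfolding e unfolding scal_def
    by (subst measure_distr[OF scal_measurable[OF assms] box_sets])
       (intro arg_cong[where f="measure P"], auto simp: pbox_def in_box_def space_Rp algebra_simps)
qed

lemma conv_smooth_box:
  assumes "law p P" "\<sigma> > 0"
  shows "measure (conv p P (scal p \<sigma> (std_gauss p))) (pbox p a b) = (\<integral>x. box_mass p \<sigma> a b x \<partial>P)"
  unfolding conv_box[OF assms(1) law_scal[OF law_std_gauss]] measure_scal[OF law_std_gauss] box_mass_prob[OF assms(2)] ..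

text \<open>Both ends of the interval lose a piece of length \<open>2 * e\<close>; each piece is compared with the tail beyond
it, and the two tails add up to the complement of the enlarged interval.\<close>

lemma ival_mass_shell:
  assumes T: "tail_bound s \<tau>" and \<sigma>: "\<sigma> > 0" and e: "0 \<le> e" "e / \<sigma> * s \<le> 1"
  shows "0 \<le> ival_mass \<sigma> (a - e) (b + e) x - ival_mass \<sigma> (a + e) (b - e) x"
    "ival_mass \<sigma> (a - e) (b + e) x - ival_mass \<sigma> (a + e) (b - e) x \<le> 3800 * (e / \<sigma> * s) * (1 - ival_mass \<sigma> (a - e) (b + e) x) + 2 * \<tau>"
proof -
  have s: "1 \<le> s" and \<tau>: "0 < \<tau>" using T by (auto simp: tail_bound_def)
  define c1 c2 e' where "c1 = (b + e - x) / \<sigma>" and "c2 = (a - e - x) / \<sigma>" and "e' = e / \<sigma>"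
  have e': "0 \<le> e'" "e' * s \<le> 1" using e \<sigma> by (auto simp: e'_def)
  have c1': "(b - e - x) / \<sigma> = c1 - 2 * e'" and c2': "(a + e - x) / \<sigma> = c2 + 2 * e'"
    using \<sigma> by (auto simp: c1_def c2_def e'_def field_simps)
  have h1: "Phi c1 - Phi (c1 - 2 * e') \<le> 3800 * (e' * s) * (1 - Phi c1) + \<tau>" by (rule Phi_hazard[OF T e'])
  have "Phi (- c2) - Phi (- c2 - 2 * e') \<le> 3800 * (e' * s) * (1 - Phi (- c2)) + \<tau>" by (rule Phi_hazard[OF T e'])
  then have h2: "Phi (c2 + 2 * e') - Phi c2 \<le> 3800 * (e' * s) * Phi c2 + \<tau>"
    using Phi_minus[of c2] Phi_minus[of "c2 + 2 * e'"] by simp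
  show "0 \<le> ival_mass \<sigma> (a - e) (b + e) x - ival_mass \<sigma> (a + e) (b - e) x"
    using e \<sigma> ival_mass_bounds(1)[OF \<sigma>, of "a - e" "b + e" x]
      Phi_mono[of "c1 - 2 * e'" c1] Phi_mono[of c2 "c2 + 2 * e'"] e'
    by (auto simp: ival_mass_deriv_def c1_def[symmetric] c2_def[symmetric] c1' c2')
  show "ival_mass \<sigma> (a - e) (b + e) x - ival_mass \<sigma> (a + e) (b - e) x \<le> 3800 * (e / \<sigma> * s) * (1 - ival_mass \<sigma> (a - e) (b + e) x) + 2 * \<tau>"
  proof (cases "a - e \<le> b + e")
    case False
    then show ?thesis using e \<sigma> \<tau> s by (auto simp: ival_mass_deriv_def intro!: add_nonneg_nonneg mult_nonneg_nonneg)
  next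
    case True
    then have f: "ival_mass \<sigma> (a - e) (b + e) x = Phi c1 - Phi c2" by (simp add: ival_mass_deriv_def c1_def c2_def)
    have "Phi (c1 - 2 * e') - Phi (c2 + 2 * e') \<le> ival_mass \<sigma> (a + e) (b - e) x"
    proof (cases "a + e \<le> b - e")
      case True
      then show ?thesis by (simp add: ival_mass_deriv_def c1' c2')
    next
      case False
      then have "c1 - 2 * e' \<le> c2 + 2 * e'" unfolding c1'[symmetric] c2'[symmetric] using \<sigma> by (intro divide_right_mono) auto
      then show ?thesis using False Phi_mono by (simp add: ival_mass_deriv_def)
    qed
    then have "ival_mass \<sigma> (a - e) (b + e) x - ival_mass \<sigma> (a + e) (b - e) x \<le>
       (3800 * (e' * s) * (1 - Phi c1) + \<tau>) + (3800 * (e' * s) * Phi c2 + \<tau>)"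
      unfolding f using h1 h2 by linarith
    also have "\<dots> = 3800 * (e' * s) * (1 - (Phi c1 - Phi c2)) + 2 * \<tau>" by (simp add: algebra_simps)
    finally show ?thesis by (simp add: f e'_def)
  qed
qed

text \<open>Exchanging one factor at a time leaves a product of factors that are at most \<open>exp (- (1 - f j))\<close>; the
surplus \<open>1\<close> in the exponent pays for the factor that is missing.\<close>

lemma prod_diff_exp_bound:
  fixes f g :: "nat \<Rightarrow> real"
  assumes "finite J" "\<And>j. j \<in> J \<Longrightarrow> 0 \<le> g j \<and> g j \<le> f j \<and> f j \<le> 1"
  shows "(\<Prod>j\<in>J. f j) - (\<Prod>j\<in>J. g j) \<le> exp (1 - (\<Sum>j\<in>J. 1 - f j)) * (\<Sum>j\<in>J. f j - g j)"
  using assms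
proof (induction J rule: finite_induct)
  case (insert i J)
  let ?E = "exp (1 - (\<Sum>j\<in>J. 1 - f j))"
  have i: "0 \<le> g i" "g i \<le> f i" "f i \<le> 1" using insert.prems[of i] by auto
  have E: "(\<Prod>j\<in>J. f j) \<le> exp (- (\<Sum>j\<in>J. 1 - f j))"
    unfolding sum_negf[symmetric] exp_sum[OF insert.hyps(1)]
  proof (rule prod_mono)
    fix j assume "j \<in> J"
    then have "0 \<le> g j" "g j \<le> f j" using insert.prems[of j] by auto
    then show "0 \<le> f j \<and> f j \<le> exp (- (1 - f j))" using exp_ge_add_one_self[of "- (1 - f j)"] by simp
  qed
  have IH: "(\<Prod>j\<in>J. f j) - (\<Prod>j\<in>J. g j) \<le> ?E * (\<Sum>j\<in>J. f j - g j)" using insert by auto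
  have D0: "0 \<le> ?E * (\<Sum>j\<in>J. f j - g j)" using insert.prems by (intro mult_nonneg_nonneg sum_nonneg) auto
  have fe: "f i \<le> exp (- (1 - f i))" using exp_ge_add_one_self[of "- (1 - f i)"] by simp
  have "(\<Prod>j\<in>insert i J. f j) - (\<Prod>j\<in>insert i J. g j) =
      (f i - g i) * (\<Prod>j\<in>J. f j) + g i * ((\<Prod>j\<in>J. f j) - (\<Prod>j\<in>J. g j))"
    using insert.hyps by (simp add: algebra_simps)
  also have "\<dots> \<le> (f i - g i) * (exp (- (1 - f i)) * ?E) + exp (- (1 - f i)) * (?E * (\<Sum>j\<in>J. f j - g j))"
  proof (rule add_mono)
    have "(\<Prod>j\<in>J. f j) \<le> exp (- (\<Sum>j\<in>J. 1 - f j))" by (rule E)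
    also have "\<dots> \<le> exp (- (1 - f i)) * ?E" unfolding exp_add[symmetric] using i by simp
    finally show "(f i - g i) * (\<Prod>j\<in>J. f j) \<le> (f i - g i) * (exp (- (1 - f i)) * ?E)"
      using i by (intro mult_left_mono) auto
    have "g i * ((\<Prod>j\<in>J. f j) - (\<Prod>j\<in>J. g j)) \<le> g i * (?E * (\<Sum>j\<in>J. f j - g j))"
      using i IH by (intro mult_left_mono) auto
    also have "\<dots> \<le> exp (- (1 - f i)) * (?E * (\<Sum>j\<in>J. f j - g j))"
      using i fe D0 by (intro mult_right_mono) auto
    finally show "g i * ((\<Prod>j\<in>J. f j) - (\<Prod>j\<in>J. g j)) \<le> exp (- (1 - f i)) * (?E * (\<Sum>j\<in>J. f j - g j))" .
  qed
  also have "\<dots> = exp (- (1 - f i)) * ?E * (\<Sum>j\<in>insert i J. f j - g j)"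
    using insert.hyps by (simp add: algebra_simps)
  also have "exp (- (1 - f i)) * ?E = exp (1 - (\<Sum>j\<in>insert i J. 1 - f j))"
    unfolding exp_add[symmetric] using insert.hyps by simp
  finally show ?case .
qed simp

text \<open>By \<open>ival_mass_shell\<close> and \<open>prod_diff_exp_bound\<close> the difference is at most \<open>exp (1 - Q)\<close> times a multiple of \<open>e / \<sigma> * s * Q\<close>, where
\<open>Q\<close> is the total complementary mass; \<open>Q * exp (- Q)\<close> is bounded, whatever the number of coordinates.\<close>

lemma box_mass_shell:
  assumes T: "tail_bound s \<tau>" and \<sigma>: "\<sigma> > 0" and e: "0 \<le> e"
  shows "box_mass p \<sigma> (\<lambda>j. a j - e) (\<lambda>j. b j + e) x - box_mass p \<sigma> (\<lambda>j. a j + e) (\<lambda>j. b j - e) x \<le>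
      3800 * (e / \<sigma> * s) + 6 * (real p * \<tau>)"
proof (cases "e / \<sigma> * s \<le> 1")
  case False
  have "0 \<le> real p * \<tau>" using T by (auto simp: tail_bound_def)
  then show ?thesis using False box_mass_bounds[OF \<sigma>, of p "\<lambda>j. a j - e" "\<lambda>j. b j + e" x]
    box_mass_bounds[OF \<sigma>, of p "\<lambda>j. a j + e" "\<lambda>j. b j - e" x] by linarith
next
  case True
  have s: "1 \<le> s" and \<tau>: "0 < \<tau>" using T by (auto simp: tail_bound_def)
  define f g where "f j = ival_mass \<sigma> (a j - e) (b j + e) (x j)" and "g j = ival_mass \<sigma> (a j + e) (b j - e) (x j)" for j
  define E where "E = e / \<sigma> * s"
  have E: "0 \<le> E" using e s \<sigma> by (simp add: E_def)
  note r = ival_mass_shell[OF T \<sigma> e True]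
  have fg: "0 \<le> g j \<and> g j \<le> f j \<and> f j \<le> 1" for j
    using r(1)[of "a j" "b j" "x j"] ival_mass_bounds[OF \<sigma>] by (auto simp: f_def g_def)
  define Q where "Q = (\<Sum>j<p. 1 - f j)"
  have Q: "0 \<le> Q" unfolding Q_def using fg by (intro sum_nonneg) auto
  have "(\<Prod>j<p. f j) - (\<Prod>j<p. g j) \<le> exp (1 - Q) * (\<Sum>j<p. f j - g j)"
    unfolding Q_def by (rule prod_diff_exp_bound) (use fg in auto)
  also have "(\<Sum>j<p. f j - g j) \<le> (\<Sum>j<p. 3800 * E * (1 - f j) + 2 * \<tau>)"
    unfolding f_def g_def E_def by (intro sum_mono r)
  also have "\<dots> = 3800 * E * Q + 2 * (real p * \<tau>)" by (simp add: Q_def sum.distrib sum_distrib_left)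
  finally have "(\<Prod>j<p. f j) - (\<Prod>j<p. g j) \<le> exp (1 - Q) * (3800 * E * Q + 2 * (real p * \<tau>))"
    by simp
  also have "\<dots> = 3800 * E * (exp (1 - Q) * Q) + exp (1 - Q) * (2 * (real p * \<tau>))" by (simp add: algebra_simps)
  also have "\<dots> \<le> 3800 * E * 1 + 3 * (2 * (real p * \<tau>))"
  proof (intro add_mono mult_left_mono mult_right_mono)
    have "Q \<le> exp (Q - 1)" using exp_ge_add_one_self[of "Q - 1"] by simp
    then have "exp (1 - Q) * Q \<le> exp (1 - Q) * exp (Q - 1)" by (intro mult_left_mono) auto
    then show "exp (1 - Q) * Q \<le> 1" by (simp add: exp_add[symmetric])
    have "exp (1 - Q) \<le> exp 1" using Q by simp
    then show "exp (1 - Q) \<le> 3" using exp_le by linarith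
  qed (use E \<tau> in auto)
  finally show ?thesis by (simp add: box_mass_def f_def g_def E_def)
qed

lemma shell_measure:
  assumes P: "law p P" and e: "0 \<le> e"
  shows "measure P {w \<in> space P. shell p a b e w} =
    measure P (pbox p (\<lambda>j. a j - e) (\<lambda>j. b j + e)) - measure P (pbox p (\<lambda>j. a j + e) (\<lambda>j. b j - e))"
proof -
  interpret prob_space P using P by (simp add: law_def)
  have sub: "pbox p (\<lambda>j. a j + e) (\<lambda>j. b j - e) \<subseteq> pbox p (\<lambda>j. a j - e) (\<lambda>j. b j + e)"
    unfolding pbox_def using e by (auto intro: in_box_mono)
  have "{w \<in> space P. shell p a b e w} = pbox p (\<lambda>j. a j - e) (\<lambda>j. b j + e) - pbox p (\<lambda>j. a j + e) (\<lambda>j. b j - e)"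
    unfolding law_space[OF P] pbox_def shell_def by auto
  then show ?thesis using finite_measure_Diff[OF law_box[OF P] law_box[OF P] sub] by simp
qed

text \<open>Only the independent part of the normal law is used; the bound for it holds for every shift of the
box and survives averaging over \<open>W\<close>. This costs a factor \<open>1 / \<sigma>\<close>.\<close>

lemma gauss_anticoncentration:
  assumes T: "tail_bound s \<tau>" and \<sigma>: "\<sigma> > 0" and e: "0 \<le> e" and W: "law p W"
    and \<gamma>: "\<gamma> = conv p W (scal p \<sigma> (std_gauss p))"
  shows "measure \<gamma> {w \<in> space \<gamma>. shell p a b e w} \<le> 3800 * (e / \<sigma> * s) + 6 * (real p * \<tau>)"
proof -
  interpret W: prob_space W using W by (simp add: law_def)
  have l: "law p \<gamma>" unfolding \<gamma> by (intro law_conv W law_scal law_std_gauss)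
  have i: "integrable W (box_mass p \<sigma> c d)" for c d
    by (rule W.integrable_const_bound[of _ 1]) (use box_mass_bounds[OF \<sigma>] law_box_mass_measurable[OF W \<sigma>] in auto)
  have "measure \<gamma> {w \<in> space \<gamma>. shell p a b e w} =
    (\<integral>x. box_mass p \<sigma> (\<lambda>j. a j - e) (\<lambda>j. b j + e) x \<partial>W) - (\<integral>x. box_mass p \<sigma> (\<lambda>j. a j + e) (\<lambda>j. b j - e) x \<partial>W)"
    unfolding shell_measure[OF l e] unfolding \<gamma> conv_smooth_box[OF W \<sigma>] ..
  also have "\<dots> = (\<integral>x. box_mass p \<sigma> (\<lambda>j. a j - e) (\<lambda>j. b j + e) x - box_mass p \<sigma> (\<lambda>j. a j + e) (\<lambda>j. b j - e) x \<partial>W)"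
    by (rule Bochner_Integration.integral_diff[symmetric, OF i i])
  also have "\<dots> \<le> (\<integral>x. 3800 * (e / \<sigma> * s) + 6 * (real p * \<tau>) \<partial>W)"
    by (intro integral_mono Bochner_Integration.integrable_diff i box_mass_shell[OF T \<sigma> e]) auto
  finally show ?thesis by (simp add: W.prob_space)
qed

section \<open>One step of the Lindeberg replacement\<close>

definition max_abs :: "nat \<Rightarrow> (nat \<Rightarrow> real) \<Rightarrow> real" where
  "max_abs p x = (MAX j\<in>{..<p}. \<bar>x j\<bar>)"

lemma max_abs_ge: "j < p \<Longrightarrow> \<bar>x j\<bar> \<le> max_abs p x"
  unfolding max_abs_def by (intro Max_ge) auto

lemma max_abs_le: "0 < p \<Longrightarrow> (\<And>j. j < p \<Longrightarrow> \<bar>x j\<bar> \<le> c) \<Longrightarrow> max_abs p x \<le> c"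
  unfolding max_abs_def by (subst Max_le_iff) auto

lemma max_abs_attained: "0 < p \<Longrightarrow> \<exists>j<p. max_abs p x = \<bar>x j\<bar>"
proof -
  assume "0 < p"
  then have "max_abs p x \<in> (\<lambda>j. \<bar>x j\<bar>) ` {..<p}" unfolding max_abs_def by (intro Max_in) auto
  then show ?thesis by auto
qed

lemma max_abs_nonneg: "0 < p \<Longrightarrow> 0 \<le> max_abs p x"
  using max_abs_ge[of 0 p x] by auto

lemma max_abs_measurable: "law p P \<Longrightarrow> max_abs p \<in> borel_measurable P"
proof -
  assume P: "law p P"
  have [measurable]: "(\<lambda>x. x j) \<in> borel_measurable P" if "j < p" for j by (rule component_law[OF P that])
  show ?thesis unfolding max_abs_def[abs_def] by (intro borel_measurable_Max borel_measurable_abs) auto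
qed

lemma max_abs_scale:
  assumes "0 < p" "0 \<le> c" shows "max_abs p (\<lambda>j\<in>{..<p}. c * x j) = c * max_abs p x"
proof (rule antisym)
  show "max_abs p (\<lambda>j\<in>{..<p}. c * x j) \<le> c * max_abs p x"
    using assms by (intro max_abs_le) (auto simp: abs_mult intro!: mult_left_mono max_abs_ge)
  obtain j where j: "j < p" "max_abs p x = \<bar>x j\<bar>" using max_abs_attained[OF assms(1)] by blast
  show "c * max_abs p x \<le> max_abs p (\<lambda>j\<in>{..<p}. c * x j)"
    using max_abs_ge[OF j(1), of "\<lambda>j\<in>{..<p}. c * x j"] j assms by (simp add: abs_mult)
qed

lemma pow4_le_exp: "u ^ 4 \<le> 384 * exp (u / 2)" if "0 \<le> u" for u :: real
proof -
  have "(u / 2) ^ 4 /\<^sub>R fact 4 \<le> (\<Sum>k<5. (u / 2) ^ k /\<^sub>R fact k)"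
    using that by (intro member_le_sum[where f="\<lambda>k. (u / 2) ^ k /\<^sub>R fact k"]) auto
  also have "\<dots> \<le> exp (u / 2)"
    unfolding exp_def using that by (intro sum_le_suminf summable_exp_generic) auto
  finally show ?thesis by (simp add: power_divide fact_numeral)
qed

text \<open>Below twice the \<open>q\<close>-th root \<open>l\<close> of \<open>L\<close> the power is of the desired size; above it the exponential gains
the factor \<open>exp L \<ge> P\<close>. Dividing by \<open>P\<close> makes the bound summable over \<open>P\<close> coordinates.\<close>

lemma power_exp_split:
  fixes u l L :: real
  assumes u: "0 \<le> u" and q: "q \<in> {1, 2::nat}" and l: "1 \<le> l" "l ^ q = L" and p: "0 < P" "P \<le> exp L" and m: "m \<le> 4"
  shows "u ^ m \<le> 16 * l ^ m + 384 / P * exp (u ^ q)"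
proof (cases "u \<le> 2 * l")
  case True
  have "u ^ m \<le> (2 * l) ^ m" using u True by (intro power_mono) auto
  also have "\<dots> = 2 ^ m * l ^ m" by (simp add: power_mult_distrib)
  also have "\<dots> \<le> 2 ^ 4 * l ^ m" using m l by (intro mult_right_mono power_increasing) auto
  also have "\<dots> \<le> 16 * l ^ m + 384 / P * exp (u ^ q)" using p by simp
  finally show ?thesis .
next
  case False
  have u1: "1 \<le> u" using False l by linarith
  have "2 * L \<le> 2 ^ q * l ^ q" using q l by auto
  also have "\<dots> = (2 * l) ^ q" by (simp add: power_mult_distrib)
  also have "\<dots> \<le> u ^ q" using False l by (intro power_mono) auto
  finally have L: "2 * L \<le> u ^ q" .
  have uq: "u \<le> u ^ q" using u1 q by (auto simp: self_le_power)
  have "u ^ m \<le> u ^ 4" using m u1 by (intro power_increasing) auto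
  also have "\<dots> \<le> 384 * exp (u / 2)" by (rule pow4_le_exp[OF u])
  also have "\<dots> \<le> 384 * exp (u ^ q / 2)" using uq by simp
  finally have 1: "u ^ m \<le> 384 * exp (u ^ q / 2)" .
  have "P * exp (u ^ q / 2) \<le> exp L * exp (u ^ q / 2)" using p by (intro mult_right_mono) auto
  also have "\<dots> \<le> exp (u ^ q)" unfolding exp_add[symmetric] using L by simp
  finally have "exp (u ^ q / 2) \<le> exp (u ^ q) / P" using p by (simp add: field_simps)
  then have "u ^ m \<le> 384 / P * exp (u ^ q)" using 1 by simp
  then show ?thesis using l by (simp add: add_increasing)
qed

lemma max_moment:
  assumes P: "law p P" and p: "0 < p" and q: "q \<in> {1, 2::nat}" and t: "0 < t" and l: "1 \<le> l" "real p \<le> exp (l ^ q)"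
    and E: "\<And>j. j < p \<Longrightarrow> (\<integral>\<^sup>+x. ennreal (exp (\<bar>x j\<bar> ^ q / t ^ q)) \<partial>P) \<le> 2" and m: "m \<le> 4"
  shows "integrable P (\<lambda>x. max_abs p x ^ m)" "(\<integral>x. max_abs p x ^ m \<partial>P) \<le> 784 * (t * l) ^ m"
proof -
  interpret prob_space P using P by (simp add: law_def)
  note [measurable] = max_abs_measurable[OF P]
  have [measurable]: "(\<lambda>x. x j) \<in> borel_measurable P" if "j < p" for j by (rule component_law[OF P that])
  have pt: "max_abs p x ^ m \<le> t ^ m * (16 * l ^ m + 384 / real p * (\<Sum>j<p. exp (\<bar>x j\<bar> ^ q / t ^ q)))" for x
  proof -
    obtain j where j: "j < p" "max_abs p x = \<bar>x j\<bar>" using max_abs_attained[OF p] by blast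
    have "(\<bar>x j\<bar> / t) ^ m \<le> 16 * l ^ m + 384 / real p * exp ((\<bar>x j\<bar> / t) ^ q)"
      using t p l m by (intro power_exp_split[OF _ q _ refl]) auto
    also have "\<dots> \<le> 16 * l ^ m + 384 / real p * (\<Sum>j<p. exp (\<bar>x j\<bar> ^ q / t ^ q))"
      unfolding power_divide using j
      by (intro add_left_mono mult_left_mono member_le_sum[where f="\<lambda>j. exp (\<bar>x j\<bar> ^ q / t ^ q)"]) auto
    finally have "t ^ m * (\<bar>x j\<bar> / t) ^ m \<le> t ^ m * (16 * l ^ m + 384 / real p * (\<Sum>j<p. exp (\<bar>x j\<bar> ^ q / t ^ q)))"
      using t by (intro mult_left_mono) auto
    moreover have "t ^ m * (\<bar>x j\<bar> / t) ^ m = max_abs p x ^ m" using t j by (simp add: power_divide)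
    ultimately show ?thesis by simp
  qed
  have "(\<integral>\<^sup>+x. ennreal (max_abs p x ^ m) \<partial>P) \<le>
      (\<integral>\<^sup>+x. ennreal (t ^ m) * (ennreal (16 * l ^ m) + ennreal (384 / real p) * (\<Sum>j<p. ennreal (exp (\<bar>x j\<bar> ^ q / t ^ q)))) \<partial>P)"
  proof (rule nn_integral_mono)
    fix x
    have "ennreal (max_abs p x ^ m) \<le> ennreal (t ^ m * (16 * l ^ m + 384 / real p * (\<Sum>j<p. exp (\<bar>x j\<bar> ^ q / t ^ q))))"
      by (intro ennreal_leI pt)
    also have "\<dots> = ennreal (t ^ m) * (ennreal (16 * l ^ m) + ennreal (384 / real p) * (\<Sum>j<p. ennreal (exp (\<bar>x j\<bar> ^ q / t ^ q))))"
      using t l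
      by (simp add: ennreal_mult[symmetric] sum_ennreal sum_nonneg ennreal_plus[symmetric] del: ennreal_plus)
    finally show "ennreal (max_abs p x ^ m) \<le> \<dots>" .
  qed
  also have "\<dots> = ennreal (t ^ m) * (ennreal (16 * l ^ m) + ennreal (384 / real p) * (\<Sum>j<p. (\<integral>\<^sup>+x. ennreal (exp (\<bar>x j\<bar> ^ q / t ^ q)) \<partial>P)))"
    by (subst nn_integral_cmult, simp, subst nn_integral_add, simp, simp, subst nn_integral_cmult, simp, subst nn_integral_sum)
       (auto simp: emeasure_space_1)
  also have "\<dots> \<le> ennreal (t ^ m) * (ennreal (16 * l ^ m) + ennreal (384 / real p) * (\<Sum>j<p. 2))"
    by (intro mult_left_mono add_left_mono sum_mono) (use E in auto)
  also have "(\<Sum>j<p. 2 :: ennreal) = ennreal (real p * 2)" by (simp add: ennreal_mult'' ennreal_of_nat_eq_real_of_nat)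
  also have "ennreal (t ^ m) * (ennreal (16 * l ^ m) + ennreal (384 / real p) * ennreal (real p * 2)) =
      ennreal (t ^ m * (16 * l ^ m + 768))"
  proof -
    have 1: "ennreal (384 / real p) * ennreal (real p * 2) = ennreal 768"
      using p by (subst ennreal_mult[symmetric]) auto
    have 2: "ennreal (16 * l ^ m) + ennreal 768 = ennreal (16 * l ^ m + 768)"
      using l by (subst ennreal_plus) auto
    show ?thesis unfolding 1 2 using t l by (subst ennreal_mult) auto
  qed
  also have "\<dots> \<le> ennreal (784 * (t * l) ^ m)"
  proof (rule ennreal_leI)
    have "1 \<le> l ^ m" using l by simp
    then have "t ^ m * (16 * l ^ m + 768) \<le> t ^ m * (784 * l ^ m)" using t by (intro mult_left_mono) auto
    then show "t ^ m * (16 * l ^ m + 768) \<le> 784 * (t * l) ^ m" by (simp add: power_mult_distrib mult_ac)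
  qed
  finally have *: "(\<integral>\<^sup>+x. ennreal (max_abs p x ^ m) \<partial>P) \<le> ennreal (784 * (t * l) ^ m)" .
  have nn: "0 \<le> max_abs p x ^ m" for x using max_abs_nonneg[OF p] by simp
  show i: "integrable P (\<lambda>x. max_abs p x ^ m)"
    by (rule integrableI_nonneg) (use * nn in \<open>auto intro: le_less_trans\<close>)
  have "ennreal (\<integral>x. max_abs p x ^ m \<partial>P) \<le> ennreal (784 * (t * l) ^ m)"
    using * nn_integral_eq_integral[OF i] nn by simp
  then show "(\<integral>x. max_abs p x ^ m \<partial>P) \<le> 784 * (t * l) ^ m" using t l by (simp add: ennreal_le_iff)
qed

definition moments_agree :: "nat \<Rightarrow> (nat \<Rightarrow> real) measure \<Rightarrow> (nat \<Rightarrow> real) measure \<Rightarrow> bool" where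
  "moments_agree p U V \<longleftrightarrow> (\<forall>i<p. (\<integral>x. x i \<partial>U) = (\<integral>x. x i \<partial>V)) \<and>
     (\<forall>i<p. \<forall>j<p. (\<integral>x. x i * x j \<partial>U) = (\<integral>x. x i * x j \<partial>V))"

lemma coordinate_integrable:
  assumes U: "law p U" and m: "integrable U (\<lambda>x. max_abs p x ^ 4)" and i: "i < p"
  shows "integrable U (\<lambda>x. x i)" "j < p \<Longrightarrow> integrable U (\<lambda>x. x i * x j)"
     "integrable U (\<lambda>x. max_abs p x ^ 3)"
proof -
  interpret prob_space U using U by (simp add: law_def)
  note [measurable] = max_abs_measurable[OF U]
  have [measurable]: "(\<lambda>x. x j) \<in> borel_measurable U" if "j < p" for j by (rule component_law[OF U that])
  have i1: "integrable U (\<lambda>x. 1 + max_abs p x ^ 4)" using m by simp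
  have p: "0 < p" using i by simp
  have b: "u \<le> 1 + u ^ 4" "u\<^sup>2 \<le> 1 + u ^ 4" "u ^ 3 \<le> 1 + u ^ 4" if "0 \<le> u" for u :: real
  proof -
    have "u \<le> 1 + u ^ 4 \<and> u\<^sup>2 \<le> 1 + u ^ 4 \<and> u ^ 3 \<le> 1 + u ^ 4"
    proof (cases "u \<le> 1")
      case True
      then have "u\<^sup>2 \<le> 1" "u ^ 3 \<le> 1" "0 \<le> u ^ 4" using that by (auto simp: power_le_one)
      then show ?thesis using True by linarith
    next
      case False
      then have "u ^ 1 \<le> u ^ 4" "u\<^sup>2 \<le> u ^ 4" "u ^ 3 \<le> u ^ 4" by (intro power_increasing; simp)+
      then show ?thesis by simp
    qed
    then show "u \<le> 1 + u ^ 4" "u\<^sup>2 \<le> 1 + u ^ 4" "u ^ 3 \<le> 1 + u ^ 4" by auto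
  qed
  show "integrable U (\<lambda>x. x i)"
  proof (rule Bochner_Integration.integrable_bound[OF i1])
    have "norm (x i) \<le> norm (1 + max_abs p x ^ 4)" for x
      using max_abs_ge[OF i, of x] b(1)[OF max_abs_nonneg[OF p], of x] by simp
    then show "AE x in U. norm (x i) \<le> norm (1 + max_abs p x ^ 4)" by simp
  qed (use i in simp)
  show "integrable U (\<lambda>x. max_abs p x ^ 3)"
  proof (rule Bochner_Integration.integrable_bound[OF i1])
    have "norm (max_abs p x ^ 3) \<le> norm (1 + max_abs p x ^ 4)" for x
      using b(3)[OF max_abs_nonneg[OF p], of x] max_abs_nonneg[OF p, of x] by simp
    then show "AE x in U. norm (max_abs p x ^ 3) \<le> norm (1 + max_abs p x ^ 4)" by simp
  qed simp
  show "integrable U (\<lambda>x. x i * x j)" if j: "j < p"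
  proof (rule Bochner_Integration.integrable_bound[OF i1])
    have "norm (x i * x j) \<le> norm (1 + max_abs p x ^ 4)" for x
    proof -
      have "\<bar>x i\<bar> * \<bar>x j\<bar> \<le> max_abs p x * max_abs p x" by (intro mult_mono max_abs_ge i j max_abs_nonneg[OF p]) auto
      then show ?thesis using b(2)[OF max_abs_nonneg[OF p], of x] by (simp add: abs_mult power2_eq_square)
    qed
    then show "AE x in U. norm (x i * x j) \<le> norm (1 + max_abs p x ^ 4)" by simp
  qed (use i j in simp)
qed

text \<open>The linear and the quadratic term of the expansion at \<open>w\<close> have the same mean under \<open>U\<close> and \<open>V\<close>, which
leaves the two remainders.\<close>

lemma box_mass_diff_pointwise:
  fixes a b :: "nat \<Rightarrow> real"
  assumes T: "tail_bound s \<tau>" and \<sigma>: "\<sigma> > 0" and p\<tau>: "real p * \<tau> \<le> 1" and p: "0 < p"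
    and U: "law p U" and V: "law p V" and agree: "moments_agree p U V"
    and mU: "integrable U (\<lambda>x. max_abs p x ^ 4)" and mV: "integrable V (\<lambda>x. max_abs p x ^ 4)"
  defines "B \<equiv> \<lambda>w x. (2 * s / \<sigma>)^3 * (max_abs p x)^3 * (60 * of_bool (shell p a b (\<sigma> * s + max_abs p x) w) + 334 * (real p * \<tau>))"
  shows "ennreal \<bar>(\<integral>x. box_mass p \<sigma> a b (\<lambda>j. w j + x j) \<partial>U) - (\<integral>x. box_mass p \<sigma> a b (\<lambda>j. w j + x j) \<partial>V)\<bar> \<le>
    (\<integral>\<^sup>+x. ennreal (B w x) \<partial>U) + (\<integral>\<^sup>+x. ennreal (B w x) \<partial>V)"
proof -
  obtain \<alpha> \<beta> where ab: "\<And>x m. (\<forall>j<p. \<bar>x j\<bar> \<le> m) \<Longrightarrow> 0 \<le> m \<Longrightarrow>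
    \<bar>box_mass p \<sigma> a b (\<lambda>j. w j + x j) - box_mass p \<sigma> a b w - (\<Sum>j<p. \<alpha> j * x j) - (\<Sum>i<p. \<Sum>j<p. \<beta> i j * (x i * x j)) / 2\<bar>
     \<le> (2 * s / \<sigma>)^3 * m^3 * (60 * of_bool (shell p a b (\<sigma> * s + m) w) + 334 * (real p * \<tau>))"
    using box_mass_expansion[OF T \<sigma> p\<tau>, of a b w] by blast
  define lq where "lq x = (\<Sum>j<p. \<alpha> j * x j) + (\<Sum>i<p. \<Sum>j<p. \<beta> i j * (x i * x j)) / 2" for x
  define r where "r x = box_mass p \<sigma> a b (\<lambda>j. w j + x j) - box_mass p \<sigma> a b w - lq x" for x
  have rB: "\<bar>r x\<bar> \<le> B w x" for x
    using ab[of x "max_abs p x"] max_abs_ge max_abs_nonneg[OF p] unfolding r_def B_def lq_def by (simp add: algebra_simps)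
  have main: "(\<integral>x. box_mass p \<sigma> a b (\<lambda>j. w j + x j) \<partial>P) = box_mass p \<sigma> a b w + (\<integral>x. lq x \<partial>P) + (\<integral>x. r x \<partial>P)"
     "ennreal \<bar>\<integral>x. r x \<partial>P\<bar> \<le> (\<integral>\<^sup>+x. ennreal (B w x) \<partial>P)"
     "(\<integral>x. lq x \<partial>P) = (\<Sum>j<p. \<alpha> j * (\<integral>x. x j \<partial>P)) + (\<Sum>i<p. \<Sum>j<p. \<beta> i j * (\<integral>x. x i * x j \<partial>P)) / 2"
    if P: "law p P" and m: "integrable P (\<lambda>x. max_abs p x ^ 4)" for P
  proof -
    interpret prob_space P using P by (simp add: law_def)
    note ci = coordinate_integrable[OF P m]
    have lq: "integrable P lq" unfolding lq_def
      by (intro Bochner_Integration.integrable_add Bochner_Integration.integrable_sum integrable_mult_right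
            Bochner_Integration.integrable_divide ci) auto
    have bm: "integrable P (\<lambda>x. box_mass p \<sigma> a b (\<lambda>j. w j + x j))"
    proof (rule integrable_const_bound[of _ 1])
      show "(\<lambda>x. box_mass p \<sigma> a b (\<lambda>j. w j + x j)) \<in> borel_measurable P"
        by (intro box_mass_measurable \<sigma> borel_measurable_add borel_measurable_const component_law[OF P])
    qed (use box_mass_bounds[OF \<sigma>] in auto)
    have ri: "integrable P r" unfolding r_def
      by (intro Bochner_Integration.integrable_diff bm lq) auto
    show "(\<integral>x. box_mass p \<sigma> a b (\<lambda>j. w j + x j) \<partial>P) = box_mass p \<sigma> a b w + (\<integral>x. lq x \<partial>P) + (\<integral>x. r x \<partial>P)"
      unfolding r_def using bm lq by (simp add: prob_space)
    have "ennreal \<bar>\<integral>x. r x \<partial>P\<bar> \<le> ennreal (\<integral>x. \<bar>r x\<bar> \<partial>P)" by (intro ennreal_leI integral_abs_bound)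
    also have "\<dots> = (\<integral>\<^sup>+x. ennreal \<bar>r x\<bar> \<partial>P)" using ri by (intro nn_integral_eq_integral[symmetric]) auto
    also have "\<dots> \<le> (\<integral>\<^sup>+x. ennreal (B w x) \<partial>P)" by (intro nn_integral_mono ennreal_leI rB)
    finally show "ennreal \<bar>\<integral>x. r x \<partial>P\<bar> \<le> (\<integral>\<^sup>+x. ennreal (B w x) \<partial>P)" .
    have "(\<integral>x. (\<Sum>j<p. \<alpha> j * x j) \<partial>P) = (\<Sum>j<p. \<alpha> j * (\<integral>x. x j \<partial>P))"
      by (subst Bochner_Integration.integral_sum) (auto intro: ci)
    moreover have "(\<integral>x. (\<Sum>i<p. \<Sum>j<p. \<beta> i j * (x i * x j)) \<partial>P) = (\<Sum>i<p. \<Sum>j<p. \<beta> i j * (\<integral>x. x i * x j \<partial>P))"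
      by (subst Bochner_Integration.integral_sum, (intro Bochner_Integration.integrable_sum integrable_mult_right ci; simp),
          intro sum.cong refl, subst Bochner_Integration.integral_sum) (auto intro: ci)
    moreover have "(\<integral>x. lq x \<partial>P) = (\<integral>x. (\<Sum>j<p. \<alpha> j * x j) \<partial>P) + (\<integral>x. (\<Sum>i<p. \<Sum>j<p. \<beta> i j * (x i * x j)) / 2 \<partial>P)"
      unfolding lq_def
      by (intro Bochner_Integration.integral_add Bochner_Integration.integrable_sum integrable_mult_right
            Bochner_Integration.integrable_divide ci) auto
    ultimately show "(\<integral>x. lq x \<partial>P) = (\<Sum>j<p. \<alpha> j * (\<integral>x. x j \<partial>P)) + (\<Sum>i<p. \<Sum>j<p. \<beta> i j * (\<integral>x. x i * x j \<partial>P)) / 2"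
      by simp
  qed
  have lqe: "(\<integral>x. lq x \<partial>U) = (\<integral>x. lq x \<partial>V)"
    unfolding main(3)[OF U mU] main(3)[OF V mV] using agree by (simp add: moments_agree_def)
  have "\<bar>(\<integral>x. box_mass p \<sigma> a b (\<lambda>j. w j + x j) \<partial>U) - (\<integral>x. box_mass p \<sigma> a b (\<lambda>j. w j + x j) \<partial>V)\<bar> \<le>
     \<bar>\<integral>x. r x \<partial>U\<bar> + \<bar>\<integral>x. r x \<partial>V\<bar>"
    unfolding main(1)[OF U mU] main(1)[OF V mV] lqe by linarith
  then have "ennreal \<bar>(\<integral>x. box_mass p \<sigma> a b (\<lambda>j. w j + x j) \<partial>U) - (\<integral>x. box_mass p \<sigma> a b (\<lambda>j. w j + x j) \<partial>V)\<bar> \<le>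
     ennreal \<bar>\<integral>x. r x \<partial>U\<bar> + ennreal \<bar>\<integral>x. r x \<partial>V\<bar>"
    unfolding ennreal_plus[symmetric, OF abs_ge_zero abs_ge_zero] by (rule ennreal_leI)
  also have "\<dots> \<le> (\<integral>\<^sup>+x. ennreal (B w x) \<partial>U) + (\<integral>\<^sup>+x. ennreal (B w x) \<partial>V)"
    by (intro add_mono main(2) U V mU mV)
  finally show ?thesis .
qed

text \<open>Integrating over \<open>w\<close> first replaces the indicator of the shell by its probability; the width of the
shell depends on \<open>x\<close>, whence the fourth moment.\<close>

lemma shell_average:
  assumes T: "tail_bound s \<tau>" and \<sigma>: "\<sigma> > 0" and p: "0 < p"
    and P: "law p P" and U: "law p U" and mU: "integrable U (\<lambda>x. max_abs p x ^ 4)"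
    and sh: "\<And>e. 0 \<le> e \<Longrightarrow> measure P {w \<in> space P. shell p a b e w} \<le> b0 + b1 * e"
    and M: "(\<integral>x. max_abs p x ^ 3 \<partial>U) \<le> M3" "(\<integral>x. max_abs p x ^ 4 \<partial>U) \<le> M4" and b: "0 \<le> b0" "0 \<le> b1"
  defines "B \<equiv> \<lambda>w x. (2 * s / \<sigma>)^3 * (max_abs p x)^3 * (60 * of_bool (shell p a b (\<sigma> * s + max_abs p x) w) + 334 * (real p * \<tau>))"
  shows "(\<integral>\<^sup>+w. (\<integral>\<^sup>+x. ennreal (B w x) \<partial>U) \<partial>P) \<le>
     ennreal ((2 * s / \<sigma>)^3 * ((60 * (b0 + b1 * (\<sigma> * s)) + 334 * (real p * \<tau>)) * M3 + 60 * b1 * M4))"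
proof -
  interpret P: prob_space P using P by (simp add: law_def)
  interpret U: prob_space U using U by (simp add: law_def)
  interpret PU: pair_sigma_finite P U ..
  have s: "1 \<le> s" and \<tau>: "0 < \<tau>" using T by (auto simp: tail_bound_def)
  note [measurable] = max_abs_measurable[OF U]
  have [measurable]: "(\<lambda>x. x j) \<in> borel_measurable P" "(\<lambda>x. x j) \<in> borel_measurable U" if "j < p" for j
    using that by (auto intro: component_law P U)
  have shm[measurable]: "Measurable.pred (P \<Otimes>\<^sub>M U) (\<lambda>z. shell p a b (\<sigma> * s + max_abs p (snd z)) (fst z))"
    unfolding shell_def in_box_def by measurable
  have Bm: "(\<lambda>(w, x). ennreal (B w x)) \<in> borel_measurable (P \<Otimes>\<^sub>M U)"
    unfolding B_def split_beta of_bool_def by measurable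
  define c where "c = (2 * s / \<sigma>)^3"
  have c: "0 \<le> c" using s \<sigma> by (simp add: c_def)
  define k where "k = 60 * (b0 + b1 * (\<sigma> * s)) + 334 * (real p * \<tau>)"
  have "(\<integral>\<^sup>+w. (\<integral>\<^sup>+x. ennreal (B w x) \<partial>U) \<partial>P) = (\<integral>\<^sup>+x. (\<integral>\<^sup>+w. ennreal (B w x) \<partial>P) \<partial>U)"
    using PU.Fubini'[OF Bm] by simp
  also have "\<dots> \<le> (\<integral>\<^sup>+x. ennreal (c * (k * max_abs p x ^ 3 + 60 * b1 * max_abs p x ^ 4)) \<partial>U)"
  proof (rule nn_integral_mono)
    fix x
    define m where "m = max_abs p x"
    have m: "0 \<le> m" using max_abs_nonneg[OF p] by (simp add: m_def)
    let ?S = "{w \<in> space P. shell p a b (\<sigma> * s + m) w}"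
    have S: "?S \<in> sets P" using shell_measurable[of p a b "\<sigma> * s + m"] law_space[OF P] P
      by (simp add: law_def pred_def)
    have e: "0 \<le> \<sigma> * s + m" using m s \<sigma> by simp
    have "(\<integral>\<^sup>+w. ennreal (B w x) \<partial>P) = (\<integral>\<^sup>+w. ennreal (c * m^3 * 60) * indicator ?S w + ennreal (c * m^3 * (334 * (real p * \<tau>))) \<partial>P)"
    proof (rule nn_integral_cong)
      fix w assume "w \<in> space P"
      then show "ennreal (B w x) = ennreal (c * m^3 * 60) * indicator ?S w + ennreal (c * m^3 * (334 * (real p * \<tau>)))"
        using c m \<tau> unfolding B_def c_def[symmetric] m_def[symmetric]
        by (auto simp: indicator_def ennreal_plus[symmetric] algebra_simps simp del: ennreal_plus)
    qed
    also have "\<dots> = ennreal (c * m^3 * 60) * emeasure P ?S + ennreal (c * m^3 * (334 * (real p * \<tau>)))"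
      using S by (subst nn_integral_add) (auto simp: nn_integral_cmult_indicator P.emeasure_space_1)
    also have "\<dots> = ennreal (c * m^3 * 60 * measure P ?S + c * m^3 * (334 * (real p * \<tau>)))"
      using c m \<tau> by (simp add: P.emeasure_eq_measure ennreal_mult ennreal_plus)
    also have "\<dots> \<le> ennreal (c * (k * m ^ 3 + 60 * b1 * m ^ 4))"
    proof (rule ennreal_leI)
      have "c * m^3 * 60 * measure P ?S \<le> c * m^3 * 60 * (b0 + b1 * (\<sigma> * s + m))"
        using c m by (intro mult_left_mono sh e) auto
      then show "c * m^3 * 60 * measure P ?S + c * m^3 * (334 * (real p * \<tau>)) \<le> c * (k * m ^ 3 + 60 * b1 * m ^ 4)"
        by (simp add: k_def algebra_simps power3_eq_cube power4_eq_xxxx)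
    qed
    finally show "(\<integral>\<^sup>+w. ennreal (B w x) \<partial>P) \<le> ennreal (c * (k * max_abs p x ^ 3 + 60 * b1 * max_abs p x ^ 4))" by (simp add: m_def)
  qed
  also have "\<dots> = ennreal (\<integral>x. c * (k * max_abs p x ^ 3 + 60 * b1 * max_abs p x ^ 4) \<partial>U)"
  proof (rule nn_integral_eq_integral)
    show "integrable U (\<lambda>x. c * (k * max_abs p x ^ 3 + 60 * b1 * max_abs p x ^ 4))"
      using coordinate_integrable(3)[OF U mU p] mU by simp
    have "0 \<le> k" using b s \<sigma> \<tau> by (simp add: k_def)
    then show "AE x in U. 0 \<le> c * (k * max_abs p x ^ 3 + 60 * b1 * max_abs p x ^ 4)"
      using c b max_abs_nonneg[OF p] by (intro AE_I2 mult_nonneg_nonneg add_nonneg_nonneg) auto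
  qed
  also have "(\<integral>x. c * (k * max_abs p x ^ 3 + 60 * b1 * max_abs p x ^ 4) \<partial>U) =
      c * (k * (\<integral>x. max_abs p x ^ 3 \<partial>U) + 60 * b1 * (\<integral>x. max_abs p x ^ 4 \<partial>U))"
    using coordinate_integrable(3)[OF U mU p] mU by simp
  also have "ennreal \<dots> \<le> ennreal (c * (k * M3 + 60 * b1 * M4))"
    using c b s \<sigma> \<tau> M by (intro ennreal_leI mult_left_mono add_mono) (auto simp: k_def)
  finally show ?thesis by (simp add: c_def k_def)
qed

text \<open>The law \<open>P\<close> of everything that is not exchanged enters only through its mass near the boundary, and
this mass has to be controlled uniformly over all boxes.\<close>

lemma lindeberg_step:
  assumes T: "tail_bound s \<tau>" and \<sigma>: "\<sigma> > 0" and p\<tau>: "real p * \<tau> \<le> 1" and p: "0 < p"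
    and P: "law p P" and U: "law p U" and V: "law p V" and agree: "moments_agree p U V"
    and mU: "integrable U (\<lambda>x. max_abs p x ^ 4)" and mV: "integrable V (\<lambda>x. max_abs p x ^ 4)"
    and sh: "\<And>e. 0 \<le> e \<Longrightarrow> measure P {w \<in> space P. shell p a b e w} \<le> b0 + b1 * e"
    and MU: "(\<integral>x. max_abs p x ^ 3 \<partial>U) \<le> M3" "(\<integral>x. max_abs p x ^ 4 \<partial>U) \<le> M4"
    and MV: "(\<integral>x. max_abs p x ^ 3 \<partial>V) \<le> M3" "(\<integral>x. max_abs p x ^ 4 \<partial>V) \<le> M4" and b: "0 \<le> b0" "0 \<le> b1"
  shows "\<bar>measure (conv p (conv p P U) (scal p \<sigma> (std_gauss p))) (pbox p a b) -
          measure (conv p (conv p P V) (scal p \<sigma> (std_gauss p))) (pbox p a b)\<bar> \<le>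
     2 * ((2 * s / \<sigma>)^3 * ((60 * (b0 + b1 * (\<sigma> * s)) + 334 * (real p * \<tau>)) * M3 + 60 * b1 * M4))"
proof -
  interpret P: prob_space P using P by (simp add: law_def)
  define c where "c = (2 * s / \<sigma>)^3 * ((60 * (b0 + b1 * (\<sigma> * s)) + 334 * (real p * \<tau>)) * M3 + 60 * b1 * M4)"
  define B where "B = (\<lambda>w x. (2 * s / \<sigma>)^3 * (max_abs p x)^3 * (60 * of_bool (shell p a b (\<sigma> * s + max_abs p x) w) + 334 * (real p * \<tau>)))"
  define F where "F Q w = (\<integral>x. box_mass p \<sigma> a b (\<lambda>j. w j + x j) \<partial>Q)" for Q w
  have e: "measure (conv p (conv p P Q) (scal p \<sigma> (std_gauss p))) (pbox p a b) = (\<integral>w. F Q w \<partial>P)" if Q: "law p Q" for Q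
  proof -
    have "measure (conv p (conv p P Q) (scal p \<sigma> (std_gauss p))) (pbox p a b) = (\<integral>x. box_mass p \<sigma> a b x \<partial>conv p P Q)"
      by (rule conv_smooth_box[OF law_conv[OF P Q] \<sigma>])
    also have "\<dots> = (\<integral>w. (\<integral>x. box_mass p \<sigma> a b (padd p w x) \<partial>Q) \<partial>P)"
      by (rule integral_conv[OF P Q _, of _ 1]) (use box_mass_bounds[OF \<sigma>] in \<open>auto intro!: box_mass_measurable \<sigma>\<close>)
    finally show ?thesis by (simp add: F_def box_mass_def padd_def)
  qed
  have Fi: "integrable P (F Q)" if Q: "law p Q" for Q
  proof -
    interpret Q: prob_space Q using Q by (simp add: law_def)
    have m: "(\<lambda>(w, x). box_mass p \<sigma> a b (\<lambda>j. w j + x j)) \<in> borel_measurable (P \<Otimes>\<^sub>M Q)"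
    proof -
      have [measurable]: "(\<lambda>x. x j) \<in> borel_measurable P" "(\<lambda>x. x j) \<in> borel_measurable Q" if "j < p" for j
        using that by (auto intro: component_law P Q)
      show ?thesis unfolding split_beta by (intro box_mass_measurable \<sigma>) measurable
    qed
    have le: "norm (F Q w) \<le> 1" for w
    proof -
      have "norm (F Q w) \<le> (\<integral>x. norm (box_mass p \<sigma> a b (\<lambda>j. w j + x j)) \<partial>Q)" unfolding F_def by (rule integral_norm_bound)
      also have "\<dots> \<le> 1" using box_mass_bounds[OF \<sigma>] by (intro Q.integral_le_const Q.integrable_const_bound[of _ 1] AE_I2)
          (auto intro!: box_mass_measurable \<sigma> borel_measurable_add borel_measurable_const component_law[OF Q])
      finally show ?thesis .
    qed
    show ?thesis
      by (rule P.integrable_const_bound[of _ 1])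
         (use le Q.borel_measurable_lebesgue_integral[OF m] in \<open>auto simp: F_def[abs_def]\<close>)
  qed
  have "ennreal \<bar>(\<integral>w. F U w \<partial>P) - (\<integral>w. F V w \<partial>P)\<bar> = ennreal \<bar>\<integral>w. F U w - F V w \<partial>P\<bar>"
    using Fi U V by simp
  also have "\<dots> \<le> ennreal (\<integral>w. \<bar>F U w - F V w\<bar> \<partial>P)" by (intro ennreal_leI integral_abs_bound)
  also have "\<dots> = (\<integral>\<^sup>+w. ennreal \<bar>F U w - F V w\<bar> \<partial>P)"
    using Fi U V by (intro nn_integral_eq_integral[symmetric]) auto
  also have "\<dots> \<le> (\<integral>\<^sup>+w. (\<integral>\<^sup>+x. ennreal (B w x) \<partial>U) + (\<integral>\<^sup>+x. ennreal (B w x) \<partial>V) \<partial>P)"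
    unfolding F_def B_def by (intro nn_integral_mono box_mass_diff_pointwise assms)
  also have "\<dots> = (\<integral>\<^sup>+w. (\<integral>\<^sup>+x. ennreal (B w x) \<partial>U) \<partial>P) + (\<integral>\<^sup>+w. (\<integral>\<^sup>+x. ennreal (B w x) \<partial>V) \<partial>P)"
  proof -
    have "(\<lambda>w. \<integral>\<^sup>+x. ennreal (B w x) \<partial>Q) \<in> borel_measurable P" if Q: "law p Q" for Q
    proof -
      interpret Q: prob_space Q using Q by (simp add: law_def)
      note [measurable] = max_abs_measurable[OF Q]
      have [measurable]: "(\<lambda>x. x j) \<in> borel_measurable P" "(\<lambda>x. x j) \<in> borel_measurable Q" if "j < p" for j
        using that by (auto intro: component_law P Q)
      have [measurable]: "Measurable.pred (P \<Otimes>\<^sub>M Q) (\<lambda>z. shell p a b (\<sigma> * s + max_abs p (snd z)) (fst z))"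
        unfolding shell_def in_box_def by measurable
      have Bm: "(\<lambda>(w, x). ennreal (B w x)) \<in> borel_measurable (P \<Otimes>\<^sub>M Q)"
        unfolding B_def split_beta of_bool_def by measurable
      show ?thesis using Q.borel_measurable_nn_integral_fst[OF Bm] by simp
    qed
    from nn_integral_add[OF this[OF U] this[OF V]] show ?thesis .
  qed
  also have "\<dots> \<le> ennreal c + ennreal c"
    unfolding B_def c_def by (intro add_mono shell_average assms)
  also have "\<dots> = ennreal (2 * c)"
  proof -
    have "0 \<le> (\<integral>x. max_abs p x ^ 3 \<partial>U)" "0 \<le> (\<integral>x. max_abs p x ^ 4 \<partial>U)"
      using max_abs_nonneg[OF p] by (intro Bochner_Integration.integral_nonneg; simp)+
    then have "0 \<le> M3" "0 \<le> M4" using MU by linarith+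
    then have "0 \<le> c" using b \<sigma> T by (simp add: c_def tail_bound_def)
    then show ?thesis by (simp add: ennreal_plus[symmetric] del: ennreal_plus)
  qed
  finally have "ennreal \<bar>(\<integral>w. F U w \<partial>P) - (\<integral>w. F V w \<partial>P)\<bar> \<le> ennreal (2 * c)" .
  moreover have "0 \<le> 2 * c"
  proof -
    have "0 \<le> (\<integral>x. max_abs p x ^ 3 \<partial>U)" "0 \<le> (\<integral>x. max_abs p x ^ 4 \<partial>U)"
      using max_abs_nonneg[OF p] by (intro Bochner_Integration.integral_nonneg; simp)+
    then have "0 \<le> M3" "0 \<le> M4" using MU by linarith+
    then show ?thesis using b \<sigma> T by (simp add: c_def tail_bound_def)
  qed
  ultimately show ?thesis unfolding e[OF U] e[OF V] c_def[symmetric] by (simp add: ennreal_le_iff)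
qed

section \<open>Convolution powers and the replacement path\<close>

fun conv_pow :: "nat \<Rightarrow> (nat \<Rightarrow> real) measure \<Rightarrow> nat \<Rightarrow> (nat \<Rightarrow> real) measure" where
  "conv_pow p \<mu> 0 = return (Rp p) (\<lambda>j\<in>{..<p}. 0)"
| "conv_pow p \<mu> (Suc n) = conv p (conv_pow p \<mu> n) \<mu>"

lemma law_conv_pow: "law p \<mu> \<Longrightarrow> law p (conv_pow p \<mu> n)"
  by (induction n) (auto simp: law_def[of p "return _ _"] space_Rp intro!: prob_space_return law_conv)

lemma char_fun_conv_pow: "law p \<mu> \<Longrightarrow> char_fun p (conv_pow p \<mu> n) a = char_fun p \<mu> a ^ n"
proof (induction n)
  case 0
  have "char_fun p (conv_pow p \<mu> 0) a = cis (\<Sum>j<p. a j * (\<lambda>j\<in>{..<p}. 0) j)"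
    unfolding char_fun_def cis_conv_exp conv_pow.simps by (rule integral_return) (auto simp: space_Rp)
  then show ?case by simp
qed (simp add: char_fun_conv law_conv_pow mult.commute)

lemma conv_commute: "law p P \<Longrightarrow> law p Q \<Longrightarrow> conv p P Q = conv p Q P"
  by (rule char_fun_unique[of p]) (auto simp: law_conv char_fun_conv)

lemma measure_scal_box:
  assumes P: "law p P" and c: "0 < c"
  shows "measure (scal p c P) (pbox p a b) = measure P (pbox p (\<lambda>j. a j / c) (\<lambda>j. b j / c))"
  unfolding scal_def
  by (subst measure_distr[OF scal_measurable[OF P] box_sets])
     (intro arg_cong[where f="measure P"], use c in \<open>auto simp: pbox_def in_box_def space_Rp law_space[OF P] field_simps\<close>)

text \<open>Conditionally on the second summand the shell is translated, and the bound is uniform in the box.\<close>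

lemma shell_conv:
  assumes P: "law p P" and Q: "law p Q" and B: "\<And>a b. measure P {w \<in> space P. shell p a b e w} \<le> B"
  shows "measure (conv p P Q) {w \<in> space (conv p P Q). shell p a b e w} \<le> B"
proof -
  interpret Q: prob_space Q using Q by (simp add: law_def)
  let ?S = "{w \<in> space (Rp p). shell p a b e w}"
  have S: "?S \<in> sets (Rp p)" by measurable
  have L: "law p (conv p Q P)" by (rule law_conv[OF Q P])
  have "measure (conv p P Q) {w \<in> space (conv p P Q). shell p a b e w} = measure (conv p Q P) ?S"
    unfolding conv_commute[OF P Q] law_space[OF L] ..
  also have "\<dots> = (\<integral>x. indicator ?S x \<partial>conv p Q P)" using S L by (simp add: law_def)
  also have "\<dots> = (\<integral>y. (\<integral>x. indicator ?S (padd p y x) \<partial>P) \<partial>Q)"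
    by (rule integral_conv[OF Q P, where K=1]) (use S in \<open>auto simp: indicator_def\<close>)
  also have "(\<lambda>y. \<integral>x. indicator ?S (padd p y x) \<partial>P) =
       (\<lambda>y. measure P {w \<in> space P. shell p (\<lambda>j. a j - y j) (\<lambda>j. b j - y j) e w})"
  proof
    fix y
    let ?T = "{w \<in> space P. shell p (\<lambda>j. a j - y j) (\<lambda>j. b j - y j) e w}"
    have "(\<integral>x. indicator ?S (padd p y x) \<partial>P) = (\<integral>x. indicator ?T x \<partial>P :: real)"
    proof (intro Bochner_Integration.integral_cong refl)
      fix x assume x: "x \<in> space P"
      have "in_box p a' b' (padd p y x) \<longleftrightarrow> in_box p (\<lambda>j. a' j - y j) (\<lambda>j. b' j - y j) x" for a' b'
        unfolding in_box_def padd_def by (auto simp: algebra_simps)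
      then have "shell p a b e (padd p y x) \<longleftrightarrow> shell p (\<lambda>j. a j - y j) (\<lambda>j. b j - y j) e x"
        unfolding shell_def by (simp add: algebra_simps)
      moreover have "padd p y x \<in> space (Rp p)" by (simp add: padd_def space_Rp)
      ultimately show "indicator ?S (padd p y x) = (indicator ?T x :: real)" using x by (simp add: indicator_def)
    qed
    also have "\<dots> = measure P (?T \<inter> space P)" by (rule Bochner_Integration.integral_indicator)
    also have "?T \<inter> space P = ?T" by auto
    finally show "(\<integral>x. indicator ?S (padd p y x) \<partial>P) = measure P ?T" .
  qed
  also have "(\<integral>y. measure P {w \<in> space P. shell p (\<lambda>j. a j - y j) (\<lambda>j. b j - y j) e w} \<partial>Q) \<le> B"
  proof (cases "integrable Q (\<lambda>y. measure P {w \<in> space P. shell p (\<lambda>j. a j - y j) (\<lambda>j. b j - y j) e w})")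
    case True
    then show ?thesis by (intro Q.integral_le_const AE_I2 B)
  next
    case False
    have "0 \<le> B" using B[of a b] measure_nonneg[of P] order_trans by blast
    then show ?thesis using not_integrable_integral_eq[OF False] by simp
  qed
  finally show ?thesis .
qed

lemma prod_ge_one_minus_sum:
  fixes f :: "nat \<Rightarrow> real"
  assumes "\<And>j. j < p \<Longrightarrow> 0 \<le> f j \<and> f j \<le> 1 \<and> 1 - f j \<le> \<tau>" and "0 \<le> \<tau>"
  shows "1 - real p * \<tau> \<le> (\<Prod>j<p. f j)"
  using assms
proof (induction p)
  case (Suc p)
  let ?G = "\<Prod>j<p. f j"
  have G: "0 \<le> ?G" "?G \<le> 1" using Suc.prems by (auto intro!: prod_nonneg prod_le_1)
  have IH: "1 - real p * \<tau> \<le> ?G" using Suc by auto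
  have fp: "0 \<le> f p" "f p \<le> 1" "1 - f p \<le> \<tau>" using Suc.prems(1)[of p] by auto
  have "?G * (1 - f p) \<le> 1 * \<tau>" using G fp by (intro mult_mono) auto
  then show ?case using IH by (simp add: algebra_simps)
qed simp

lemma box_mass_lower:
  assumes T: "tail_bound s \<tau>" and \<sigma>: "\<sigma> > 0" and d: "d = \<sigma> * s"
  shows "of_bool (in_box p (\<lambda>j. a j + d) (\<lambda>j. b j - d) w) - real p * \<tau> \<le> box_mass p \<sigma> a b w"
proof (cases "in_box p (\<lambda>j. a j + d) (\<lambda>j. b j - d) w")
  case True
  have "1 - real p * \<tau> \<le> box_mass p \<sigma> a b w"
    unfolding box_mass_def
  proof (rule prod_ge_one_minus_sum)
    fix j assume j: "j < p"
    then have "a j + \<sigma> * s \<le> w j" "w j \<le> b j - \<sigma> * s" using True by (auto simp: in_box_def d)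
    from ival_mass_inside[OF T \<sigma> this] ival_mass_bounds[OF \<sigma>]
    show "0 \<le> ival_mass \<sigma> (a j) (b j) (w j) \<and> ival_mass \<sigma> (a j) (b j) (w j) \<le> 1 \<and> 1 - ival_mass \<sigma> (a j) (b j) (w j) \<le> \<tau>" by auto
  qed (use T in \<open>auto simp: tail_bound_def\<close>)
  then show ?thesis using True by simp
next
  case False
  have "0 \<le> real p * \<tau>" using T by (auto simp: tail_bound_def)
  then show ?thesis using False box_mass_bounds[OF \<sigma>, of p a b w] by simp
qed

lemma box_mass_upper:
  assumes T: "tail_bound s \<tau>" and \<sigma>: "\<sigma> > 0" and d: "d = \<sigma> * s"
  shows "box_mass p \<sigma> a b w \<le> of_bool (in_box p (\<lambda>j. a j - d) (\<lambda>j. b j + d) w) + \<tau>"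
proof (cases "in_box p (\<lambda>j. a j - d) (\<lambda>j. b j + d) w")
  case True
  then show ?thesis using box_mass_bounds[OF \<sigma>, of p a b w] T by (simp add: tail_bound_def)
next
  case False
  then obtain i where i: "i < p" "w i < a i - \<sigma> * s \<or> b i + \<sigma> * s < w i" by (auto simp: in_box_def d not_le)
  have "box_mass p \<sigma> a b w = ival_mass \<sigma> (a i) (b i) (w i) * (\<Prod>j\<in>{..<p} - {i}. ival_mass \<sigma> (a j) (b j) (w j))"
    unfolding box_mass_def using i by (intro prod.remove) auto
  also have "\<dots> \<le> \<tau> * 1"
    using ival_mass_outside[OF T \<sigma> i(2)] ival_mass_bounds[OF \<sigma>] T
    by (intro mult_mono prod_le_1 prod_nonneg) (auto simp: tail_bound_def)
  finally show ?thesis using False by simp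
qed

lemma integral_in_box:
  assumes P: "law p P" shows "(\<integral>w. of_bool (in_box p a b w) \<partial>P) = measure P (pbox p a b)"
    and "integrable P (\<lambda>w. of_bool (in_box p a b w) :: real)"
proof -
  interpret prob_space P using P by (simp add: law_def)
  have "(\<integral>w. of_bool (in_box p a b w) \<partial>P) = (\<integral>w. indicator (pbox p a b) w \<partial>P)"
    by (intro Bochner_Integration.integral_cong) (auto simp: law_space[OF P] pbox_def indicator_def)
  also have "\<dots> = measure P (pbox p a b \<inter> space P)" by (rule Bochner_Integration.integral_indicator)
  also have "pbox p a b \<inter> space P = pbox p a b" by (auto simp: pbox_def law_space[OF P])
  finally show "(\<integral>w. of_bool (in_box p a b w) \<partial>P) = measure P (pbox p a b)" .
  have "integrable P (\<lambda>w. of_bool (in_box p a b w) :: real) \<longleftrightarrow> integrable P (indicator (pbox p a b) :: _ \<Rightarrow> real)"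
    by (intro Bochner_Integration.integrable_cong) (auto simp: law_space[OF P] pbox_def indicator_def)
  then show "integrable P (\<lambda>w. of_bool (in_box p a b w) :: real)" using law_box[OF P] by (simp add: emeasure_eq_measure)
qed

lemma integrable_box_mass: "law p P \<Longrightarrow> \<sigma> > 0 \<Longrightarrow> integrable P (box_mass p \<sigma> a b)"
  using box_mass_bounds[of \<sigma> p a b] law_box_mass_measurable[of p P \<sigma> a b]
  by (intro finite_measure.integrable_const_bound[of P _ 1]) (auto simp: law_def intro: prob_space.finite_measure)

text \<open>Smoothing at scale \<open>\<epsilon>\<close> moves a point by more than \<open>\<epsilon> * s\<close> in some coordinate only with probability
\<open>p * \<tau>\<close>. So the smoothed masses of the box enlarged or shrunk by \<open>\<epsilon> * s\<close> enclose its indicator, and moving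
on by another \<open>\<epsilon> * s\<close> encloses them between indicators, whose masses differ by that of a shell.\<close>

lemma smoothing_inequality:
  assumes T: "tail_bound s \<tau>" and e: "\<epsilon> > 0" and p: "0 < p" and P: "law p P" and G: "law p \<gamma>"
    and D: "\<And>a b. \<bar>(\<integral>w. box_mass p \<epsilon> a b w \<partial>P) - (\<integral>w. box_mass p \<epsilon> a b w \<partial>\<gamma>)\<bar> \<le> \<Delta>"
    and K: "\<And>a b. measure \<gamma> {w \<in> space \<gamma>. shell p a b (2 * (\<epsilon> * s)) w} \<le> K"
  shows "\<bar>measure P (pbox p a b) - measure \<gamma> (pbox p a b)\<bar> \<le> \<Delta> + K + 2 * (real p * \<tau>)"
proof -
  interpret P: prob_space P using P by (simp add: law_def)
  interpret G: prob_space \<gamma> using G by (simp add: law_def)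
  define d where "d = \<epsilon> * s"
  have d: "0 \<le> d" using T e by (simp add: d_def tail_bound_def)
  have \<tau>: "0 < \<tau>" using T by (simp add: tail_bound_def)
  then have p\<tau>: "\<tau> \<le> real p * \<tau>" using p by (simp add: mult_le_cancel_right1)
  have lo: "measure Q (pbox p (\<lambda>j. a j + d) (\<lambda>j. b j - d)) - real p * \<tau> \<le> (\<integral>w. box_mass p \<epsilon> a b w \<partial>Q)" if Q: "law p Q" for Q a b
  proof -
    interpret Q: prob_space Q using Q by (simp add: law_def)
    have "measure Q (pbox p (\<lambda>j. a j + d) (\<lambda>j. b j - d)) - real p * \<tau> = (\<integral>w. of_bool (in_box p (\<lambda>j. a j + d) (\<lambda>j. b j - d) w) - real p * \<tau> \<partial>Q)"
      using integral_in_box[OF Q] by (simp add: Q.prob_space)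
    also have "\<dots> \<le> (\<integral>w. box_mass p \<epsilon> a b w \<partial>Q)"
      by (intro integral_mono Bochner_Integration.integrable_diff integral_in_box(2)[OF Q] integrable_box_mass[OF Q e] box_mass_lower[OF T e d_def]) auto
    finally show ?thesis .
  qed
  have hi: "(\<integral>w. box_mass p \<epsilon> a b w \<partial>Q) \<le> measure Q (pbox p (\<lambda>j. a j - d) (\<lambda>j. b j + d)) + real p * \<tau>" if Q: "law p Q" for Q a b
  proof -
    interpret Q: prob_space Q using Q by (simp add: law_def)
    have "(\<integral>w. box_mass p \<epsilon> a b w \<partial>Q) \<le> (\<integral>w. of_bool (in_box p (\<lambda>j. a j - d) (\<lambda>j. b j + d) w) + \<tau> \<partial>Q)"
      by (intro integral_mono Bochner_Integration.integrable_add integral_in_box(2)[OF Q] integrable_box_mass[OF Q e] box_mass_upper[OF T e d_def]) auto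
    also have "\<dots> = measure Q (pbox p (\<lambda>j. a j - d) (\<lambda>j. b j + d)) + \<tau>"
      using integral_in_box[OF Q] by (simp add: Q.prob_space)
    finally show ?thesis using p\<tau> by simp
  qed
  have sh: "measure \<gamma> (pbox p (\<lambda>j. a j - 2 * d) (\<lambda>j. b j + 2 * d)) - measure \<gamma> (pbox p (\<lambda>j. a j + 2 * d) (\<lambda>j. b j - 2 * d)) \<le> K"
    using K[of a b] shell_measure[OF G, of "2 * d" a b] d by (simp add: d_def)
  have m1: "measure \<gamma> (pbox p a b) \<le> measure \<gamma> (pbox p (\<lambda>j. a j - 2 * d) (\<lambda>j. b j + 2 * d))"
    using d by (intro G.finite_measure_mono law_box[OF G]) (auto simp: pbox_def intro: in_box_mono)
  have m2: "measure \<gamma> (pbox p (\<lambda>j. a j + 2 * d) (\<lambda>j. b j - 2 * d)) \<le> measure \<gamma> (pbox p a b)"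
    using d by (intro G.finite_measure_mono law_box[OF G]) (auto simp: pbox_def intro: in_box_mono)
  have "measure P (pbox p a b) \<le> (\<integral>w. box_mass p \<epsilon> (\<lambda>j. a j - d) (\<lambda>j. b j + d) w \<partial>P) + real p * \<tau>"
    using lo[OF P, of "\<lambda>j. a j - d" "\<lambda>j. b j + d"] by simp
  moreover have "(\<integral>w. box_mass p \<epsilon> (\<lambda>j. a j - d) (\<lambda>j. b j + d) w \<partial>\<gamma>) \<le> measure \<gamma> (pbox p (\<lambda>j. a j - 2 * d) (\<lambda>j. b j + 2 * d)) + real p * \<tau>"
    using hi[OF G, of "\<lambda>j. a j - d" "\<lambda>j. b j + d"] by (simp add: algebra_simps)
  moreover have "(\<integral>w. box_mass p \<epsilon> (\<lambda>j. a j + d) (\<lambda>j. b j - d) w \<partial>P) - real p * \<tau> \<le> measure P (pbox p a b)"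
    using hi[OF P, of "\<lambda>j. a j + d" "\<lambda>j. b j - d"] by simp
  moreover have "measure \<gamma> (pbox p (\<lambda>j. a j + 2 * d) (\<lambda>j. b j - 2 * d)) - real p * \<tau> \<le> (\<integral>w. box_mass p \<epsilon> (\<lambda>j. a j + d) (\<lambda>j. b j - d) w \<partial>\<gamma>)"
    using lo[OF G, of "\<lambda>j. a j + d" "\<lambda>j. b j - d"] by (simp add: algebra_simps)
  ultimately show ?thesis
    using D[of "\<lambda>j. a j - d" "\<lambda>j. b j + d"] D[of "\<lambda>j. a j + d" "\<lambda>j. b j - d"] sh m1 m2 by linarith
qed

lemma scal_moments:
  assumes U: "law p U" and p: "0 < p" and c: "0 \<le> c" and i: "integrable U (\<lambda>x. max_abs p x ^ m)"
  shows "integrable (scal p c U) (\<lambda>x. max_abs p x ^ m)" "(\<integral>x. max_abs p x ^ m \<partial>scal p c U) = c ^ m * (\<integral>x. max_abs p x ^ m \<partial>U)"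
proof -
  have m: "(\<lambda>x. max_abs p x ^ m) \<in> borel_measurable (Rp p)"
    using max_abs_measurable[OF law_std_gauss[of p]] by (intro borel_measurable_power) (simp add: law_measurable[OF law_std_gauss])
  show "integrable (scal p c U) (\<lambda>x. max_abs p x ^ m)"
    unfolding scal_def using i
    by (subst integrable_distr_eq[OF scal_measurable[OF U] m]) (simp add: max_abs_scale[OF p c] power_mult_distrib)
  show "(\<integral>x. max_abs p x ^ m \<partial>scal p c U) = c ^ m * (\<integral>x. max_abs p x ^ m \<partial>U)"
    unfolding scal_def by (subst integral_distr[OF scal_measurable[OF U] m]) (simp add: max_abs_scale[OF p c] power_mult_distrib)
qed

lemma scal_agree:
  assumes U: "law p U" and V: "law p V" and a: "moments_agree p U V"
  shows "moments_agree p (scal p c U) (scal p c V)"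
proof -
  have 1: "(\<integral>x. x i \<partial>scal p c Q) = c * (\<integral>x. x i \<partial>Q)" if "law p Q" "i < p" for Q i
    unfolding scal_def using that by (subst integral_distr[OF scal_measurable[OF that(1)]]) auto
  have 2: "(\<integral>x. x i * x j \<partial>scal p c Q) = c * c * (\<integral>x. x i * x j \<partial>Q)" if "law p Q" "i < p" "j < p" for Q i j
  proof -
    have "(\<integral>x. x i * x j \<partial>scal p c Q) = (\<integral>x. c * c * (x i * x j) \<partial>Q)"
      unfolding scal_def using that by (subst integral_distr[OF scal_measurable[OF that(1)]]) (auto simp: mult_ac)
    then show ?thesis by simp
  qed
  show ?thesis using a U V by (auto simp: moments_agree_def 1 2)
qed

section \<open>The recursion in the sample size\<close>

abbreviation mom_const :: real where "mom_const \<equiv> 12544"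

lemma harmonic_bound: "1 \<le> n \<Longrightarrow> (\<Sum>r=1..n. 1 / real r) \<le> 1 + ln (real n)"
proof (induction n rule: nat_induct_at_least)
  case (Suc n)
  have "ln (1 + - 1 / real (Suc n)) \<le> - 1 / real (Suc n)"
    by (rule ln_add_one_self_le_self2) (use Suc.hyps in \<open>simp add: field_simps\<close>)
  moreover have "1 + - 1 / real (Suc n) = real n / real (Suc n)" by (simp add: field_simps)
  moreover have "ln (real n / real (Suc n)) = ln (real n) - ln (real (Suc n))" using Suc.hyps by (simp add: ln_div)
  ultimately have "1 / real (Suc n) \<le> ln (real (Suc n)) - ln (real n)" by simp
  then show ?case using Suc.IH by simp
qed simp

lemma inverse_square_sum:
  assumes \<rho>: "0 < \<rho>" and A: "\<rho> \<le> A\<^sup>2" and n: "1 \<le> n"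
  shows "(\<Sum>r<n. 1 / (sqrt (A\<^sup>2 + \<rho> * real r))\<^sup>2) \<le> 3 * Log (real n) / \<rho>"
proof -
  have sq: "(sqrt (A\<^sup>2 + \<rho> * real r))\<^sup>2 = A\<^sup>2 + \<rho> * real r" for r using \<rho> by simp
  have "(\<Sum>r<n. 1 / (A\<^sup>2 + \<rho> * real r)) \<le> (\<Sum>r\<in>insert 0 {1..n}. 1 / (A\<^sup>2 + \<rho> * real r))"
    using \<rho> A by (intro sum_mono2) auto
  also have "\<dots> = 1 / A\<^sup>2 + (\<Sum>r=1..n. 1 / (A\<^sup>2 + \<rho> * real r))" by simp
  also have "\<dots> \<le> 1 / \<rho> + (\<Sum>r=1..n. 1 / \<rho> * (1 / real r))"
  proof (intro add_mono sum_mono)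
    show "1 / A\<^sup>2 \<le> 1 / \<rho>" using A \<rho> by (intro divide_left_mono mult_pos_pos) auto
    fix r assume r: "r \<in> {1..n}"
    have "1 / (A\<^sup>2 + \<rho> * real r) \<le> 1 / (\<rho> * real r)" using \<rho> r by (intro divide_left_mono mult_pos_pos add_nonneg_pos) auto
    then show "1 / (A\<^sup>2 + \<rho> * real r) \<le> 1 / \<rho> * (1 / real r)" by simp
  qed
  also have "\<dots> = 1 / \<rho> * (1 + (\<Sum>r=1..n. 1 / real r))" by (simp add: sum_distrib_left algebra_simps)
  also have "\<dots> \<le> 1 / \<rho> * (3 * Log (real n))"
    using harmonic_bound[OF n] \<rho> by (intro mult_left_mono) (auto simp: Log_def)
  finally show ?thesis by (simp add: sq)
qed

text \<open>The terms are dominated by the increments of \<open>- 2 / (\<rho> * v)\<close> with \<open>v = sqrt (A\<^sup>2 + \<rho> * r)\<close>.\<close>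

lemma inverse_cube_sum:
  assumes \<rho>: "0 < \<rho>" and A: "\<rho> \<le> A\<^sup>2" "0 < A"
  shows "(\<Sum>r<n. 1 / (sqrt (A\<^sup>2 + \<rho> * real r))^3) \<le> 3 / (\<rho> * A)"
proof -
  define v where "v r = sqrt (A\<^sup>2 + \<rho> * real r)" for r
  have v0: "v 0 = A" using A by (simp add: v_def)
  have vp: "0 < v r" for r using A \<rho> by (auto simp: v_def intro!: add_pos_nonneg)
  have v2: "(v r)\<^sup>2 = A\<^sup>2 + \<rho> * real r" for r using \<rho> by (simp add: v_def)
  have t1: "(\<Sum>r<Suc m. 1 / v r ^ 3) \<le> 1 / (\<rho> * A) + 2 / \<rho> * (1 / A - 1 / v m)" for m
  proof (induction m)
    case 0
    have "1 / A ^ 3 = 1 / (A\<^sup>2 * A)" by (simp add: power2_eq_square power3_eq_cube)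
    also have "\<dots> \<le> 1 / (\<rho> * A)" using A \<rho> by (intro divide_left_mono mult_right_mono mult_pos_pos) auto
    finally show ?case by (simp add: v0)
  next
    case (Suc m)
    let ?x = "v m" and ?y = "v (Suc m)"
    have xy: "?x \<le> ?y" using \<rho> by (simp add: v_def)
    have d: "(?y - ?x) * (?y + ?x) = \<rho>" using v2[of m] v2[of "Suc m"] by (simp add: power2_eq_square algebra_simps)
    have "\<rho> \<le> (?y - ?x) * (2 * ?y)" unfolding d[symmetric] using xy by (intro mult_left_mono) auto
    then have "\<rho> * ?x \<le> (?y - ?x) * (2 * ?y) * ?y" using xy vp[of m] vp[of "Suc m"] \<rho> by (intro mult_mono) auto
    then have "1 / ?y ^ 3 \<le> 2 / \<rho> * (1 / ?x - 1 / ?y)"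
      using vp[of m] vp[of "Suc m"] \<rho> by (simp add: field_simps power3_eq_cube)
    then have "1 / (\<rho> * A) + 2 / \<rho> * (1 / A - 1 / ?x) + 1 / ?y ^ 3 \<le> 1 / (\<rho> * A) + 2 / \<rho> * (1 / A - 1 / ?y)"
      by (simp add: algebra_simps)
    then show ?case using Suc.IH by (simp add: algebra_simps)
  qed
  have t2: "2 / \<rho> * (1 / A - 1 / v m) \<le> 2 / (\<rho> * A)" for m
    using vp[of m] \<rho> by (simp add: field_simps)
  have t3: "1 / (\<rho> * A) + 2 / (\<rho> * A) = 3 / (\<rho> * A)" by (simp add: add_divide_distrib[symmetric])
  have "(\<Sum>r<Suc m. 1 / v r ^ 3) \<le> 3 / (\<rho> * A)" for m
    by (rule order_trans[OF t1 add_left_mono[OF t2, of "1 / (\<rho> * A)" m, unfolded t3]])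
  moreover have "(\<Sum>r<n. 1 / v r ^ 3) \<le> (\<Sum>r<Suc n. 1 / v r ^ 3)" using vp[of n] by simp
  ultimately show ?thesis unfolding v_def by (meson order_trans)
qed

lemma tail_bound_log:
  assumes L: "1 \<le> L" "real p * real n \<le> exp L" and pn: "0 < p" "0 < n"
  shows "tail_bound (8 * sqrt L) (1 / (real p * real n))"
proof -
  have "1 + 1/2 + (1/2)^2 / 2 \<le> exp (1/2 :: real)" by (rule exp_lower_Taylor_quadratic) simp
  then have "(13/8) ^ 14 \<le> exp (1/2 :: real) ^ 14" by (intro power_mono) (auto simp: power_divide)
  moreover have "exp (1/2 :: real) ^ 14 = exp 7" by (simp add: exp_of_nat_mult[symmetric])
  moreover have "768 \<le> (13/8 :: real) ^ 14" by (simp add: power_divide)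
  ultimately have e7: "768 \<le> exp (7::real)" by linarith
  have "768 * exp (- (8 * sqrt L)\<^sup>2 / 8) = 768 * exp (- 8 * L)" using L by (simp add: power_mult_distrib)
  also have "\<dots> \<le> exp 7 * exp (- 8 * L)" by (intro mult_right_mono e7) auto
  also have "\<dots> \<le> exp (- L)" unfolding exp_add[symmetric] using L by simp
  also have "\<dots> \<le> 1 / (real p * real n)" using L pn by (simp add: exp_minus field_simps)
  finally have "768 * exp (- (8 * sqrt L)\<^sup>2 / 8) \<le> 1 / (real p * real n)" .
  moreover have "1 \<le> 8 * sqrt L" using real_sqrt_le_mono[OF L(1)] unfolding real_sqrt_one by linarith
  ultimately show ?thesis using pn by (simp add: tail_bound_def)
qed

text \<open>The rescaled problem, in terms of laws alone. \<open>S\<close> is the quadratic form of the covariance matrix, which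
\<open>\<mu>\<close> and \<open>\<gamma>\<close> share, and \<open>W\<close> has covariance matrix \<open>S\<close> minus \<open>\<rho>\<close> times the identity. For the sample size \<open>n\<close>,
\<open>mscale n\<close> is the order of magnitude of the largest coordinate.\<close>

locale gaussian_match =
  fixes p :: nat and \<mu> \<gamma> W :: "(nat \<Rightarrow> real) measure" and S :: "(nat \<Rightarrow> real) \<Rightarrow> real"
    and \<rho> :: real and mscale :: "nat \<Rightarrow> real"
  assumes p: "0 < p" and \<mu>: "law p \<mu>" and \<gamma>: "law p \<gamma>" and W: "law p W" and \<rho>: "0 < \<rho>" "\<rho> \<le> 1"
    and char_fun\<gamma>: "\<And>a. char_fun p \<gamma> a = of_real (exp (- S a / 2))"
    and cfW: "\<And>a. char_fun p W a = of_real (exp (- S a / 2 + \<rho> * (\<Sum>j<p. (a j)\<^sup>2) / 2))"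
    and S: "\<And>a c. S (\<lambda>j. c * a j) = c\<^sup>2 * S a"
    and agree: "moments_agree p \<mu> \<gamma>"
    and int\<mu>: "integrable \<mu> (\<lambda>x. max_abs p x ^ 4)" and int\<gamma>: "integrable \<gamma> (\<lambda>x. max_abs p x ^ 4)"
    and M\<mu>: "\<And>n. 1 \<le> n \<Longrightarrow> (\<integral>x. max_abs p x ^ 3 \<partial>\<mu>) \<le> mom_const * mscale n ^ 3" "\<And>n. 1 \<le> n \<Longrightarrow> (\<integral>x. max_abs p x ^ 4 \<partial>\<mu>) \<le> mom_const * mscale n ^ 4"
    and M\<gamma>: "\<And>n. 1 \<le> n \<Longrightarrow> (\<integral>x. max_abs p x ^ 3 \<partial>\<gamma>) \<le> mom_const * mscale n ^ 3" "\<And>n. 1 \<le> n \<Longrightarrow> (\<integral>x. max_abs p x ^ 4 \<partial>\<gamma>) \<le> mom_const * mscale n ^ 4"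
    and mscale_ge_1: "\<And>n. 1 \<le> mscale n" and mscale_mono: "\<And>k n. 1 \<le> k \<Longrightarrow> k \<le> n \<Longrightarrow> mscale k \<le> mscale n"
begin

definition rlog :: "nat \<Rightarrow> real" where "rlog n = sqrt (Log (real (p * n)))"

definition norm_sum :: "nat \<Rightarrow> (nat \<Rightarrow> real) measure" where "norm_sum n = scal p (1 / sqrt (real n)) (conv_pow p \<mu> n)"

definition box_error :: "nat \<Rightarrow> (nat \<Rightarrow> real) \<Rightarrow> (nat \<Rightarrow> real) \<Rightarrow> real" where
  "box_error n a b = \<bar>measure (norm_sum n) (pbox p a b) - measure \<gamma> (pbox p a b)\<bar>"

lemma law_norm_sum: "law p (norm_sum n)" unfolding norm_sum_def by (intro law_scal law_conv_pow \<mu>)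

lemma rlog_ge_1: "1 \<le> rlog n" by (simp add: rlog_def Log_def)

lemma rlog_mono: "1 \<le> k \<Longrightarrow> k \<le> n \<Longrightarrow> rlog k \<le> rlog n"
  unfolding rlog_def Log_def using p by (intro real_sqrt_le_mono max.mono) (auto simp: ln_le_cancel_iff)

lemma tail: "1 \<le> n \<Longrightarrow> tail_bound (8 * rlog n) (1 / (real p * real n))"
  unfolding rlog_def
proof (rule tail_bound_log)
  assume n: "1 \<le> n"
  have "real p * real n = exp (ln (real (p * n)))" using p n by simp
  also have "\<dots> \<le> exp (Log (real (p * n)))" by (simp add: Log_def)
  finally show "real p * real n \<le> exp (Log (real (p * n)))" .
qed (use p in \<open>auto simp: Log_def\<close>)

lemma char_fun_scal_std_gauss: "char_fun p (scal p c (std_gauss p)) a = of_real (exp (- (c\<^sup>2 * (\<Sum>j<p. (a j)\<^sup>2)) / 2))"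
  unfolding char_fun_scal[OF law_std_gauss] char_fun_std_gauss exp_of_real[symmetric]
  by (simp add: power_mult_distrib sum_distrib_left)

lemma char_fun_scal_W: "char_fun p (scal p c W) a = of_real (exp (c\<^sup>2 * (- S a / 2 + \<rho> * (\<Sum>j<p. (a j)\<^sup>2) / 2)))"
  unfolding char_fun_scal[OF W] cfW S by (simp add: power_mult_distrib sum_distrib_left[symmetric] algebra_simps)

lemma char_fun_scal_\<gamma>: "char_fun p (scal p c \<gamma>) a = of_real (exp (- (c\<^sup>2 * S a) / 2))"
  unfolding char_fun_scal[OF \<gamma>] char_fun\<gamma> S by simp

lemma gauss_split: "\<gamma> = conv p W (scal p (sqrt \<rho>) (std_gauss p))"
proof (rule char_fun_unique[OF \<gamma>])
  show "char_fun p \<gamma> a = char_fun p (conv p W (scal p (sqrt \<rho>) (std_gauss p))) a" for a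
    unfolding char_fun_conv[OF W law_scal[OF law_std_gauss]] char_fun_scal_std_gauss cfW char_fun\<gamma> of_real_mult[symmetric] exp_add[symmetric]
    using \<rho> by simp
qed (intro law_conv W law_scal law_std_gauss)

lemma shell_gauss:
  assumes "1 \<le> n" "0 \<le> e"
  shows "measure \<gamma> {w \<in> space \<gamma>. shell p a b e w} \<le> 3800 * (e / sqrt \<rho> * (8 * rlog n)) + 6 / real n"
proof -
  have "measure \<gamma> {w \<in> space \<gamma>. shell p a b e w} \<le> 3800 * (e / sqrt \<rho> * (8 * rlog n)) + 6 * (real p * (1 / (real p * real n)))"
    by (rule gauss_anticoncentration[OF tail[OF assms(1)] _ assms(2) W gauss_split]) (use \<rho> in simp)
  then show ?thesis using p by simp
qed

text \<open>Rescaling from \<open>n\<close> to \<open>k\<close> summands widens the shell by at most \<open>sqrt 2\<close>, as \<open>n \<le> 2 * k\<close>. The error \<open>D\<close>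
enters twice because a shell is the difference of two boxes.\<close>

lemma shell_partial_sum:
  assumes k: "1 \<le> k" "k < n" "n \<le> 2 * k" and D: "\<And>a b. box_error k a b \<le> D" and e: "0 \<le> e"
  shows "measure (scal p (1 / sqrt (real n)) (conv_pow p \<mu> k)) {w \<in> space (scal p (1 / sqrt (real n)) (conv_pow p \<mu> k)). shell p a b e w} \<le>
    (2 * D + 6 / real n) + (5400 * (8 * rlog n) / sqrt \<rho>) * e"
proof -
  have n0: "0 < n" using k by simp
  define c where "c = sqrt (real n) / sqrt (real k)"
  have c: "0 < c" "c \<le> sqrt 2"
  proof -
    have "real n / real k \<le> 2" using k by (simp add: field_simps)
    then show "c \<le> sqrt 2" unfolding c_def real_sqrt_divide[symmetric] by (rule real_sqrt_le_mono)
    show "0 < c" using k by (simp add: c_def)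
  qed
  have bx: "measure (scal p (1 / sqrt (real n)) (conv_pow p \<mu> k)) (pbox p u v) = measure (norm_sum k) (pbox p (\<lambda>j. c * u j) (\<lambda>j. c * v j))" for u v
    unfolding norm_sum_def using k
    by (subst (1 2) measure_scal_box[OF law_conv_pow[OF \<mu>]]) (auto simp: c_def mult.commute)
  have le: "measure (norm_sum k) (pbox p u v) - measure (norm_sum k) (pbox p u' v') \<le>
      measure \<gamma> (pbox p u v) - measure \<gamma> (pbox p u' v') + 2 * D" for u v u' v'
    using D[of u v] D[of u' v'] unfolding box_error_def by linarith
  have "measure (scal p (1 / sqrt (real n)) (conv_pow p \<mu> k)) {w \<in> space (scal p (1 / sqrt (real n)) (conv_pow p \<mu> k)). shell p a b e w} =
      measure (norm_sum k) (pbox p (\<lambda>j. c * (a j - e)) (\<lambda>j. c * (b j + e))) - measure (norm_sum k) (pbox p (\<lambda>j. c * (a j + e)) (\<lambda>j. c * (b j - e)))"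
    by (subst shell_measure[OF law_scal[OF law_conv_pow[OF \<mu>]] e]) (simp only: bx)
  also have "\<dots> \<le> measure \<gamma> (pbox p (\<lambda>j. c * (a j - e)) (\<lambda>j. c * (b j + e))) - measure \<gamma> (pbox p (\<lambda>j. c * (a j + e)) (\<lambda>j. c * (b j - e))) + 2 * D"
    by (rule le)
  also have "measure \<gamma> (pbox p (\<lambda>j. c * (a j - e)) (\<lambda>j. c * (b j + e))) - measure \<gamma> (pbox p (\<lambda>j. c * (a j + e)) (\<lambda>j. c * (b j - e))) =
     measure \<gamma> {w \<in> space \<gamma>. shell p (\<lambda>j. c * a j) (\<lambda>j. c * b j) (c * e) w}"
    using c e by (subst shell_measure[OF \<gamma>]) (auto simp: algebra_simps)
  also have "\<dots> \<le> 3800 * (c * e / sqrt \<rho> * (8 * rlog n)) + 6 / real n"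
    using c e n0 by (intro shell_gauss) auto
  also have "3800 * (c * e / sqrt \<rho> * (8 * rlog n)) \<le> (5400 * (8 * rlog n) / sqrt \<rho>) * e"
  proof -
    have "sqrt 2 \<le> 54 / (38::real)" by (rule real_le_lsqrt) (auto simp: power2_eq_square)
    then have c2: "3800 * c \<le> 5400" using c by simp
    have "(3800 * c) * (e * (8 * rlog n) / sqrt \<rho>) \<le> 5400 * (e * (8 * rlog n) / sqrt \<rho>)"
      using c2 e rlog_ge_1[of n] \<rho> by (intro mult_right_mono) auto
    then show ?thesis by (simp add: mult_ac)
  qed
  finally show ?thesis by simp
qed

text \<open>The first \<open>k\<close> summands are original and the other \<open>n - k\<close> normal, with additional noise of variance
\<open>\<epsilon>\<^sup>2\<close>. The part \<open>N(0, \<rho> I)\<close> of the normal summands is collected in the last factor.\<close>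

definition path :: "nat \<Rightarrow> real \<Rightarrow> nat \<Rightarrow> (nat \<Rightarrow> real) measure" where
  "path n \<epsilon> k = conv p (conv p (scal p (1 / sqrt (real n)) (conv_pow p \<mu> k)) (scal p (sqrt (real (n - k) / real n)) W))
      (scal p (sqrt (\<epsilon>\<^sup>2 + \<rho> * (real (n - k) / real n))) (std_gauss p))"

text \<open>Both laws have the same characteristic function. Splitting one normal summand off \<open>path n \<epsilon> k\<close> lowers
the noise from \<open>n - k\<close> to \<open>n - Suc k\<close> summands.\<close>

lemma path_step:
  assumes k: "k < n" and \<epsilon>: "0 < \<epsilon>"
  defines "P \<equiv> conv p (scal p (1 / sqrt (real n)) (conv_pow p \<mu> k)) (scal p (sqrt (real (n - Suc k) / real n)) W)"
    and "\<sigma> \<equiv> sqrt (\<epsilon>\<^sup>2 + \<rho> * (real (n - Suc k) / real n))"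
  shows "path n \<epsilon> (Suc k) = conv p (conv p P (scal p (1 / sqrt (real n)) \<mu>)) (scal p \<sigma> (std_gauss p))"
    and "path n \<epsilon> k = conv p (conv p P (scal p (1 / sqrt (real n)) \<gamma>)) (scal p \<sigma> (std_gauss p))"
proof -
  note laws = law_conv law_scal law_conv_pow[OF \<mu>] W \<gamma> \<mu> law_std_gauss
  show "path n \<epsilon> (Suc k) = conv p (conv p P (scal p (1 / sqrt (real n)) \<mu>)) (scal p \<sigma> (std_gauss p))"
    unfolding path_def P_def \<sigma>_def
    by (rule char_fun_unique[of p]) (simp_all add: laws char_fun_conv char_fun_scal[OF law_conv_pow[OF \<mu>]] char_fun_scal[OF \<mu>] char_fun_conv_pow[OF \<mu>] mult_ac del: conv_pow.simps)
  have nk: "real (n - k) = real (n - Suc k) + 1" using k by (simp add: of_nat_diff)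
  have n: "0 < real n" using k by simp
  show "path n \<epsilon> k = conv p (conv p P (scal p (1 / sqrt (real n)) \<gamma>)) (scal p \<sigma> (std_gauss p))"
  proof (rule char_fun_unique[of p])
    show "law p (path n \<epsilon> k)" "law p (conv p (conv p P (scal p (1 / sqrt (real n)) \<gamma>)) (scal p \<sigma> (std_gauss p)))"
      unfolding path_def P_def by (intro laws)+
    fix a :: "nat \<Rightarrow> real"
    define Q where "Q = (\<Sum>j<p. (a j)\<^sup>2)"
    let ?t = "real (n - Suc k) / real n"
    have sq: "(sqrt (\<epsilon>\<^sup>2 + \<rho> * ?t))\<^sup>2 = \<epsilon>\<^sup>2 + \<rho> * ?t" "(sqrt ?t)\<^sup>2 = ?t" "(1 / sqrt (real n))\<^sup>2 = 1 / real n"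
      using \<rho> by (auto simp: power_divide)
    have sq': "(sqrt (\<epsilon>\<^sup>2 + \<rho> * (real (n - k) / real n)))\<^sup>2 = \<epsilon>\<^sup>2 + \<rho> * (?t + 1 / real n)"
       "(sqrt (real (n - k) / real n))\<^sup>2 = ?t + 1 / real n"
      using \<rho> by (auto simp: nk add_divide_distrib)
    \<comment> \<open>\<open>\<rho>\<close> cancels on both sides: the noise taken out of \<open>W\<close> is put back by the last factor\<close>
    have X: "exp ((?t + 1 / real n) * (- S a / 2 + \<rho> * Q / 2)) * exp (- ((\<epsilon>\<^sup>2 + \<rho> * (?t + 1 / real n)) * Q) / 2) =
       exp (?t * (- S a / 2 + \<rho> * Q / 2)) * exp (- (1 / real n * S a) / 2) * exp (- ((\<epsilon>\<^sup>2 + \<rho> * ?t) * Q) / 2)"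
    proof -
      have "(t + d) * (- s / 2 + r * q / 2) + - ((e + r * (t + d)) * q) / 2 =
          t * (- s / 2 + r * q / 2) + - (d * s) / 2 + - ((e + r * t) * q) / 2" for t d s r q e :: real
        by (simp add: field_simps)
      then show ?thesis unfolding exp_add[symmetric] by (intro arg_cong[where f=exp])
    qed
    show "char_fun p (path n \<epsilon> k) a = char_fun p (conv p (conv p P (scal p (1 / sqrt (real n)) \<gamma>)) (scal p \<sigma> (std_gauss p))) a"
      unfolding path_def P_def \<sigma>_def
      by (simp only: laws char_fun_conv char_fun_scal_W char_fun_scal_\<gamma> char_fun_scal_std_gauss sq sq' Q_def[symmetric] mult.assoc
            of_real_mult[symmetric] X)
  qed
qed

lemma path_end:
  assumes n: "1 \<le> n" and \<epsilon>: "0 < \<epsilon>"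
  shows "path n \<epsilon> n = conv p (norm_sum n) (scal p \<epsilon> (std_gauss p))" "path n \<epsilon> 0 = conv p \<gamma> (scal p \<epsilon> (std_gauss p))"
proof -
  note laws = law_conv law_scal law_conv_pow[OF \<mu>] W \<gamma> \<mu> law_std_gauss law_norm_sum
  show "path n \<epsilon> n = conv p (norm_sum n) (scal p \<epsilon> (std_gauss p))"
    unfolding path_def norm_sum_def using \<epsilon>
    by (intro char_fun_unique[of p]) (simp_all add: laws char_fun_conv char_fun_scal_W)
  show "path n \<epsilon> 0 = conv p \<gamma> (scal p \<epsilon> (std_gauss p))"
  proof (rule char_fun_unique[of p])
    show "law p (path n \<epsilon> 0)" "law p (conv p \<gamma> (scal p \<epsilon> (std_gauss p)))" unfolding path_def by (intro laws)+
    fix a :: "nat \<Rightarrow> real"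
    define Q where "Q = (\<Sum>j<p. (a j)\<^sup>2)"
    have sq: "(sqrt (\<epsilon>\<^sup>2 + \<rho> * (real (n - 0) / real n)))\<^sup>2 = \<epsilon>\<^sup>2 + \<rho>" "(sqrt (real (n - 0) / real n))\<^sup>2 = 1"
      using n \<rho> by auto
    have X: "exp (1 * (- S a / 2 + \<rho> * Q / 2)) * exp (- ((\<epsilon>\<^sup>2 + \<rho>) * Q) / 2) = exp (- S a / 2) * exp (- (\<epsilon>\<^sup>2 * Q) / 2)"
      unfolding exp_add[symmetric] by (simp add: field_simps)
    have err_const: "char_fun p (scal p (1 / sqrt (real n)) (conv_pow p \<mu> 0)) a = 1"
      by (simp only: char_fun_scal[OF law_conv_pow[OF \<mu>]] char_fun_conv_pow[OF \<mu>] power_0)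
    show "char_fun p (path n \<epsilon> 0) a = char_fun p (conv p \<gamma> (scal p \<epsilon> (std_gauss p))) a"
      unfolding path_def
      by (simp only: laws char_fun_conv char_fun_scal_W char_fun\<gamma> char_fun_scal_std_gauss sq Q_def[symmetric] err_const mult_1 of_real_mult[symmetric] X)
         (simp only: mult_1 of_real_mult[symmetric] X[unfolded mult_1])
  qed
qed


text \<open>In terms of \<open>v = sqrt n * \<sigma>\<close> the powers of \<open>n\<close> combine into the single factor \<open>1 / v ^ 3\<close>.\<close>

lemma path_increment:
  assumes k: "k < n" and A: "0 < A" and b: "0 \<le> b0" "0 \<le> b1"
    and sh: "\<And>a b e. 0 \<le> e \<Longrightarrow> measure (scal p (1 / sqrt (real n)) (conv_pow p \<mu> k))
        {w \<in> space (scal p (1 / sqrt (real n)) (conv_pow p \<mu> k)). shell p a b e w} \<le> b0 + b1 * e"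
  defines "s \<equiv> 8 * rlog n" and "v \<equiv> sqrt (A\<^sup>2 + \<rho> * real (n - Suc k))" and "y \<equiv> sqrt (real n)"
  shows "\<bar>measure (path n (A / y) (Suc k)) (pbox p a b) - measure (path n (A / y) k) (pbox p a b)\<bar> \<le>
     16 * s^3 * ((60 * (b0 + b1 * (s * v / y)) + 334 / real n) * (mom_const * mscale n ^ 3) + 60 * b1 * (mom_const * mscale n ^ 4) / y) / v ^ 3"
proof -
  have n: "1 \<le> n" using k by simp
  have y: "0 < y" "y\<^sup>2 = real n" using k by (auto simp: y_def)
  have v: "0 < v" using A \<rho> by (auto simp: v_def intro!: add_pos_nonneg)
  define \<sigma> where "\<sigma> = v / y"
  have \<sigma>: "0 < \<sigma>" using v y by (simp add: \<sigma>_def)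
  have \<sigma>': "sqrt ((A / y)\<^sup>2 + \<rho> * (real (n - Suc k) / real n)) = \<sigma>"
  proof -
    have "(A / y)\<^sup>2 + \<rho> * (real (n - Suc k) / real n) = (A\<^sup>2 + \<rho> * real (n - Suc k)) / real n"
      by (simp add: power_divide y add_divide_distrib)
    then show ?thesis by (simp add: \<sigma>_def v_def y_def real_sqrt_divide)
  qed
  have e: "0 < A / y" using A y by simp
  define P where "P = conv p (scal p (1 / sqrt (real n)) (conv_pow p \<mu> k)) (scal p (sqrt (real (n - Suc k) / real n)) W)"
  have lP: "law p P" unfolding P_def by (intro law_conv law_scal law_conv_pow \<mu> W)
  note st = path_step[OF k e, folded P_def, unfolded \<sigma>']
  have c: "0 \<le> 1 / sqrt (real n)" by simp
  have c3: "(1 / sqrt (real n)) ^ 3 * z = z / (real n * y)" "(1 / sqrt (real n)) ^ 4 * z = z / (real n)\<^sup>2" for z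
    using y(2) unfolding y_def[symmetric]
    by (simp_all add: power3_eq_cube power4_eq_xxxx power2_eq_square power_divide y(2)[symmetric])
  have MU: "(\<integral>x. max_abs p x ^ 3 \<partial>scal p (1 / sqrt (real n)) \<mu>) \<le> mom_const * mscale n ^ 3 / (real n * y)"
       "(\<integral>x. max_abs p x ^ 4 \<partial>scal p (1 / sqrt (real n)) \<mu>) \<le> mom_const * mscale n ^ 4 / (real n)\<^sup>2"
    using scal_moments(2)[OF \<mu> p c coordinate_integrable(3)[OF \<mu> int\<mu> p]] scal_moments(2)[OF \<mu> p c int\<mu>] M\<mu>[OF n] y
    unfolding c3 by (auto intro: divide_right_mono)
  have MV: "(\<integral>x. max_abs p x ^ 3 \<partial>scal p (1 / sqrt (real n)) \<gamma>) \<le> mom_const * mscale n ^ 3 / (real n * y)"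
       "(\<integral>x. max_abs p x ^ 4 \<partial>scal p (1 / sqrt (real n)) \<gamma>) \<le> mom_const * mscale n ^ 4 / (real n)\<^sup>2"
    using scal_moments(2)[OF \<gamma> p c coordinate_integrable(3)[OF \<gamma> int\<gamma> p]] scal_moments(2)[OF \<gamma> p c int\<gamma>] M\<gamma>[OF n] y
    unfolding c3 by (auto intro: divide_right_mono)
  have pt: "real p * (1 / (real p * real n)) = 1 / real n" using p by simp
  have pt1: "real p * (1 / (real p * real n)) \<le> 1" unfolding pt using n by simp
  have "\<bar>measure (path n (A / y) (Suc k)) (pbox p a b) - measure (path n (A / y) k) (pbox p a b)\<bar> \<le>
      2 * ((2 * s / \<sigma>)^3 * ((60 * (b0 + b1 * (\<sigma> * s)) + 334 * (real p * (1 / (real p * real n)))) * (mom_const * mscale n ^ 3 / (real n * y))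
        + 60 * b1 * (mom_const * mscale n ^ 4 / (real n)\<^sup>2)))"
    unfolding st
  proof (rule lindeberg_step[OF tail[OF n, folded s_def] \<sigma> pt1 p lP _ _ _ _ _ _ MU MV b])
    show "measure P {w \<in> space P. shell p a b e w} \<le> b0 + b1 * e" if "0 \<le> e" for e
      unfolding P_def by (rule shell_conv) (auto intro!: law_scal law_conv_pow \<mu> W sh that)
    show "moments_agree p (scal p (1 / sqrt (real n)) \<mu>) (scal p (1 / sqrt (real n)) \<gamma>)" by (rule scal_agree[OF \<mu> \<gamma> agree])
    show "integrable (scal p (1 / sqrt (real n)) \<mu>) (\<lambda>x. max_abs p x ^ 4)" by (rule scal_moments(1)[OF \<mu> p c int\<mu>])
    show "integrable (scal p (1 / sqrt (real n)) \<gamma>) (\<lambda>x. max_abs p x ^ 4)" by (rule scal_moments(1)[OF \<gamma> p c int\<gamma>])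
  qed (intro law_scal \<mu> \<gamma>)+
  also have "\<dots> = 16 * s^3 * ((60 * (b0 + b1 * (s * v / y)) + 334 / real n) * (mom_const * mscale n ^ 3) + 60 * b1 * (mom_const * mscale n ^ 4) / y) / v ^ 3"
  proof -
    have arith: "2 * ((2 * s / (v / y))^3 * (X * (Y / (y\<^sup>2 * y)) + Z * (V / (y\<^sup>2)\<^sup>2))) = 16 * s^3 * (X * Y + Z * V / y) / v ^ 3" for X Y Z V
      using v y(1) by (simp add: field_simps power2_eq_square power3_eq_cube)
    show ?thesis unfolding pt \<sigma>_def y(2)[symmetric] arith using p by (simp add: mult.commute)
  qed
  finally show ?thesis .
qed

definition rate :: "nat \<Rightarrow> real" where
  "rate n = rlog n ^ 5 * mscale n ^ 3 * Log (real n) / (sqrt \<rho> ^ 3 * sqrt (real n))"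

end

lemma telescope_abs: "\<bar>f n - f 0\<bar> \<le> (\<Sum>k<n. \<bar>f (Suc k) - f k :: real\<bar>)"
proof (induction n)
  case (Suc n)
  have "\<bar>f (Suc n) - f 0\<bar> \<le> \<bar>f (Suc n) - f n\<bar> + \<bar>f n - f 0\<bar>" by linarith
  then show ?case using Suc.IH by simp
qed simp

text \<open>While at least a quarter of the summands are normal, \<open>v\<close> is of order \<open>sqrt (\<rho> * n)\<close>, and the trivial bound
\<open>1\<close> for the mass of the shell suffices.\<close>

lemma early_increment:
  fixes s M v g y :: real
  assumes "0 < s" "0 \<le> M" "0 < g" "0 < y" and v: "g * y / 2 \<le> v" and n: "y\<^sup>2 = n" "1 \<le> n"
  shows "16 * s^3 * ((60 * (1 + 0 * (s * v / y)) + 334 / n) * M + 60 * 0 * M' / y) / v ^ 3 \<le> 50432 * s^3 * M / (g^3 * y^3)"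
proof -
  have v0: "0 < v" using v mult_pos_pos[OF assms(3,4)] by linarith
  have "(g * y / 2) ^ 3 \<le> v ^ 3" using assms by (intro power_mono) auto
  then have "1 / v ^ 3 \<le> 1 / ((g * y / 2) ^ 3)" using assms v0 by (intro divide_left_mono mult_pos_pos zero_less_power) auto
  also have "\<dots> = 8 / (g^3 * y^3)" by (simp add: power_mult_distrib power_divide)
  finally have 1: "1 / v ^ 3 \<le> 8 / (g^3 * y^3)" .
  have "334 / n \<le> 334" using n by (simp add: field_simps)
  then have "16 * s^3 * ((60 * (1 + 0 * (s * v / y)) + 334 / n) * M + 60 * 0 * M' / y) * (1 / v ^ 3) \<le>
     16 * s^3 * (394 * M) * (8 / (g^3 * y^3))"
    using assms 1 v0 by (intro mult_mono mult_nonneg_nonneg) (auto intro!: mult_right_mono)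
  then show ?thesis by (simp add: field_simps)
qed

lemma late_increment:
  fixes s M M' v g y n D :: real
  assumes "0 < s" "0 \<le> M" "0 < g" "0 < y" "0 < v"
  shows "16 * s^3 * ((60 * ((2 * D + 6 / n) + (5400 * s / g) * (s * v / y)) + 334 / n) * M + 60 * (5400 * s / g) * M' / y) / v ^ 3 =
     16 * s^3 * (120 * D + 694 / n) * M * (1 / v ^ 3) + 5184000 * s^5 * M / (g * y) * (1 / v\<^sup>2) + 5184000 * s^4 * M' / (g * y) * (1 / v ^ 3)"
proof -
  have "16 * s^3 * ((60 * ((2 * D + 6 * m) + (5400 * s * h) * (s * v * z)) + 334 * m) * M + 60 * (5400 * s * h) * M' * z) * w =
     16 * s^3 * (120 * D + 694 * m) * M * w + 5184000 * s^5 * M * (h * z) * (v * w) + 5184000 * s^4 * M' * (h * z) * w" for m h z w :: real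
    by (simp add: algebra_simps power2_eq_square power3_eq_cube power4_eq_xxxx eval_nat_numeral)
  from this[of "1/n" "1/g" "1/y" "1/v^3"] show ?thesis using assms by (simp add: power2_eq_square power3_eq_cube)
qed

lemma remainder_terms:
  fixes s M l Lg h z :: real
  assumes "1 \<le> s" "1 \<le> l" "l \<le> M" "1 \<le> Lg" "1 \<le> h" "0 < z" "z \<le> 1"
  defines "R \<equiv> s^5 * M * Lg * h^3 * z"
  shows "s^3 * M * h^3 * z \<le> R" "s * l * h * z \<le> R" "z\<^sup>2 \<le> R" "s^5 * M * h^3 * z \<le> R"
proof -
  have M: "1 \<le> M" using assms by linarith
  have s3: "s^3 \<le> s^5" "s \<le> s^5" "1 \<le> s^5" using assms power_increasing[of 1 5 s] by (auto intro: power_increasing)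
  have h3: "h \<le> h^3" "1 \<le> h^3" using assms power_increasing[of 1 3 h] by auto
  show "s^3 * M * h^3 * z \<le> R"
  proof -
    have "s^3 * M * h^3 * z = (s^3 * M * 1) * (h^3 * z)" by simp
    also have "\<dots> \<le> (s^5 * M * Lg) * (h^3 * z)" using assms M s3 by (intro mult_right_mono mult_mono) auto
    finally show ?thesis by (simp add: R_def mult_ac)
  qed
  show "s^5 * M * h^3 * z \<le> R"
  proof -
    have "s^5 * M * h^3 * z = (s^5 * M * 1) * (h^3 * z)" by simp
    also have "\<dots> \<le> (s^5 * M * Lg) * (h^3 * z)" using assms M s3 by (intro mult_right_mono mult_mono) auto
    finally show ?thesis by (simp add: R_def mult_ac)
  qed
  show "s * l * h * z \<le> R"
  proof -
    have "s * l * h * z = (s * l * 1 * h) * z" by simp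
    also have "\<dots> \<le> (s^5 * M * Lg * h^3) * z" using assms M s3 h3 by (intro mult_right_mono mult_mono) auto
    finally show ?thesis by (simp add: R_def)
  qed
  show "z\<^sup>2 \<le> R"
  proof -
    have "z\<^sup>2 \<le> 1 * z" using assms unfolding power2_eq_square by (intro mult_right_mono) auto
    also have "1 * z = (1 * 1 * 1 * 1) * z" by simp
    also have "\<dots> \<le> (s^5 * M * Lg * h^3) * z" using assms M s3 h3 by (intro mult_right_mono mult_mono) auto
    finally show ?thesis by (simp add: R_def)
  qed
qed

context gaussian_match
begin

text \<open>The terms with \<open>D\<close> sum up to \<open>5760 * s ^ 3 * M * D / (\<rho> * A)\<close>, and \<open>A = sqrt n * \<epsilon>\<close> is chosen such that this
is \<open>D / 4\<close>. Any factor below \<open>1 / sqrt 2\<close> would do, since the rate grows by at most \<open>sqrt 2\<close> when \<open>n\<close> is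
halved.\<close>

lemma recursion:
  assumes n: "2 \<le> n" and D0: "0 \<le> D" and D: "\<And>k a b. 1 \<le> k \<Longrightarrow> k < n \<Longrightarrow> n \<le> 2 * k \<Longrightarrow> box_error k a b \<le> D"
  shows "box_error n a b \<le> D / 4 + 200000000 * ((8 * rlog n)^5 * (mom_const * mscale n ^ 3) * Log (real n) * (1 / sqrt \<rho>)^3 * (1 / sqrt (real n)))"
proof -
  define s M M' g y A where "s = 8 * rlog n" and "M = mom_const * mscale n ^ 3" and "M' = mom_const * mscale n ^ 4" and "g = sqrt \<rho>" and "y = sqrt (real n)"
    and "A = 23040 * s^3 * M / \<rho>"
  define v where "v r = sqrt (A\<^sup>2 + \<rho> * real r)" for r :: nat
  define R where "R = s^5 * M * Log (real n) * (1 / g)^3 * (1 / y)"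
  have n1: "1 \<le> n" using n by simp
  have s1: "1 \<le> s" using rlog_ge_1[of n] by (simp add: s_def)
  have el3: "mscale n \<le> mscale n ^ 3" using mscale_ge_1[of n] power_increasing[of 1 3 "mscale n"] by simp
  have M: "mscale n \<le> M" "1 \<le> M" using mscale_ge_1[of n] el3 by (auto simp: M_def)
  have M': "M' = M * mscale n" by (simp add: M_def M'_def power4_eq_xxxx power3_eq_cube)
  have g: "0 < g" "g \<le> 1" "g\<^sup>2 = \<rho>" using \<rho> by (auto simp: g_def)
  have y: "1 \<le> y" "y\<^sup>2 = real n" using n by (auto simp: y_def)
  have A\<rho>: "\<rho> * A = 23040 * s^3 * M" using \<rho> by (simp add: A_def)
  have s3: "1 \<le> s^3" using s1 by simp
  have A1: "1 \<le> A"
  proof -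
    have "1 * 1 \<le> s^3 * M" using s1 s3 M by (intro mult_mono) auto
    then have "\<rho> \<le> 23040 * s^3 * M" using \<rho> by linarith
    then show ?thesis using \<rho> s1 by (simp add: A_def)
  qed
  have A2: "\<rho> \<le> A\<^sup>2" using A1 \<rho> one_le_power[OF A1, of 2] by linarith
  have vp: "0 < v r" for r using A1 \<rho> by (auto simp: v_def intro!: add_pos_nonneg)
  have Lg: "1 \<le> Log (real n)" by (simp add: Log_def)
  note R = remainder_terms[OF s1 mscale_ge_1[of n] M(1) Lg, of "1 / g" "1 / y", folded R_def]
  have gy: "1 \<le> 1 / g" "0 < 1 / y" "1 / y \<le> 1" using g y by auto
  note R = R[OF gy]
  define \<epsilon> where "\<epsilon> = A / y"
  have \<epsilon>: "0 < \<epsilon>" using A1 y by (simp add: \<epsilon>_def)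
  define E where "E = 50432 * s^3 * M / (g^3 * y^3)"
  define late where "late r = 16 * s^3 * (120 * D + 694 / real n) * M * (1 / v r ^ 3) + 5184000 * s^5 * M / (g * y) * (1 / (v r)\<^sup>2) +
       5184000 * s^4 * M' / (g * y) * (1 / v r ^ 3)" for r
  have E0: "0 \<le> E" using s1 M g y by (simp add: E_def)
  have M'0: "0 \<le> M'" using M mscale_ge_1[of n] by (simp add: M')
  have late0: "0 \<le> late r" for r using s1 M M'0 g y vp[of r] D0 by (simp add: late_def)
  have sums: "(\<Sum>r<n. 1 / v r ^ 3) \<le> 3 / (\<rho> * A)" "(\<Sum>r<n. 1 / (v r)\<^sup>2) \<le> 3 * Log (real n) / \<rho>"
    unfolding v_def using inverse_cube_sum[OF \<rho>(1) A2] inverse_square_sum[OF \<rho>(1) A2 n1] A1 by auto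
  have total: "real n * E + (\<Sum>r<n. late r) \<le> D / 4 + 15603109 * R"
  proof -
    have e1: "real n * E \<le> 50432 * R"
    proof -
      have "real n * E = 50432 * (s^3 * M * (1 / g)^3 * (1 / y))"
        unfolding E_def y(2)[symmetric] using y(1) g by (simp add: field_simps power2_eq_square power3_eq_cube)
      then show ?thesis using R(1) by simp
    qed
    have "(\<Sum>r<n. late r) = 16 * s^3 * (120 * D + 694 / real n) * M * (\<Sum>r<n. 1 / v r ^ 3) +
        5184000 * s^5 * M / (g * y) * (\<Sum>r<n. 1 / (v r)\<^sup>2) + 5184000 * s^4 * M' / (g * y) * (\<Sum>r<n. 1 / v r ^ 3)"
      unfolding late_def sum.distrib sum_distrib_left ..
    also have "\<dots> \<le> 16 * s^3 * (120 * D + 694 / real n) * M * (3 / (\<rho> * A)) +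
        5184000 * s^5 * M / (g * y) * (3 * Log (real n) / \<rho>) + 5184000 * s^4 * M' / (g * y) * (3 / (\<rho> * A))"
      using s1 M M'0 g y D0 by (intro add_mono mult_left_mono sums) auto
    also have "16 * s^3 * (120 * D + 694 / real n) * M * (3 / (\<rho> * A)) = D / 4 + 33312 / 23040 / real n"
      unfolding A\<rho> using s1 M n by (simp add: field_simps)
    also have "5184000 * s^5 * M / (g * y) * (3 * Log (real n) / \<rho>) = 15552000 * R"
      unfolding R_def g(3)[symmetric] using g y by (simp add: field_simps power2_eq_square power3_eq_cube)
    also have "5184000 * s^4 * M' / (g * y) * (3 / (\<rho> * A)) = 675 * (s * mscale n * (1 / g) * (1 / y))"
      unfolding A\<rho> M' using s1 M g y by (simp add: field_simps power3_eq_cube power4_eq_xxxx)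
    finally have "(\<Sum>r<n. late r) \<le> D / 4 + 33312 / 23040 / real n + 15552000 * R + 675 * (s * mscale n * (1 / g) * (1 / y))" .
    moreover have "33312 / 23040 / real n \<le> 2 * R"
    proof -
      have "33312 / 23040 / real n \<le> 2 * (1 / y)\<^sup>2" using n by (simp add: power_divide y field_simps)
      then show ?thesis using R(3) by linarith
    qed
    moreover have "0 \<le> R" using R(3) zero_le_power2[of "1 / y"] by linarith
    ultimately show ?thesis using e1 R(2) by linarith
  qed
  have inc: "\<bar>measure (path n \<epsilon> (Suc k)) (pbox p a b) - measure (path n \<epsilon> k) (pbox p a b)\<bar> \<le> E + late (n - Suc k)" if k: "k < n" for k a b
  proof (cases "2 * k < n")
    case True
    interpret prob_space "scal p (1 / sqrt (real n)) (conv_pow p \<mu> k)" using law_scal[OF law_conv_pow[OF \<mu>]] by (simp add: law_def)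
    have "real n \<le> 4 * real (n - Suc k)" using True n by linarith
    then have "\<rho> * (real n / 4) \<le> \<rho> * real (n - Suc k)" using \<rho> by (intro mult_left_mono) auto
    then have "\<rho> * real n / 4 \<le> A\<^sup>2 + \<rho> * real (n - Suc k)" using zero_le_power2[of A] by linarith
    then have "sqrt (\<rho> * real n / 4) \<le> v (n - Suc k)" unfolding v_def by (rule real_sqrt_le_mono)
    moreover have "sqrt (\<rho> * real n / 4) = g * y / 2" by (simp add: g_def y_def real_sqrt_divide real_sqrt_mult)
    ultimately have vg: "g * y / 2 \<le> v (n - Suc k)" by simp
    have "\<bar>measure (path n \<epsilon> (Suc k)) (pbox p a b) - measure (path n \<epsilon> k) (pbox p a b)\<bar> \<le>
       16 * s^3 * ((60 * (1 + 0 * (s * v (n - Suc k) / y)) + 334 / real n) * M + 60 * 0 * M' / y) / v (n - Suc k) ^ 3"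
      unfolding \<epsilon>_def s_def v_def M_def M'_def y_def
      by (rule path_increment[OF k]) (use A1 in auto)
    also have "\<dots> \<le> E" unfolding E_def by (rule early_increment) (use s1 M g y n vg in auto)
    finally show ?thesis using late0[of "n - Suc k"] by linarith
  next
    case False
    then have k1: "1 \<le> k" "n \<le> 2 * k" using n by auto
    have "\<bar>measure (path n \<epsilon> (Suc k)) (pbox p a b) - measure (path n \<epsilon> k) (pbox p a b)\<bar> \<le>
       16 * s^3 * ((60 * ((2 * D + 6 / real n) + (5400 * s / g) * (s * v (n - Suc k) / y)) + 334 / real n) * M + 60 * (5400 * s / g) * M' / y) / v (n - Suc k) ^ 3"
      unfolding \<epsilon>_def s_def v_def M_def M'_def y_def g_def
    proof (rule path_increment[OF k])
      show "measure (scal p (1 / sqrt (real n)) (conv_pow p \<mu> k)) {w \<in> space (scal p (1 / sqrt (real n)) (conv_pow p \<mu> k)). shell p a b e w} \<le>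
        (2 * D + 6 / real n) + (5400 * (8 * rlog n) / sqrt \<rho>) * e" if "0 \<le> e" for a b e
        by (rule shell_partial_sum[OF k1(1) k k1(2) D[OF k1(1) k k1(2)] that])
    qed (use A1 D0 rlog_ge_1[of n] \<rho> in auto)
    also have "\<dots> = late (n - Suc k)" unfolding late_def by (rule late_increment) (use s1 M g y vp in auto)
    finally show ?thesis using E0 by linarith
  qed
  have diff: "\<bar>measure (path n \<epsilon> n) (pbox p a b) - measure (path n \<epsilon> 0) (pbox p a b)\<bar> \<le> D / 4 + 15603109 * R" for a b
  proof -
    have "\<bar>measure (path n \<epsilon> n) (pbox p a b) - measure (path n \<epsilon> 0) (pbox p a b)\<bar> \<le> (\<Sum>k<n. E + late (n - Suc k))"
      by (rule order_trans[OF telescope_abs[of "\<lambda>k. measure (path n \<epsilon> k) (pbox p a b)"]]) (intro sum_mono inc, simp)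
    also have "\<dots> = real n * E + (\<Sum>r<n. late r)" by (simp add: sum.distrib sum.nat_diff_reindex)
    finally show ?thesis using total by linarith
  qed
  have "box_error n a b \<le> (D / 4 + 15603109 * R) + (3800 * (2 * (\<epsilon> * s) / g * s) + 6 / real n) + 2 * (real p * (1 / (real p * real n)))"
    unfolding box_error_def
  proof (rule smoothing_inequality[OF tail[OF n1, folded s_def] \<epsilon> p law_norm_sum \<gamma>])
    show "\<bar>(\<integral>w. box_mass p \<epsilon> a b w \<partial>norm_sum n) - (\<integral>w. box_mass p \<epsilon> a b w \<partial>\<gamma>)\<bar> \<le> D / 4 + 15603109 * R" for a b
      using diff[of a b] unfolding path_end[OF n1 \<epsilon>] conv_smooth_box[OF law_norm_sum \<epsilon>] conv_smooth_box[OF \<gamma> \<epsilon>] .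
    show "measure \<gamma> {w \<in> space \<gamma>. shell p a b (2 * (\<epsilon> * s)) w} \<le> 3800 * (2 * (\<epsilon> * s) / g * s) + 6 / real n" for a b
      unfolding g_def s_def using shell_gauss[OF n1, of "2 * (\<epsilon> * (8 * rlog n))" a b] \<epsilon> rlog_ge_1[of n] by simp
  qed
  also have "3800 * (2 * (\<epsilon> * s) / g * s) = 175104000 * (s^5 * M * (1 / g)^3 * (1 / y))"
    unfolding \<epsilon>_def A_def g(3)[symmetric] using g y by (simp add: field_simps power2_eq_square power3_eq_cube eval_nat_numeral)
  also have "real p * (1 / (real p * real n)) = (1 / y)\<^sup>2" using p by (simp add: power_divide y)
  also have "6 / real n = 6 * (1 / y)\<^sup>2" by (simp add: power_divide y)
  finally have "box_error n a b \<le> D / 4 + 15603109 * R + (175104000 * (s^5 * M * (1 / g)^3 * (1 / y)) + 6 * (1 / y)\<^sup>2) + 2 * (1 / y)\<^sup>2" .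
  then have "box_error n a b \<le> D / 4 + 200000000 * R" using R(3,4) zero_le_power2[of "1/y"] by linarith
  then show ?thesis by (simp add: R_def s_def M_def g_def y_def)
qed

definition err_const :: real where "err_const = 200000000 * 8^5 * mom_const"

lemma rate_bound:
  assumes "1 \<le> n" shows "1 / sqrt (real n) \<le> rate n"
proof -
  have s: "0 < sqrt \<rho> ^ 3" "sqrt \<rho> ^ 3 \<le> 1" using \<rho> by (auto intro!: power_le_one)
  have "1 * 1 * 1 \<le> rlog n ^ 5 * mscale n ^ 3 * Log (real n)"
    using rlog_ge_1[of n] mscale_ge_1[of n] by (intro mult_mono mult_nonneg_nonneg one_le_power) (auto simp: Log_def)
  then have "1 * 1 * 1 / (1 * sqrt (real n)) \<le> rlog n ^ 5 * mscale n ^ 3 * Log (real n) / (sqrt \<rho> ^ 3 * sqrt (real n))"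
    using assms s by (intro frac_le mult_right_mono) auto
  then show ?thesis by (simp add: rate_def)
qed

lemma rate_step:
  assumes k: "1 \<le> k" "k < n" "n \<le> 2 * k" shows "rate k \<le> 3 / 2 * rate n"
proof -
  have s: "0 < sqrt \<rho> ^ 3" using \<rho> by auto
  have "sqrt (real n) \<le> 3 / 2 * sqrt (real k)"
  proof (rule real_le_lsqrt)
    show "real n \<le> (3 / 2 * sqrt (real k))\<^sup>2" using k by (simp add: power_mult_distrib power_divide)
  qed auto
  then have i: "1 / sqrt (real k) \<le> 3 / 2 * (1 / sqrt (real n))" using k by (simp add: field_simps)
  have Lk: "Log (real k) \<le> Log (real n)" "0 \<le> Log (real k)" unfolding Log_def using k by (auto simp: max.coboundedI1)
  have "rlog k ^ 5 * mscale k ^ 3 * Log (real k) \<le> rlog n ^ 5 * mscale n ^ 3 * Log (real n)"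
    using rlog_ge_1[of k] mscale_ge_1[of k] rlog_ge_1[of n] mscale_ge_1[of n] rlog_mono[of k n] mscale_mono[of k n] k Lk
    by (intro mult_mono mult_nonneg_nonneg power_mono zero_le_power) auto
  then have "rlog k ^ 5 * mscale k ^ 3 * Log (real k) * (1 / sqrt (real k)) \<le>
      rlog n ^ 5 * mscale n ^ 3 * Log (real n) * (3 / 2 * (1 / sqrt (real n)))"
  proof (rule mult_mono)
    show "0 \<le> rlog n ^ 5 * mscale n ^ 3 * Log (real n)"
      using rlog_ge_1[of n] mscale_ge_1[of n] by (intro mult_nonneg_nonneg zero_le_power) (auto simp: Log_def)
  qed (use i in auto)
  then have "rlog k ^ 5 * mscale k ^ 3 * Log (real k) * (1 / sqrt (real k)) / sqrt \<rho> ^ 3 \<le>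
      rlog n ^ 5 * mscale n ^ 3 * Log (real n) * (3 / 2 * (1 / sqrt (real n))) / sqrt \<rho> ^ 3"
    using s by (intro divide_right_mono) auto
  then show ?thesis by (simp add: rate_def field_simps)
qed

theorem box_approximation: "1 \<le> n \<Longrightarrow> box_error n a b \<le> 2 * err_const * rate n"
proof (induction n arbitrary: a b rule: less_induct)
  case (less n)
  have err_const: "1 \<le> err_const" by (simp add: err_const_def)
  have r: "0 \<le> rate n" using rate_bound[OF less.prems] by (meson order_trans zero_le_divide_1_iff real_sqrt_ge_zero of_nat_0_le_iff)
  show ?case
  proof (cases "n = 1")
    case True
    interpret A: prob_space "norm_sum n" using law_norm_sum by (simp add: law_def)
    interpret B: prob_space \<gamma> using \<gamma> by (simp add: law_def)
    have "box_error n a b \<le> 1" unfolding box_error_def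
      using A.prob_le_1[of "pbox p a b"] B.prob_le_1[of "pbox p a b"] measure_nonneg[of "norm_sum n" "pbox p a b"] measure_nonneg[of \<gamma> "pbox p a b"]
      by linarith
    moreover have "1 \<le> rate n" using rate_bound[OF less.prems] True by simp
    then have "1 * 1 \<le> 2 * err_const * rate n" using err_const by (intro mult_mono) auto
    ultimately show ?thesis by simp
  next
    case False
    then have n2: "2 \<le> n" using less.prems by simp
    have "box_error n a b \<le> (2 * err_const * (3 / 2 * rate n)) / 4 +
       200000000 * ((8 * rlog n)^5 * (mom_const * mscale n ^ 3) * Log (real n) * (1 / sqrt \<rho>)^3 * (1 / sqrt (real n)))"
    proof (rule recursion[OF n2])
      show "0 \<le> 2 * err_const * (3 / 2 * rate n)" using err_const r by simp
      fix k a b assume k: "1 \<le> k" "k < n" "n \<le> 2 * k"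
      have "box_error k a b \<le> 2 * err_const * rate k" by (rule less.IH[OF k(2,1)])
      also have "\<dots> \<le> 2 * err_const * (3 / 2 * rate n)" using rate_step[OF k] err_const by (intro mult_left_mono) auto
      finally show "box_error k a b \<le> 2 * err_const * (3 / 2 * rate n)" .
    qed
    also have "200000000 * ((8 * rlog n)^5 * (mom_const * mscale n ^ 3) * Log (real n) * (1 / sqrt \<rho>)^3 * (1 / sqrt (real n))) = err_const * rate n"
      by (simp add: err_const_def rate_def power_mult_distrib power_divide)
    also have "(2 * err_const * (3 / 2 * rate n)) / 4 + err_const * rate n \<le> 2 * err_const * rate n" using err_const r by (simp add: field_simps)
    finally show ?thesis .
  qed
qed

end

section \<open>Quadratic forms\<close>

definition qf :: "nat \<Rightarrow> (nat \<Rightarrow> nat \<Rightarrow> real) \<Rightarrow> (nat \<Rightarrow> real) \<Rightarrow> real" where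
  "qf p M a = (\<Sum>i<p. \<Sum>j<p. a i * a j * M i j)"

lemma linear_le_quadratic_zero:
  fixes L c :: real
  assumes "\<And>s. 0 \<le> 2 * s * L + s\<^sup>2 * c" shows "L = 0"
proof (rule ccontr)
  assume L: "L \<noteq> 0"
  define d where "d = \<bar>c\<bar> + 1"
  have d: "d > 0" "c < d" by (auto simp: d_def)
  have "2 * (- L / d) * L + (- L / d)\<^sup>2 * c = (L\<^sup>2 / d) * (c / d - 2)"
    using d by (simp add: power2_eq_square field_simps)
  also have "\<dots> < 0" using L d by (intro mult_pos_neg) (auto simp: field_simps)
  finally show False using assms[of "- L / d"] by simp
qed

lemma qf_Suc:
  assumes "\<And>i j. i < Suc p \<Longrightarrow> j < Suc p \<Longrightarrow> M i j = M j i"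
  shows "qf (Suc p) M a = qf p M a + 2 * a p * (\<Sum>i<p. a i * M i p) + (a p)\<^sup>2 * M p p"
proof -
  have "(\<Sum>j<p. a p * a j * M p j) = (\<Sum>j<p. a p * (a j * M j p))" using assms by (intro sum.cong) auto
  moreover have "(\<Sum>i<p. a i * a p * M i p) = (\<Sum>j<p. a p * (a j * M j p))" by (intro sum.cong) auto
  ultimately show ?thesis
    by (simp add: qf_def sum.distrib sum_distrib_left[symmetric] power2_eq_square)
qed

lemma qf_cong: "(\<And>i. i < p \<Longrightarrow> a i = b i) \<Longrightarrow> qf p M a = qf p M b"
  unfolding qf_def by (intro sum.cong) auto

text \<open>Gaussian elimination of the last variable: subtracting the square that contains it leaves a
semidefinite form in the others. If the pivot \<open>d\<close> vanishes, semidefiniteness forces its whole row to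
vanish, in agreement with \<open>x / 0 = 0\<close>.\<close>

lemma psd_factor:
  assumes "\<And>i j. i < p \<Longrightarrow> j < p \<Longrightarrow> M i j = M j i" and "\<And>a. 0 \<le> qf p M a"
  shows "\<exists>B. \<forall>i<p. \<forall>j<p. M i j = (\<Sum>k<p. B i k * B j k)"
  using assms
proof (induction p arbitrary: M)
  case (Suc p)
  define d where "d = M p p"
  note sym = Suc.prems(1)
  have Q: "0 \<le> qf p M a + 2 * t * (\<Sum>i<p. a i * M i p) + t\<^sup>2 * d" for a t
  proof -
    have "qf (Suc p) M (a(p := t)) = qf p M a + 2 * t * (\<Sum>i<p. a i * M i p) + t\<^sup>2 * d"
    proof -
      have "qf (Suc p) M (a(p := t)) = qf p M (a(p := t)) + 2 * t * (\<Sum>i<p. (a(p := t)) i * M i p) + t\<^sup>2 * M p p"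
        by (subst qf_Suc[OF sym]) simp_all
      moreover have "(\<Sum>i<p. (a(p := t)) i * M i p) = (\<Sum>i<p. a i * M i p)" by (intro sum.cong) auto
      ultimately show ?thesis using qf_cong[of p "a(p := t)" a M] by (simp add: d_def)
    qed
    then show ?thesis using Suc.prems(2)[of "a(p := t)"] by (simp only:)
  qed
  have d0: "0 \<le> d" using Q[of "\<lambda>_. 0" 1] by (simp add: qf_def)
  have z: "(\<Sum>i<p. a i * M i p) = 0" if "d = 0" for a
  proof -
    have "0 \<le> qf p M a + 2 * t * (\<Sum>i<p. a i * M i p)" for t using Q[of a t] that by simp
    from this[of "- (qf p M a + 1) / (2 * (\<Sum>i<p. a i * M i p))"] show ?thesis
      by (cases "(\<Sum>i<p. a i * M i p) = 0") (auto simp: field_simps)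
  qed
  have zi: "M i p = 0" if "d = 0" "i < p" for i
    using z[OF that(1), of "\<lambda>j. if j = i then 1 else 0"] that(2) by (simp add: if_distrib[of "\<lambda>x. x * _"] cong: if_cong)
  define M' where "M' i j = M i j - M i p * M j p / d" for i j
  have "\<exists>B. \<forall>i<p. \<forall>j<p. M' i j = (\<Sum>k<p. B i k * B j k)"
  proof (rule Suc.IH)
    show "M' i j = M' j i" if "i < p" "j < p" for i j using sym[of i j] that by (simp add: M'_def mult.commute)
    fix a :: "nat \<Rightarrow> real"
    define c where "c = (\<Sum>i<p. a i * M i p)"
    have "qf p M' a = qf p M a - (\<Sum>i<p. \<Sum>j<p. (a i * M i p) * (a j * M j p) / d)"
      unfolding qf_def M'_def sum_subtractf[symmetric] by (intro sum.cong refl) (simp add: algebra_simps)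
    also have "(\<Sum>i<p. \<Sum>j<p. (a i * M i p) * (a j * M j p) / d) = c * c / d"
      unfolding c_def sum_product sum_divide_distrib ..
    finally have e: "qf p M' a = qf p M a - c * c / d" .
    show "0 \<le> qf p M' a"
    proof (cases "d = 0")
      case True
      then show ?thesis using e Q[of a 0] by simp
    next
      case False
      have "0 \<le> qf p M a + 2 * (- c / d) * c + (- c / d)\<^sup>2 * d" using Q[of a "- c / d"] by (simp add: c_def)
      also have "\<dots> = qf p M' a" unfolding e using False by (simp add: power2_eq_square field_simps)
      finally show ?thesis .
    qed
  qed
  then obtain B where B: "\<And>i j. i < p \<Longrightarrow> j < p \<Longrightarrow> M' i j = (\<Sum>k<p. B i k * B j k)" by blast
  define B' where "B' i k = (if k = p then M i p / sqrt d else if i = p then 0 else B i k)" for i k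
  have sq: "sqrt d * sqrt d = d" using d0 by simp
  show ?case
  proof (intro exI[of _ B'] allI impI)
    fix i j assume ij: "i < Suc p" "j < Suc p"
    have S: "(\<Sum>k<Suc p. B' i k * B' j k) = (\<Sum>k<p. B' i k * B' j k) + M i p * M j p / d"
      using sq by (simp add: B'_def)
    have "M i j = (\<Sum>k<p. B' i k * B' j k) + M i p * M j p / d"
    proof (cases "i = p \<or> j = p")
      case True
      then have "(\<Sum>k<p. B' i k * B' j k) = 0" by (intro sum.neutral) (auto simp: B'_def)
      moreover have "M i j = M i p * M j p / d"
        using True zi[of i] zi[of j] ij sym[of p j] d_def by (cases "d = 0") (auto simp: less_Suc_eq)
      ultimately show ?thesis by simp
    next
      case False
      then have "(\<Sum>k<p. B' i k * B' j k) = M' i j" using ij by (subst B) (auto simp: B'_def intro!: sum.cong)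
      then show ?thesis by (simp add: M'_def)
    qed
    then show "M i j = (\<Sum>k<Suc p. B' i k * B' j k)" using S by simp
  qed
qed simp

lemma compact_cube: "compact {x :: nat \<Rightarrow> real. (\<forall>i<p. \<bar>x i\<bar> \<le> 1) \<and> (\<forall>i\<ge>p. x i = 0)}"
proof -
  have "compactin (product_topology (\<lambda>_::nat. euclidean) UNIV) (PiE UNIV (\<lambda>i. if i < p then {-1..1::real} else {0}))"
    unfolding compactin_PiE by (auto simp: compactin_euclidean_iff)
  moreover have "PiE UNIV (\<lambda>i. if i < p then {-1..1::real} else {0}) = {x. (\<forall>i<p. \<bar>x i\<bar> \<le> 1) \<and> (\<forall>i\<ge>p. x i = 0)}"
    by (auto simp: PiE_iff abs_le_iff not_less split: if_splits) (meson not_le)+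
  ultimately show ?thesis by (simp add: euclidean_product_topology compactin_euclidean_iff)
qed

lemma continuous_coordinate: "continuous_on A (\<lambda>x :: nat \<Rightarrow> real. x i)"
  by (rule continuous_on_subset[OF continuous_on_product_coordinates]) auto

lemma qf_add:
  assumes "\<And>i j. i < p \<Longrightarrow> j < p \<Longrightarrow> M i j = M j i"
  shows "qf p M (\<lambda>i. x i + s * y i) = qf p M x + 2 * s * (\<Sum>i<p. y i * (\<Sum>j<p. M i j * x j)) + s\<^sup>2 * qf p M y"
proof -
  have 1: "(\<Sum>i<p. \<Sum>j<p. x i * y j * M i j) = (\<Sum>i<p. \<Sum>j<p. y i * x j * M i j)"
    by (subst sum.swap) (intro sum.cong refl, use assms in auto)
  have "qf p M (\<lambda>i. x i + s * y i) = (\<Sum>i<p. \<Sum>j<p. x i * x j * M i j + s * (x i * y j * M i j) +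
     s * (y i * x j * M i j) + s\<^sup>2 * (y i * y j * M i j))"
    unfolding qf_def by (intro sum.cong refl) (simp add: algebra_simps power2_eq_square)
  also have "\<dots> = qf p M x + s * (\<Sum>i<p. \<Sum>j<p. x i * y j * M i j) + s * (\<Sum>i<p. \<Sum>j<p. y i * x j * M i j) + s\<^sup>2 * qf p M y"
    by (simp add: sum.distrib sum_distrib_left qf_def)
  also have "(\<Sum>i<p. \<Sum>j<p. x i * y j * M i j) = (\<Sum>i<p. \<Sum>j<p. y i * x j * M i j)" by (rule 1)
  also have "(\<Sum>i<p. \<Sum>j<p. y i * x j * M i j) = (\<Sum>i<p. y i * (\<Sum>j<p. M i j * x j))"
    by (simp add: sum_distrib_left mult_ac)
  finally show ?thesis by simp
qed

lemma qf_scale: "qf p M (\<lambda>i. c * x i) = c\<^sup>2 * qf p M x"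
  unfolding qf_def sum_distrib_left by (intro sum.cong refl) (simp add: power2_eq_square mult_ac)

text \<open>The form attains its minimum \<open>m\<close> on the compact unit sphere. At a minimiser the first variation
vanishes, so that \<open>m\<close> is an eigenvalue; hence the smallest eigenvalue is at most \<open>m\<close>.\<close>

lemma smallest_eigenvalue_qf:
  assumes sym: "\<And>i j. i < p \<Longrightarrow> j < p \<Longrightarrow> R i j = R j i" and p: "0 < p"
  defines "A \<equiv> mat p p (\<lambda>(i, j). R i j)"
  shows "smallest_eigenvalue A * (\<Sum>i<p. (x i)\<^sup>2) \<le> qf p R x"
proof -
  define S where "S = {x :: nat \<Rightarrow> real. (\<forall>i<p. \<bar>x i\<bar> \<le> 1) \<and> (\<forall>i\<ge>p. x i = 0)} \<inter> {x. (\<Sum>i<p. (x i)\<^sup>2) = 1}"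
  have cl: "closed {x :: nat \<Rightarrow> real. (\<Sum>i<p. (x i)\<^sup>2) = 1}"
    by (intro closed_Collect_eq continuous_intros continuous_coordinate)
  have "compact S" unfolding S_def by (intro compact_Int_closed compact_cube cl)
  moreover have "(\<lambda>i. if i = 0 then 1 else 0) \<in> S" using p
    by (auto simp: S_def if_distrib[of "\<lambda>x. x\<^sup>2"] cong: if_cong)
  then have "S \<noteq> {}" by blast
  moreover have "continuous_on S (qf p R)"
    unfolding qf_def by (intro continuous_intros continuous_coordinate)
  ultimately have "\<exists>v\<in>S. \<forall>y\<in>S. qf p R v \<le> qf p R y" by (rule continuous_attains_inf)
  then obtain v where v: "v \<in> S" "\<And>y. y \<in> S \<Longrightarrow> qf p R v \<le> qf p R y" by blast
  define m where "m = qf p R v"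
  have vn: "(\<Sum>i<p. (v i)\<^sup>2) = 1" using v by (simp add: S_def)
  have low: "m * (\<Sum>i<p. (y i)\<^sup>2) \<le> qf p R y" for y
  proof (cases "(\<Sum>i<p. (y i)\<^sup>2) = 0")
    case True
    then have "\<forall>i<p. y i = 0" by (simp add: sum_nonneg_eq_0_iff)
    then show ?thesis using True by (simp add: qf_def)
  next
    case False
    define N where "N = (\<Sum>i<p. (y i)\<^sup>2)"
    have N: "0 < N" using False unfolding N_def by (simp add: less_le sum_nonneg)
    define z where "z i = (if i < p then (1 / sqrt N) * y i else 0)" for i
    have zN: "(\<Sum>i<p. (z i)\<^sup>2) = 1"
    proof -
      have "(\<Sum>i<p. (z i)\<^sup>2) = (\<Sum>i<p. (y i)\<^sup>2 / N)" using N by (intro sum.cong) (auto simp: z_def power_divide)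
      then show ?thesis using N by (simp add: sum_divide_distrib[symmetric] N_def)
    qed
    have "\<bar>z i\<bar> \<le> 1" if "i < p" for i
    proof -
      have "(z i)\<^sup>2 \<le> (\<Sum>i<p. (z i)\<^sup>2)" using that by (intro member_le_sum) auto
      then show ?thesis using zN by (simp add: abs_square_le_1)
    qed
    then have "z \<in> S" using zN by (auto simp: S_def z_def)
    then have "m \<le> qf p R z" using v by (simp add: m_def)
    also have "qf p R z = qf p R (\<lambda>i. (1 / sqrt N) * y i)" by (rule qf_cong) (simp add: z_def)
    also have "\<dots> = (1 / N) * qf p R y" unfolding qf_scale using N by (simp add: power_divide)
    finally show ?thesis using N by (simp add: field_simps N_def[symmetric])
  qed
  have eig: "(\<Sum>j<p. R i j * v j) = m * v i" if i: "i < p" for i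
  proof -
    define y where "y j = (if j = i then 1 else 0 :: real)" for j
    have sy: "(\<Sum>j<p. y j * g j) = g i" for g using i by (simp add: y_def if_distrib[of "\<lambda>x. x * _"] cong: if_cong)
    have "0 \<le> 2 * s * ((\<Sum>j<p. R i j * v j) - m * v i) + s\<^sup>2 * (qf p R y - m * (\<Sum>j<p. (y j)\<^sup>2))" for s
    proof -
      have "(\<Sum>j<p. (v j + s * y j)\<^sup>2) = (\<Sum>j<p. (v j)\<^sup>2) + 2 * s * (\<Sum>j<p. y j * v j) + s\<^sup>2 * (\<Sum>j<p. (y j)\<^sup>2)"
        by (simp add: power2_sum power_mult_distrib sum.distrib sum_distrib_left mult_ac)
      then have n: "(\<Sum>j<p. (v j + s * y j)\<^sup>2) = 1 + 2 * s * v i + s\<^sup>2 * (\<Sum>j<p. (y j)\<^sup>2)"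
        by (simp add: sy vn)
      have "0 \<le> qf p R (\<lambda>j. v j + s * y j) - m * (\<Sum>j<p. (v j + s * y j)\<^sup>2)" using low[of "\<lambda>j. v j + s * y j"] by simp
      moreover have "qf p R (\<lambda>j. v j + s * y j) = qf p R v + 2 * s * (\<Sum>j<p. y j * (\<Sum>k<p. R j k * v k)) + s\<^sup>2 * qf p R y"
        by (rule qf_add) (rule sym)
      ultimately show ?thesis unfolding n sy m_def[symmetric] by (simp add: algebra_simps)
    qed
    from linear_le_quadratic_zero[OF this] show ?thesis by simp
  qed
  have AC: "A \<in> carrier_mat p p" by (simp add: A_def)
  have "eigenvalue A m" unfolding eigenvalue_def eigenvector_def
  proof (intro exI[of _ "vec p v"] conjI)
    show "vec p v \<in> carrier_vec (dim_row A)" by (simp add: A_def)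
    show "vec p v \<noteq> 0\<^sub>v (dim_row A)"
    proof
      assume "vec p v = 0\<^sub>v (dim_row A)"
      then have "v i = 0" if "i < p" for i using that by (auto simp: A_def vec_eq_iff)
      then show False using vn by simp
    qed
    show "A *\<^sub>v vec p v = m \<cdot>\<^sub>v vec p v"
      by (rule eq_vecI) (auto simp: A_def scalar_prod_def eig lessThan_atLeast0[symmetric])
  qed
  moreover have "finite {k. eigenvalue A k}"
  proof -
    have "char_poly A \<noteq> 0" using degree_monic_char_poly[OF AC] by auto
    then show ?thesis unfolding eigenvalue_root_char_poly[OF AC] by (rule poly_roots_finite)
  qed
  ultimately have "smallest_eigenvalue A \<le> m" unfolding smallest_eigenvalue_def by (intro Min_le) auto
  then have "smallest_eigenvalue A * (\<Sum>i<p. (x i)\<^sup>2) \<le> m * (\<Sum>i<p. (x i)\<^sup>2)"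
    by (intro mult_right_mono sum_nonneg) auto
  with low[of x] show ?thesis by linarith
qed

section \<open>The central limit theorem for laws\<close>

text \<open>The normal limit has sub-Gaussian coordinates with parameter \<open>2\<close>, whatever the summands are.\<close>

lemma nn_integral_exp_quarter_square:
  "(\<integral>\<^sup>+z. ennreal (exp (z\<^sup>2 / 4)) \<partial>std_normal_distribution) \<le> 2"
proof -
  have e: "exp (z\<^sup>2 / 4) * phi z = sqrt 2 * normal_density 0 (sqrt 2) z" for z :: real
  proof -
    have "phi (z / sqrt 2) = sqrt 2 * normal_density 0 (sqrt 2) z"
    proof -
      have "1 / sqrt (2 * pi) = sqrt 2 * (1 / sqrt (2 * pi * (sqrt 2)\<^sup>2))"
        using pi_gt_zero by (simp add: real_sqrt_mult field_simps)
      then show ?thesis by (simp add: normal_density_def power_divide)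
    qed
    then show ?thesis by (simp add: phi_sqrt2)
  qed
  have "(\<integral>\<^sup>+z. ennreal (exp (z\<^sup>2 / 4)) \<partial>std_normal_distribution) = (\<integral>\<^sup>+z. ennreal (phi z) * ennreal (exp (z\<^sup>2 / 4)) \<partial>lborel)"
    by (subst nn_integral_density) auto
  also have "\<dots> = (\<integral>\<^sup>+z. ennreal (sqrt 2) * ennreal (normal_density 0 (sqrt 2) z) \<partial>lborel)"
    by (intro nn_integral_cong) (simp add: ennreal_mult[symmetric] e[symmetric] mult.commute)
  also have "\<dots> = ennreal (sqrt 2) * (\<integral>\<^sup>+z. ennreal (normal_density 0 (sqrt 2) z) \<partial>lborel)"
    by (rule nn_integral_cmult) simp
  also have "(\<integral>\<^sup>+z. ennreal (normal_density 0 (sqrt 2) z) \<partial>lborel) = ennreal (\<integral>z. normal_density 0 (sqrt 2) z \<partial>lborel)"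
    by (intro nn_integral_eq_integral) auto
  also have "(\<integral>z. normal_density 0 (sqrt 2) z \<partial>lborel) = 1" by simp
  also have "ennreal (sqrt 2) * ennreal 1 \<le> ennreal 2"
  proof -
    have "sqrt 2 \<le> (2::real)" by (rule real_le_lsqrt) auto
    from ennreal_leI[OF this] show ?thesis by simp
  qed
  finally show ?thesis by simp
qed

lemma std_normal_coordinate:
  assumes \<gamma>: "law p \<gamma>" and j: "j < p"
    and char_fun: "\<And>s. char_fun p \<gamma> (\<lambda>i. s * (if i = j then 1 else 0)) = of_real (exp (- (s\<^sup>2) / 2))"
  shows "distr \<gamma> borel (\<lambda>x. x j) = std_normal_distribution"
proof (rule Levy_uniqueness)
  interpret prob_space \<gamma> using \<gamma> by (simp add: law_def)
  have m[measurable]: "(\<lambda>x. x j) \<in> borel_measurable \<gamma>" by (rule component_law[OF \<gamma> j])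
  show "real_distribution (distr \<gamma> borel (\<lambda>x. x j))" by simp
  show "real_distribution std_normal_distribution" by (rule real_dist_normal_dist)
  show "char (distr \<gamma> borel (\<lambda>x. x j)) = char std_normal_distribution"
  proof
    fix s
    have "char (distr \<gamma> borel (\<lambda>x. x j)) s = (CLINT x|\<gamma>. iexp (s * x j))"
      unfolding char_def by (subst integral_distr) auto
    also have "\<dots> = char_fun p \<gamma> (\<lambda>i. s * (if i = j then 1 else 0))"
      unfolding char_fun_def cis_conv_exp using j
      by (simp add: if_distrib[of "\<lambda>x. _ * x"] if_distrib[of "\<lambda>x. x * _"] cong: if_cong)
    also have "\<dots> = char std_normal_distribution s" by (simp add: char_fun char_std_normal_distribution)
    finally show "char (distr \<gamma> borel (\<lambda>x. x j)) s = char std_normal_distribution s" .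
  qed
qed

lemma qf_unit: "j < p \<Longrightarrow> qf p \<Sigma> (\<lambda>i. if i = j then 1 else 0) = \<Sigma> j j"
  unfolding qf_def by (simp add: if_distrib[of "\<lambda>x. _ * x"] if_distrib[of "\<lambda>x. x * _"] cong: if_cong)

text \<open>With \<open>L = Log (p n)\<close>, the largest coordinate has moments of order \<open>\<nu>\<close> times the \<open>q\<close>-th root of \<open>L\<close>. The rate
contains its third power and five roots of \<open>L\<close>: altogether \<open>L ^ 4\<close> for \<open>q = 2\<close>, and \<open>L ^ 3\<close> times five
roots of \<open>L\<close> for \<open>q = 1\<close>, which is at most \<open>L ^ 6\<close>.\<close>

lemma law_clt:
  assumes p: "0 < p" and \<mu>: "law p \<mu>" and \<gamma>: "law p \<gamma>" and q: "q \<in> {1, 2::nat}" and \<nu>: "1 \<le> \<nu>"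
    and sym: "\<And>i j. i < p \<Longrightarrow> j < p \<Longrightarrow> \<Sigma> i j = \<Sigma> j i" and one: "\<And>j. j < p \<Longrightarrow> \<Sigma> j j = 1"
    and \<rho>: "0 < \<rho>" and eig: "\<And>a. \<rho> * (\<Sum>j<p. (a j)\<^sup>2) \<le> qf p \<Sigma> a"
    and mom: "\<And>i. i < p \<Longrightarrow> (\<integral>x. x i \<partial>\<mu>) = 0" "\<And>i j. i < p \<Longrightarrow> j < p \<Longrightarrow> (\<integral>x. x i * x j \<partial>\<mu>) = \<Sigma> i j"
    and momg: "\<And>i. i < p \<Longrightarrow> (\<integral>x. x i \<partial>\<gamma>) = 0" "\<And>i j. i < p \<Longrightarrow> j < p \<Longrightarrow> (\<integral>x. x i * x j \<partial>\<gamma>) = \<Sigma> i j"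
    and E: "\<And>j. j < p \<Longrightarrow> (\<integral>\<^sup>+x. ennreal (exp (\<bar>x j\<bar> ^ q / \<nu> ^ q)) \<partial>\<mu>) \<le> 2"
    and char_fun: "\<And>a. char_fun p \<gamma> a = of_real (exp (- qf p \<Sigma> a / 2))" and n: "1 \<le> n"
  shows "\<bar>measure (scal p (1 / sqrt (real n)) (conv_pow p \<mu> n)) (pbox p a b) - measure \<gamma> (pbox p a b)\<bar> \<le>
    2 * (200000000 * 8^5 * mom_const) * (\<nu>^3 * Log (real (p * n)) ^ (if q = 1 then 6 else 4) * Log (real n) / (\<rho> powr (3/2) * sqrt (real n)))"
proof -
  define L where "L n = Log (real (p * n))" for n
  define lq where "lq n = (if q = 1 then L n else sqrt (L n))" for n
  define mscale where "mscale n = \<nu> * lq n" for n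
  have L1: "1 \<le> L n" for n by (simp add: L_def Log_def)
  have sL: "1 \<le> sqrt (L n)" "sqrt (L n) * sqrt (L n) = L n" for n
    using L1[of n] by (simp_all add: real_le_rsqrt)
  have sLle: "sqrt (L n) \<le> L n" for n using sL[of n] mult_mono[of 1 "sqrt (L n)" "sqrt (L n)" "sqrt (L n)"] by simp
  have Lmono: "L k \<le> L n" if "1 \<le> k" "k \<le> n" for k n
    unfolding L_def Log_def using p that by (intro max.mono) (auto simp: ln_le_cancel_iff)
  have lq1: "1 \<le> lq n" "sqrt (L n) \<le> lq n" for n using L1 sL sLle by (auto simp: lq_def)
  have lqq: "lq n ^ q = L n" for n using q sL(2)[of n] by (auto simp: lq_def power2_eq_square)
  have pL: "real p \<le> exp (L n)" if "1 \<le> n" for n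
  proof -
    have "real p * 1 \<le> real p * real n" using that by (intro mult_left_mono) auto
    also have "\<dots> = exp (ln (real (p * n)))" using p that by simp
    also have "\<dots> \<le> exp (L n)" by (simp add: L_def Log_def)
    finally show ?thesis by simp
  qed
  have mscale_ge_1: "1 \<le> mscale n" for n using mult_mono[OF \<nu> lq1(1)[of n]] \<nu> by (simp add: mscale_def)
  have \<rho>1: "\<rho> \<le> 1"
  proof -
    have "(\<Sum>j<p. (if j = 0 then 1 else 0 :: real)\<^sup>2) = 1" using p by (simp add: if_distrib[of "\<lambda>x. x\<^sup>2"] cong: if_cong)
    then show ?thesis using eig[of "\<lambda>i. if i = 0 then 1 else 0"] qf_unit[OF p, of \<Sigma>] one[OF p] by simp
  qed
  \<comment> \<open>the covariance matrix of \<open>W\<close>\<close>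
  define M where "M i j = \<Sigma> i j - (if i = j then \<rho> else 0)" for i j
  have qM: "qf p M a = qf p \<Sigma> a - \<rho> * (\<Sum>j<p. (a j)\<^sup>2)" for a
  proof -
    have "qf p M a = qf p \<Sigma> a - (\<Sum>i<p. \<Sum>j<p. a i * a j * (if i = j then \<rho> else 0))"
      unfolding qf_def M_def sum_subtractf[symmetric] by (simp add: algebra_simps)
    also have "(\<Sum>i<p. \<Sum>j<p. a i * a j * (if i = j then \<rho> else 0)) = (\<Sum>i<p. a i * a i * \<rho>)"
      by (intro sum.cong refl) (simp add: if_distrib[of "\<lambda>x. _ * x"] cong: if_cong)
    finally show ?thesis by (simp add: sum_distrib_left power2_eq_square mult_ac)
  qed
  have "\<exists>B. \<forall>i<p. \<forall>j<p. M i j = (\<Sum>k<p. B i k * B j k)"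
  proof (rule psd_factor)
    show "M i j = M j i" if "i < p" "j < p" for i j using sym[OF that] by (simp add: M_def)
    show "0 \<le> qf p M a" for a using eig[of a] by (simp add: qM)
  qed
  then obtain B where B: "\<And>i j. i < p \<Longrightarrow> j < p \<Longrightarrow> M i j = (\<Sum>k<p. B i k * B j k)" by blast
  have cfW: "char_fun p (lin_normal p B) a = of_real (exp (- qf p \<Sigma> a / 2 + \<rho> * (\<Sum>j<p. (a j)\<^sup>2) / 2))" for a
  proof -
    have "qf p M a = (\<Sum>i<p. \<Sum>j<p. \<Sum>k<p. (a i * B i k) * (a j * B j k))"
      unfolding qf_def by (intro sum.cong refl) (simp add: B sum_distrib_left mult_ac)
    also have "\<dots> = (\<Sum>i<p. \<Sum>k<p. \<Sum>j<p. (a i * B i k) * (a j * B j k))"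
      by (intro sum.cong refl sum.swap)
    also have "\<dots> = (\<Sum>k<p. \<Sum>i<p. \<Sum>j<p. (a i * B i k) * (a j * B j k))" by (rule sum.swap)
    also have "\<dots> = (\<Sum>k<p. (\<Sum>j<p. a j * B j k)\<^sup>2)" by (simp add: power2_eq_square sum_product)
    finally have "(\<Sum>k<p. (\<Sum>j<p. a j * B j k)\<^sup>2) = qf p \<Sigma> a - \<rho> * (\<Sum>j<p. (a j)\<^sup>2)" by (simp add: qM)
    then show ?thesis unfolding char_fun_lin_normal exp_of_real[symmetric] by (simp add: diff_divide_distrib)
  qed
  have scale: "qf p \<Sigma> (\<lambda>j. c * a j) = c\<^sup>2 * qf p \<Sigma> a" for a c by (rule qf_scale)
  have Mu: "integrable \<mu> (\<lambda>x. max_abs p x ^ m)" "(\<integral>x. max_abs p x ^ m \<partial>\<mu>) \<le> 784 * mscale n ^ m" if "1 \<le> n" "m \<le> 4" for n m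
    using max_moment[OF \<mu> p q _ lq1(1)[of n] _ E that(2)] \<nu> pL[OF that(1)] by (auto simp: lqq mscale_def)
  have coord: "distr \<gamma> borel (\<lambda>x. x j) = std_normal_distribution" if j: "j < p" for j
  proof (rule std_normal_coordinate[OF \<gamma> j])
    fix s :: real
    show "char_fun p \<gamma> (\<lambda>i. s * (if i = j then 1 else 0)) = of_real (exp (- (s\<^sup>2) / 2))"
      unfolding char_fun scale qf_unit[OF j] one[OF j] by simp
  qed
  have Eg: "(\<integral>\<^sup>+x. ennreal (exp (\<bar>x j\<bar> ^ 2 / 2 ^ 2)) \<partial>\<gamma>) \<le> 2" if j: "j < p" for j
  proof -
    have [measurable]: "(\<lambda>x. x j) \<in> borel_measurable \<gamma>" by (rule component_law[OF \<gamma> j])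
    have "(\<integral>\<^sup>+x. ennreal (exp (\<bar>x j\<bar> ^ 2 / 2 ^ 2)) \<partial>\<gamma>) = (\<integral>\<^sup>+z. ennreal (exp (z\<^sup>2 / 4)) \<partial>distr \<gamma> borel (\<lambda>x. x j))"
      by (subst nn_integral_distr) auto
    then show ?thesis using nn_integral_exp_quarter_square by (simp add: coord[OF j])
  qed
  have Mg: "integrable \<gamma> (\<lambda>x. max_abs p x ^ m)" "(\<integral>x. max_abs p x ^ m \<partial>\<gamma>) \<le> mom_const * mscale n ^ m" if "1 \<le> n" "m \<le> 4" for n m
  proof -
    have a: "integrable \<gamma> (\<lambda>x. max_abs p x ^ m)" "(\<integral>x. max_abs p x ^ m \<partial>\<gamma>) \<le> 784 * (2 * sqrt (L n)) ^ m"
      using max_moment[OF \<gamma> p _ _ sL(1)[of n] _ Eg that(2)] pL[OF that(1)] L1[of n] by auto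
    show "integrable \<gamma> (\<lambda>x. max_abs p x ^ m)" by (rule a)
    have "sqrt (L n) \<le> mscale n" using lq1(2)[of n] \<nu> mult_mono[of 1 \<nu> "sqrt (L n)" "lq n"] sL(1)[of n] by (simp add: mscale_def)
    then have "(2 * sqrt (L n)) ^ m \<le> 2 ^ m * mscale n ^ m" unfolding power_mult_distrib
      using sL(1)[of n] by (intro mult_left_mono power_mono) auto
    also have "\<dots> \<le> 2 ^ 4 * mscale n ^ m" using that(2) mscale_ge_1[of n] by (intro mult_right_mono power_increasing) auto
    finally show "(\<integral>x. max_abs p x ^ m \<partial>\<gamma>) \<le> mom_const * mscale n ^ m" using a(2) by simp
  qed
  have Mu': "(\<integral>x. max_abs p x ^ m \<partial>\<mu>) \<le> mom_const * mscale n ^ m" if "1 \<le> n" "m \<le> 4" for n m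
  proof -
    have "0 \<le> mscale n ^ m" using mscale_ge_1[of n] by simp
    then show ?thesis using Mu(2)[OF that] by linarith
  qed
  interpret G: gaussian_match p \<mu> \<gamma> "lin_normal p B" "qf p \<Sigma>" \<rho> mscale
  proof unfold_locales
    show "moments_agree p \<mu> \<gamma>" using mom momg by (simp add: moments_agree_def)
    show "mscale k \<le> mscale n" if "1 \<le> k" "k \<le> n" for k n
      unfolding mscale_def lq_def using Lmono[OF that] \<nu> by (auto intro!: mult_left_mono)
  qed (use p \<mu> \<gamma> \<rho> \<rho>1 char_fun cfW scale Mu(1)[of 1 4] Mg(1)[of 1 4] Mu' Mg(2) mscale_ge_1 law_lin_normal in auto)
  have "\<bar>measure (scal p (1 / sqrt (real n)) (conv_pow p \<mu> n)) (pbox p a b) - measure \<gamma> (pbox p a b)\<bar> \<le> 2 * G.err_const * G.rate n"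
    using G.box_approximation[OF n, of a b] by (simp add: G.box_error_def G.norm_sum_def)
  also have "G.rate n \<le> \<nu>^3 * Log (real (p * n)) ^ (if q = 1 then 6 else 4) * Log (real n) / (\<rho> powr (3/2) * sqrt (real n))"
  proof -
    have r3: "sqrt \<rho> ^ 3 = \<rho> powr (3/2)"
      using \<rho> by (simp add: powr_half_sqrt[symmetric] powr_powr powr_realpow[symmetric])
    have lamL: "G.rlog n = sqrt (L n)" by (simp add: G.rlog_def L_def)
    have "G.rlog n ^ 5 * mscale n ^ 3 \<le> \<nu>^3 * L n ^ (if q = 1 then 6 else 4)"
    proof (cases "q = 1")
      case True
      have "sqrt (L n) ^ 5 \<le> sqrt (L n) ^ 6" using sL(1)[of n] by (intro power_increasing) auto
      also have "\<dots> = L n ^ 3" using sL(2)[of n] by (simp add: power_def numeral_eq_Suc mult.assoc[symmetric])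
      finally have "sqrt (L n) ^ 5 * (\<nu> ^ 3 * L n ^ 3) \<le> L n ^ 3 * (\<nu> ^ 3 * L n ^ 3)" using L1[of n] \<nu> by (intro mult_right_mono) auto
      then show ?thesis using True by (simp add: lamL mscale_def lq_def power_mult_distrib power_add[symmetric] mult_ac)
    next
      case False
      have "x ^ 5 * x ^ 3 = (x * x) ^ 4" for x :: real by (simp add: power_mult_distrib power_add[symmetric])
      from this[of "sqrt (L n)"]
      have e8: "sqrt (L n) ^ 5 * sqrt (L n) ^ 3 = L n ^ 4" by (simp only: sL(2))
      have "G.rlog n ^ 5 * mscale n ^ 3 = \<nu>^3 * (sqrt (L n) ^ 5 * sqrt (L n) ^ 3)"
        using False by (simp add: lamL mscale_def lq_def power_mult_distrib)
      then show ?thesis unfolding e8 using False by simp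
    qed
    then have "G.rlog n ^ 5 * mscale n ^ 3 * Log (real n) / (sqrt \<rho> ^ 3 * sqrt (real n)) \<le>
       \<nu>^3 * L n ^ (if q = 1 then 6 else 4) * Log (real n) / (sqrt \<rho> ^ 3 * sqrt (real n))"
      using \<rho> by (intro divide_right_mono mult_right_mono) (auto simp: Log_def)
    then show ?thesis unfolding G.rate_def r3 L_def .
  qed
  finally show ?thesis by (simp add: G.err_const_def)
qed

section \<open>From random vectors to laws\<close>

lemma (in prob_space) normal_char_and_moments:
  assumes Z: "distributed M lborel Z (normal_density m \<sigma>)" and \<sigma>: "0 < \<sigma>"
  shows "integrable M (\<lambda>\<omega>. (Z \<omega>)\<^sup>2)" "integrable M Z"
    and "expectation Z = 0 \<Longrightarrow> (CLINT \<omega>|M. cis (Z \<omega>)) = of_real (exp (- expectation (\<lambda>\<omega>. (Z \<omega>)\<^sup>2) / 2))"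
proof -
  have Zm[measurable]: "Z \<in> borel_measurable M" using distributed_measurable[OF Z] by simp
  have "integrable M (\<lambda>\<omega>. (Z \<omega> - m)\<^sup>2)"
    using distributed_integrable[OF Z, of "\<lambda>x. (x - m)\<^sup>2"] integrable_normal_moment[OF \<sigma>, of m 2] by simp
  moreover have i1: "integrable M Z"
  proof -
    have "integrable M (\<lambda>\<omega>. Z \<omega> - m)"
      using distributed_integrable[OF Z, of "\<lambda>x. x - m"] integrable_normal_moment[OF \<sigma>, of m 1] by simp
    then have "integrable M (\<lambda>\<omega>. (Z \<omega> - m) + m)" by (intro Bochner_Integration.integrable_add) auto
    then show ?thesis by simp
  qed
  ultimately have "integrable M (\<lambda>\<omega>. (Z \<omega> - m)\<^sup>2 + (2 * m * Z \<omega> - m\<^sup>2))" by (intro Bochner_Integration.integrable_add) auto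
  then show "integrable M (\<lambda>\<omega>. (Z \<omega>)\<^sup>2)" by (simp add: power2_eq_square algebra_simps)
  show "integrable M Z" by (rule i1)
  show "(CLINT \<omega>|M. cis (Z \<omega>)) = of_real (exp (- expectation (\<lambda>\<omega>. (Z \<omega>)\<^sup>2) / 2))" if e: "expectation Z = 0"
  proof -
    have m0: "m = 0" using normal_distributed_expectation[OF \<sigma> Z] e by simp
    have v: "expectation (\<lambda>\<omega>. (Z \<omega>)\<^sup>2) = \<sigma>\<^sup>2" using normal_distributed_variance[OF \<sigma> Z] e by simp
    define U where "U \<omega> = (Z \<omega> - m) / \<sigma>" for \<omega>
    have Ud: "distributed M lborel U std_normal_density"
      using normal_standard_normal_convert[OF \<sigma>, of Z m] Z unfolding U_def by simp
    have Um[measurable]: "U \<in> borel_measurable M" unfolding U_def by measurable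
    have "distr M borel U = distr M lborel U" by (rule distr_cong) auto
    also have "\<dots> = std_normal_distribution" using distributed_distr_eq_density[OF Ud] by simp
    finally have dU: "distr M borel U = std_normal_distribution" .
    have "(CLINT \<omega>|M. cis (Z \<omega>)) = (CLINT \<omega>|M. cis (\<sigma> * U \<omega>))" using \<sigma> m0 by (simp add: U_def)
    also have "\<dots> = (CLINT x|distr M borel U. cis (\<sigma> * x))" unfolding cis_conv_exp by (subst integral_distr) auto
    also have "\<dots> = exp (- of_real (\<sigma>\<^sup>2) / 2)" unfolding dU by (rule char_std_normal)
    finally show ?thesis unfolding v exp_of_real[symmetric] by simp
  qed
qed

text \<open>A linear combination of the coordinates is univariate normal or almost surely constant; in both cases
its variance, the quadratic form of the covariances, determines its characteristic function.\<close>

lemma gaussian_cf: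
  assumes N: "prob_space N" and Y: "gaussian_vector N p Y" and c: "centered N p Y"
  shows "char_fun p (distr N (Rp p) Y) a = of_real (exp (- qf p (\<lambda>i j. prob_space.expectation N (\<lambda>\<omega>. Y \<omega> i * Y \<omega> j)) a / 2))"
proof -
  interpret prob_space N by fact
  have Ym: "Y \<in> N \<rightarrow>\<^sub>M Rp p" using Y by (simp add: gaussian_vector_def)
  have Yj[measurable]: "(\<lambda>\<omega>. Y \<omega> j) \<in> borel_measurable N" if "j < p" for j
    using measurable_compose[OF Ym component_Rp[OF that]] .
  have lc: "\<exists>m \<sigma>. 0 < \<sigma> \<and> distributed N lborel (\<lambda>\<omega>. \<Sum>j<p. a j * Y \<omega> j) (normal_density m \<sigma>) \<or> (AE \<omega> in N. (\<Sum>j<p. a j * Y \<omega> j) = m)" for a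
    using Y by (simp add: gaussian_vector_def)
  have mc: "(\<lambda>\<omega>. \<Sum>j<p. a j * Y \<omega> j) \<in> borel_measurable N" for a
    by (intro borel_measurable_sum borel_measurable_times Yj) auto
  have sq: "integrable N (\<lambda>\<omega>. (\<Sum>j<p. a j * Y \<omega> j)\<^sup>2)" for a
  proof -
    obtain m \<sigma> where "0 < \<sigma> \<and> distributed N lborel (\<lambda>\<omega>. \<Sum>j<p. a j * Y \<omega> j) (normal_density m \<sigma>) \<or> (AE \<omega> in N. (\<Sum>j<p. a j * Y \<omega> j) = m)"
      using lc by blast
    then show ?thesis
    proof
      assume "0 < \<sigma> \<and> distributed N lborel (\<lambda>\<omega>. \<Sum>j<p. a j * Y \<omega> j) (normal_density m \<sigma>)"
      then show ?thesis using normal_char_and_moments(1) by blast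
    next
      assume "AE \<omega> in N. (\<Sum>j<p. a j * Y \<omega> j) = m"
      then have "AE \<omega> in N. norm ((\<Sum>j<p. a j * Y \<omega> j)\<^sup>2) \<le> m\<^sup>2" by (rule AE_mp) simp
      then show ?thesis by (rule integrable_const_bound) (use mc in measurable)
    qed
  qed
  have Y2: "integrable N (\<lambda>\<omega>. (Y \<omega> j)\<^sup>2)" if "j < p" for j
    using sq[of "\<lambda>i. if i = j then 1 else 0"] that by (simp add: if_distrib[of "\<lambda>x. x * _"] cong: if_cong)
  have YY: "integrable N (\<lambda>\<omega>. Y \<omega> i * Y \<omega> j)" if "i < p" "j < p" for i j
  proof (rule Bochner_Integration.integrable_bound)
    show "integrable N (\<lambda>\<omega>. (Y \<omega> i)\<^sup>2 + (Y \<omega> j)\<^sup>2)" using Y2 that by auto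
    show "AE \<omega> in N. norm (Y \<omega> i * Y \<omega> j) \<le> norm ((Y \<omega> i)\<^sup>2 + (Y \<omega> j)\<^sup>2)"
    proof (rule AE_I2)
      fix \<omega>
      have "2 * (\<bar>Y \<omega> i\<bar> * \<bar>Y \<omega> j\<bar>) \<le> (Y \<omega> i)\<^sup>2 + (Y \<omega> j)\<^sup>2"
        using zero_le_power2[of "\<bar>Y \<omega> i\<bar> - \<bar>Y \<omega> j\<bar>"] by (simp add: power2_diff)
      moreover have "0 \<le> \<bar>Y \<omega> i\<bar> * \<bar>Y \<omega> j\<bar>" by simp
      ultimately have "\<bar>Y \<omega> i\<bar> * \<bar>Y \<omega> j\<bar> \<le> (Y \<omega> i)\<^sup>2 + (Y \<omega> j)\<^sup>2" by linarith
      then show "norm (Y \<omega> i * Y \<omega> j) \<le> norm ((Y \<omega> i)\<^sup>2 + (Y \<omega> j)\<^sup>2)" by (simp add: abs_mult)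
    qed
  qed (use that in measurable)
  define Z where "Z \<omega> = (\<Sum>j<p. a j * Y \<omega> j)" for \<omega>
  have EZ: "expectation Z = 0"
  proof -
    have "expectation Z = (\<Sum>j<p. a j * expectation (\<lambda>\<omega>. Y \<omega> j))"
      unfolding Z_def using c by (subst Bochner_Integration.integral_sum) (auto simp: centered_def)
    then show ?thesis using c by (simp add: centered_def)
  qed
  have EZ2: "expectation (\<lambda>\<omega>. (Z \<omega>)\<^sup>2) = qf p (\<lambda>i j. expectation (\<lambda>\<omega>. Y \<omega> i * Y \<omega> j)) a"
  proof -
    have "expectation (\<lambda>\<omega>. (Z \<omega>)\<^sup>2) = expectation (\<lambda>\<omega>. \<Sum>i<p. \<Sum>j<p. a i * a j * (Y \<omega> i * Y \<omega> j))"
      by (simp add: Z_def power2_eq_square sum_product mult_ac)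
    also have "\<dots> = (\<Sum>i<p. \<Sum>j<p. a i * a j * expectation (\<lambda>\<omega>. Y \<omega> i * Y \<omega> j))"
      using YY by (subst Bochner_Integration.integral_sum, (intro Bochner_Integration.integrable_sum integrable_mult_right; simp),
          intro sum.cong refl, subst Bochner_Integration.integral_sum) auto
    finally show ?thesis by (simp add: qf_def)
  qed
  have "(CLINT \<omega>|N. cis (Z \<omega>)) = of_real (exp (- expectation (\<lambda>\<omega>. (Z \<omega>)\<^sup>2) / 2))"
  proof -
    obtain m \<sigma> where "0 < \<sigma> \<and> distributed N lborel Z (normal_density m \<sigma>) \<or> (AE \<omega> in N. Z \<omega> = m)"
      using lc[of a] unfolding Z_def[symmetric] by blast
    then show ?thesis
    proof
      assume "0 < \<sigma> \<and> distributed N lborel Z (normal_density m \<sigma>)"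
      then show ?thesis using normal_char_and_moments(3)[OF _ _ EZ] by blast
    next
      assume ae: "AE \<omega> in N. Z \<omega> = m"
      have Zm: "Z \<in> borel_measurable N" unfolding Z_def by (rule mc)
      have "expectation Z = expectation (\<lambda>_. m)" by (rule integral_cong_AE) (use ae Zm in auto)
      then have "m = 0" using EZ by (simp add: prob_space)
      with ae have ae0: "AE \<omega> in N. Z \<omega> = 0" by simp
      have "expectation (\<lambda>\<omega>. (Z \<omega>)\<^sup>2) = expectation (\<lambda>_. 0)"
        by (rule integral_cong_AE) (use ae0 Zm in auto)
      moreover have "(CLINT \<omega>|N. cis (Z \<omega>)) = (CLINT \<omega>|N. 1)"
        unfolding cis_conv_exp by (rule integral_cong_AE) (use ae0 Zm in auto)
      ultimately show ?thesis by (simp add: prob_space)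
    qed
  qed
  then show ?thesis unfolding char_fun_distr[OF Ym] EZ2[symmetric] by (simp add: Z_def)
qed

lemma iid_sum_law:
  assumes M: "prob_space M" and ind: "prob_space.indep_vars M (\<lambda>_. Rp p) X {..<n}"
    and same: "\<And>i. i < n \<Longrightarrow> distr M (Rp p) (X i) = \<mu>" and k: "k \<le> n"
  shows "distr M (Rp p) (\<lambda>\<omega>. \<lambda>j\<in>{..<p}. \<Sum>i<k. X i \<omega> j) = conv_pow p \<mu> k"
  using k
proof (induction k)
  case 0
  interpret prob_space M by fact
  show ?case by (simp only: lessThan_0 sum.empty conv_pow.simps) (rule distr_const, auto simp: space_Rp PiE_iff extensional_def)
next
  case (Suc k)
  interpret prob_space M by fact
  have Xm: "X i \<in> M \<rightarrow>\<^sub>M Rp p" if "i < n" for i using ind that by (auto simp: indep_vars_def)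
  define S where "S k \<omega> = (\<lambda>j\<in>{..<p}. \<Sum>i<k. X i \<omega> j)" for k \<omega>
  have IH: "distr M (Rp p) (S k) = conv_pow p \<mu> k" unfolding S_def[abs_def] by (rule Suc.IH) (use Suc.prems in simp)
  have ir: "indep_var (PiM {..<k} (\<lambda>_. Rp p)) (\<lambda>\<omega>. \<lambda>i\<in>{..<k}. X i \<omega>) (PiM {k} (\<lambda>_. Rp p)) (\<lambda>\<omega>. \<lambda>i\<in>{k}. X i \<omega>)"
    by (rule indep_var_restrict[OF ind]) (use Suc.prems in auto)
  have m1: "(\<lambda>x. \<lambda>j\<in>{..<p}. \<Sum>i<k. x i j) \<in> PiM {..<k} (\<lambda>_. Rp p) \<rightarrow>\<^sub>M Rp p"
  proof (intro restrict_Rp borel_measurable_sum)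
    fix j i assume "j < p" "i \<in> {..<k}"
    then have "(\<lambda>x. x i) \<in> PiM {..<k} (\<lambda>_. Rp p) \<rightarrow>\<^sub>M Rp p" "(\<lambda>x. x j) \<in> borel_measurable (Rp p)"
      by (auto intro: measurable_component_singleton component_Rp)
    then show "(\<lambda>x. x i j) \<in> borel_measurable (PiM {..<k} (\<lambda>_. Rp p))" by (rule measurable_compose)
  qed
  have m2: "(\<lambda>x. x k) \<in> PiM {k} (\<lambda>_. Rp p) \<rightarrow>\<^sub>M Rp p" by (rule measurable_component_singleton) simp
  have "indep_var (Rp p) (S k) (Rp p) (X k)"
    using indep_var_compose[OF ir m1 m2] by (simp add: comp_def S_def[abs_def] cong: restrict_cong)
  then have pair: "distr M (Rp p) (S k) \<Otimes>\<^sub>M distr M (Rp p) (X k) = distr M (Rp p \<Otimes>\<^sub>M Rp p) (\<lambda>\<omega>. (S k \<omega>, X k \<omega>))"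
    and Sm: "S k \<in> M \<rightarrow>\<^sub>M Rp p"
    using indep_var_distribution_eq by auto
  have Xk: "X k \<in> M \<rightarrow>\<^sub>M Rp p" using Xm Suc.prems by simp
  have pm: "(\<lambda>(x, y). padd p x y) \<in> Rp p \<Otimes>\<^sub>M Rp p \<rightarrow>\<^sub>M Rp p"
  proof -
    have e: "sets (std_gauss p \<Otimes>\<^sub>M std_gauss p) = sets (Rp p \<Otimes>\<^sub>M Rp p)" by (intro sets_pair_measure_cong sets_std_gauss)
    from padd_measurable[OF law_std_gauss law_std_gauss, of p] show ?thesis unfolding measurable_cong_sets[OF e refl] .
  qed
  have "distr M (Rp p) (S (Suc k)) = distr M (Rp p) ((\<lambda>(x, y). padd p x y) \<circ> (\<lambda>\<omega>. (S k \<omega>, X k \<omega>)))"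
    by (intro arg_cong[where f="distr M (Rp p)"]) (auto simp: S_def padd_def fun_eq_iff)
  also have "\<dots> = distr (distr M (Rp p \<Otimes>\<^sub>M Rp p) (\<lambda>\<omega>. (S k \<omega>, X k \<omega>))) (Rp p) (\<lambda>(x, y). padd p x y)"
    using Sm Xk by (intro distr_distr[symmetric] pm) auto
  also have "\<dots> = conv p (conv_pow p \<mu> k) \<mu>"
    unfolding pair[symmetric] IH using same Suc.prems by (simp add: conv_def)
  finally show ?case unfolding S_def[abs_def] conv_pow.simps .
qed

text \<open>The rational points of the interval, together with those end points that belong to it, form a
countable set, and every point of the interval lies between two of its elements. The compact
intervals spanned by the first \<open>m\<close> of them exhaust the interval.\<close>

lemma interval_exhaustion:
  fixes I :: "real set"
  assumes I: "is_interval I"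
  shows "\<exists>a b :: nat \<Rightarrow> real. incseq (\<lambda>m. {a m..b m}) \<and> (\<Union>m. {a m..b m}) = I"
proof (cases "I = {}")
  case True
  then show ?thesis by (intro exI[of _ "\<lambda>_. 1"] exI[of _ "\<lambda>_. 0"]) (auto simp: incseq_def)
next
  case False
  have conn: "x \<in> I \<Longrightarrow> z \<in> I \<Longrightarrow> x \<le> y \<Longrightarrow> y \<le> z \<Longrightarrow> y \<in> I" for x y z
    using I unfolding is_interval_1 by blast
  define D where "D = (I \<inter> \<rat>) \<union> {x\<in>I. \<forall>y\<in>I. y \<le> x} \<union> {x\<in>I. \<forall>y\<in>I. x \<le> y}"
  \<comment> \<open>these two sets have at most one element each\<close>
  have c1: "countable {x\<in>I. \<forall>y\<in>I. y \<le> x}"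
  proof (cases "{x\<in>I. \<forall>y\<in>I. y \<le> x} = {}")
    case False
    then obtain x where "x \<in> I" "\<forall>y\<in>I. y \<le> x" by blast
    then have "{x\<in>I. \<forall>y\<in>I. y \<le> x} \<subseteq> {x}" by (auto intro: antisym)
    then show ?thesis by (rule countable_subset) simp
  next
    case True
    then show ?thesis by (simp only: countable_empty)
  qed
  have c2: "countable {x\<in>I. \<forall>y\<in>I. x \<le> y}"
  proof (cases "{x\<in>I. \<forall>y\<in>I. x \<le> y} = {}")
    case False
    then obtain x where "x \<in> I" "\<forall>y\<in>I. x \<le> y" by blast
    then have "{x\<in>I. \<forall>y\<in>I. x \<le> y} \<subseteq> {x}" by (auto intro: antisym)
    then show ?thesis by (rule countable_subset) simp
  next
    case True
    then show ?thesis by (simp only: countable_empty)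
  qed
  have cD: "countable D" unfolding D_def using c1 c2 countable_rat by auto
  have up: "\<exists>d\<in>D. x \<le> d" if x: "x \<in> I" for x
  proof (cases "\<forall>y\<in>I. y \<le> x")
    case True
    then show ?thesis using x by (auto simp: D_def)
  next
    case False
    then obtain y where y: "y \<in> I" "x < y" by (auto simp: not_le)
    obtain r where r: "r \<in> \<rat>" "x < r" "r < y" using Rats_dense_in_real[OF y(2)] by blast
    then have "r \<in> I" using conn[OF x y(1)] by simp
    then show ?thesis using r by (auto simp: D_def intro: less_imp_le)
  qed
  have dn: "\<exists>d\<in>D. d \<le> x" if x: "x \<in> I" for x
  proof (cases "\<forall>y\<in>I. x \<le> y")
    case True
    then show ?thesis using x by (auto simp: D_def)
  next
    case False
    then obtain y where y: "y \<in> I" "y < x" by (auto simp: not_le)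
    obtain r where r: "r \<in> \<rat>" "y < r" "r < x" using Rats_dense_in_real[OF y(2)] by blast
    then have "r \<in> I" using conn[OF y(1) x] by simp
    then show ?thesis using r by (auto simp: D_def intro: less_imp_le)
  qed
  have D0: "D \<noteq> {}" using up False by blast
  define f where "f = from_nat_into D"
  have f: "range f = D" unfolding f_def by (rule range_from_nat_into[OF D0 cD])
  have DI: "D \<subseteq> I" by (auto simp: D_def)
  define a b where "a m = Min (f ` {..m})" and "b m = Max (f ` {..m})" for m :: nat
  have ab: "a m \<le> f i" "f i \<le> b m" if "i \<le> m" for i m using that by (auto simp: a_def b_def)
  have abI: "a m \<in> I" "b m \<in> I" for m
  proof -
    have "a m \<in> f ` {..m}" "b m \<in> f ` {..m}" unfolding a_def b_def by (intro Min_in Max_in; auto)+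
    then show "a m \<in> I" "b m \<in> I" using f DI by blast+
  qed
  have "incseq (\<lambda>m. {a m..b m})"
  proof (rule incseq_SucI)
    fix m
    have "a (Suc m) \<le> a m" unfolding a_def by (rule Min_antimono) auto
    moreover have "b m \<le> b (Suc m)" unfolding b_def by (rule Max_mono) auto
    ultimately show "{a m..b m} \<subseteq> {a (Suc m)..b (Suc m)}" by auto
  qed
  moreover have "(\<Union>m. {a m..b m}) = I"
  proof (intro Set.equalityI subsetI)
    fix x assume "x \<in> (\<Union>m. {a m..b m})"
    then obtain m where "a m \<le> x" "x \<le> b m" by auto
    then show "x \<in> I" using conn[OF abI] by blast
  next
    fix x assume x: "x \<in> I"
    obtain d e where "d \<in> D" "d \<le> x" "e \<in> D" "x \<le> e" using up[OF x] dn[OF x] by blast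
    then obtain i k where "f i \<le> x" "x \<le> f k" using f by (metis imageE)
    then have "a (max i k) \<le> x" "x \<le> b (max i k)" using ab(1)[of i "max i k"] ab(2)[of k "max i k"] by auto
    then show "x \<in> (\<Union>m. {a m..b m})" by auto
  qed
  ultimately show ?thesis by blast
qed

lemma hyperrectangle_limit:
  assumes P: "law p P" and Q: "law p Q"
    and box: "\<And>a b. \<bar>measure P (pbox p a b) - measure Q (pbox p a b)\<bar> \<le> \<delta>" and A: "A \<in> hyperrectangles p"
  shows "A \<in> sets (Rp p)" "\<bar>measure P A - measure Q A\<bar> \<le> \<delta>"
proof -
  obtain I where I: "A = PiE {..<p} I" "\<forall>j<p. is_interval (I j)" using A by (auto simp: hyperrectangles_def)
  have "\<exists>c :: (nat \<Rightarrow> real) \<times> (nat \<Rightarrow> real). j < p \<longrightarrow> incseq (\<lambda>m. {fst c m..snd c m}) \<and> (\<Union>m. {fst c m..snd c m}) = I j" for j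
  proof (cases "j < p")
    case True
    then obtain a b :: "nat \<Rightarrow> real" where "incseq (\<lambda>m. {a m..b m})" "(\<Union>m. {a m..b m}) = I j"
      using interval_exhaustion[of "I j"] I(2) by blast
    then show ?thesis by (intro exI[of _ "(a, b)"]) simp
  qed simp
  then obtain c :: "nat \<Rightarrow> (nat \<Rightarrow> real) \<times> (nat \<Rightarrow> real)"
    where c: "\<forall>j. j < p \<longrightarrow> incseq (\<lambda>m. {fst (c j) m..snd (c j) m}) \<and> (\<Union>m. {fst (c j) m..snd (c j) m}) = I j"
    using choice[of "\<lambda>j c. j < p \<longrightarrow> incseq (\<lambda>m. {fst c m..snd c m}) \<and> (\<Union>m. {fst c m..snd c m}) = I j"] by blast
  define a b where "a j = fst (c j)" and "b j = snd (c j)" for j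
  have ab: "incseq (\<lambda>m. {a j m..b j m})" "(\<Union>m. {a j m..b j m}) = I j" if "j < p" for j
    using c that by (simp_all add: a_def b_def)
  define C where "C m = pbox p (\<lambda>j. a j m) (\<lambda>j. b j m)" for m
  have Ciff: "w \<in> C m \<longleftrightarrow> w \<in> extensional {..<p} \<and> (\<forall>j<p. w j \<in> {a j m..b j m})" for w m
    by (auto simp: C_def pbox_def in_box_def space_Rp PiE_iff)
  have inc: "incseq C"
  proof (rule incseq_SucI)
    fix m
    have "{a j m..b j m} \<subseteq> {a j (Suc m)..b j (Suc m)}" if "j < p" for j
      using ab(1)[OF that] by (rule incseq_SucD)
    then show "C m \<subseteq> C (Suc m)" unfolding subset_iff Ciff by blast
  qed
  have un: "(\<Union>m. C m) = A"
  proof (intro Set.equalityI subsetI)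
    fix w assume "w \<in> (\<Union>m. C m)"
    then obtain m where m: "w \<in> C m" by blast
    then have "w j \<in> (\<Union>m. {a j m..b j m})" if "j < p" for j using that by (auto simp: Ciff)
    then show "w \<in> A" using ab(2) m unfolding I(1) by (simp add: Ciff PiE_iff)
  next
    fix w assume w: "w \<in> A"
    have "\<exists>m. j < p \<longrightarrow> w j \<in> {a j m..b j m}" for j
    proof (cases "j < p")
      case True
      then have "w j \<in> (\<Union>m. {a j m..b j m})" using w ab(2)[OF True] unfolding I(1) PiE_iff by simp
      then show ?thesis by blast
    qed simp
    then obtain m where m: "\<And>j. j < p \<Longrightarrow> w j \<in> {a j (m j)..b j (m j)}"
      using choice[of "\<lambda>j m. j < p \<longrightarrow> w j \<in> {a j m..b j m}"] by blast
    define k where "k = (\<Sum>j<p. m j)"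
    have "w j \<in> {a j k..b j k}" if j: "j < p" for j
    proof -
      have "m j \<le> k" unfolding k_def using j by (intro member_le_sum) auto
      then show ?thesis using ab(1)[OF j] m[OF j] unfolding incseq_def by blast
    qed
    then have "w \<in> C k" using w by (simp add: Ciff I(1) PiE_iff)
    then show "w \<in> (\<Union>m. C m)" by blast
  qed
  have Cs: "C m \<in> sets (Rp p)" for m unfolding C_def by (rule box_sets)
  show "A \<in> sets (Rp p)" unfolding un[symmetric] using Cs by auto
  have lim: "(\<lambda>m. measure R (C m)) \<longlonglongrightarrow> measure R A" if R: "law p R" for R
  proof -
    interpret prob_space R using R by (simp add: law_def)
    show ?thesis unfolding un[symmetric] using R Cs inc by (intro finite_Lim_measure_incseq) (auto simp: law_def)
  qed
  have "(\<lambda>m. \<bar>measure P (C m) - measure Q (C m)\<bar>) \<longlonglongrightarrow> \<bar>measure P A - measure Q A\<bar>"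
    by (intro tendsto_rabs tendsto_diff lim P Q)
  then show "\<bar>measure P A - measure Q A\<bar> \<le> \<delta>"
    by (rule LIMSEQ_le_const2) (auto simp: C_def intro: box)
qed

section \<open>The theorem for random vectors\<close>

text \<open>With variance one, every admissible \<open>t\<close> is at least \<open>1 / 2\<close>, because \<open>exp\<close> dominates its quadratic
Taylor polynomial. Taking \<open>2 * \<nu>\<close> as parameter, strictly above the infimum, avoids the question
whether the infimum is attained.\<close>

lemma psi_norm_unit_variance:
  assumes M: "prob_space M" and U[measurable]: "U \<in> borel_measurable M"
    and i: "integrable M (\<lambda>\<omega>. (U \<omega>)\<^sup>2)" and e: "prob_space.expectation M (\<lambda>\<omega>. (U \<omega>)\<^sup>2) = 1"
    and q: "q \<in> {1, 2::nat}" and le: "psi_norm q M U \<le> ennreal \<nu>"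
  shows "1 / 2 \<le> \<nu>" "(\<integral>\<^sup>+ \<omega>. ennreal (exp (\<bar>U \<omega>\<bar> ^ q / (2 * \<nu>) ^ q)) \<partial>M) \<le> 2"
proof -
  interpret prob_space M by fact
  have half: "1 / 2 \<le> t" if t: "0 < t" "(\<integral>\<^sup>+ \<omega>. ennreal (exp (\<bar>U \<omega>\<bar> ^ q / t ^ q)) \<partial>M) \<le> 2" for t
  proof -
    have pt: "1 + (U \<omega>)\<^sup>2 / (2 * t\<^sup>2) \<le> exp (\<bar>U \<omega>\<bar> ^ q / t ^ q)" for \<omega>
    proof (cases "q = 1")
      case True
      have "1 + \<bar>U \<omega>\<bar> / t + (\<bar>U \<omega>\<bar> / t)\<^sup>2 / 2 \<le> exp (\<bar>U \<omega>\<bar> / t)" using t by (intro exp_lower_Taylor_quadratic) auto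
      moreover have "0 \<le> \<bar>U \<omega>\<bar> / t" using t by simp
      ultimately show ?thesis using True by (simp add: power_divide)
    next
      case False
      then have q2: "q = 2" using q by simp
      have "1 + (U \<omega>)\<^sup>2 / t\<^sup>2 \<le> exp ((U \<omega>)\<^sup>2 / t\<^sup>2)" by (rule exp_ge_add_one_self)
      moreover have "(U \<omega>)\<^sup>2 / (2 * t\<^sup>2) \<le> (U \<omega>)\<^sup>2 / t\<^sup>2" using t by (intro divide_left_mono) auto
      ultimately have "1 + (U \<omega>)\<^sup>2 / (2 * t\<^sup>2) \<le> exp ((U \<omega>)\<^sup>2 / t\<^sup>2)" by linarith
      then show ?thesis using q2 by simp
    qed
    have "ennreal (1 + 1 / (2 * t\<^sup>2)) = ennreal (\<integral>\<omega>. 1 + (U \<omega>)\<^sup>2 / (2 * t\<^sup>2) \<partial>M)" using i e by (simp add: prob_space)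
    also have "\<dots> = (\<integral>\<^sup>+\<omega>. ennreal (1 + (U \<omega>)\<^sup>2 / (2 * t\<^sup>2)) \<partial>M)"
      using i by (intro nn_integral_eq_integral[symmetric]) auto
    also have "\<dots> \<le> (\<integral>\<^sup>+ \<omega>. ennreal (exp (\<bar>U \<omega>\<bar> ^ q / t ^ q)) \<partial>M)" by (intro nn_integral_mono ennreal_leI pt)
    also have "\<dots> \<le> ennreal 2" using t by simp
    finally have "1 + 1 / (2 * t\<^sup>2) \<le> 2" by (subst (asm) ennreal_le_iff) auto
    then have "1 \<le> 2 * t\<^sup>2" using t by (simp add: field_simps)
    then have "(1 / 2)\<^sup>2 \<le> t\<^sup>2" by (simp add: power_divide)
    then show ?thesis by (rule power2_le_imp_le) (use t in simp)
  qed
  have "ennreal (1 / 2) \<le> psi_norm q M U" unfolding psi_norm_def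
  proof (rule Inf_greatest)
    fix z assume "z \<in> {ennreal t |t. 0 < t \<and> (\<integral>\<^sup>+ \<omega>. ennreal (exp (\<bar>U \<omega>\<bar> ^ q / t ^ q)) \<partial>M) \<le> 2}"
    then obtain t where "z = ennreal t" "0 < t" "(\<integral>\<^sup>+ \<omega>. ennreal (exp (\<bar>U \<omega>\<bar> ^ q / t ^ q)) \<partial>M) \<le> 2" by blast
    then show "ennreal (1 / 2) \<le> z" using ennreal_leI[OF half] by blast
  qed
  then have "ennreal (1 / 2) \<le> ennreal \<nu>" using le by (rule order_trans)
  show \<nu>: "1 / 2 \<le> \<nu>"
  proof (rule leI, rule notI)
    assume "\<nu> < 1 / 2"
    then have "ennreal \<nu> < ennreal (1 / 2)" by (intro ennreal_lessI) auto
    with \<open>ennreal (1 / 2) \<le> ennreal \<nu>\<close> show False by (meson not_le)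
  qed
  have "psi_norm q M U < ennreal (2 * \<nu>)" by (rule le_less_trans[OF le]) (use \<nu> in \<open>simp add: ennreal_less_iff\<close>)
  then obtain t where t: "0 < t" "(\<integral>\<^sup>+ \<omega>. ennreal (exp (\<bar>U \<omega>\<bar> ^ q / t ^ q)) \<partial>M) \<le> 2" "ennreal t < ennreal (2 * \<nu>)"
    unfolding psi_norm_def Inf_less_iff by auto
  then have t2: "t \<le> 2 * \<nu>" by (simp add: ennreal_less_iff)
  have "(\<integral>\<^sup>+ \<omega>. ennreal (exp (\<bar>U \<omega>\<bar> ^ q / (2 * \<nu>) ^ q)) \<partial>M) \<le> (\<integral>\<^sup>+ \<omega>. ennreal (exp (\<bar>U \<omega>\<bar> ^ q / t ^ q)) \<partial>M)"
  proof (intro nn_integral_mono ennreal_leI)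
    fix \<omega>
    have "\<bar>U \<omega>\<bar> ^ q / (2 * \<nu>) ^ q \<le> \<bar>U \<omega>\<bar> ^ q / t ^ q"
      using t t2 \<nu> by (intro divide_left_mono power_mono mult_pos_pos zero_less_power) auto
    then show "exp (\<bar>U \<omega>\<bar> ^ q / (2 * \<nu>) ^ q) \<le> exp (\<bar>U \<omega>\<bar> ^ q / t ^ q)" by simp
  qed
  also have "\<dots> \<le> 2" by (rule t)
  finally show "(\<integral>\<^sup>+ \<omega>. ennreal (exp (\<bar>U \<omega>\<bar> ^ q / (2 * \<nu>) ^ q)) \<partial>M) \<le> 2" .
qed

definition CLT_const :: real where "CLT_const = 32 * (200000000 * 8^5 * mom_const)"

lemma hyperrectangle_measurable: "A \<in> hyperrectangles p \<Longrightarrow> A \<in> sets (Rp p)"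
  using hyperrectangle_limit(1)[OF law_std_gauss law_std_gauss, of p 0 A] by simp

lemma hyperrectangles_nonempty: "hyperrectangles p \<noteq> {}"
proof -
  have "PiE {..<p} (\<lambda>_. {}) \<in> hyperrectangles p" unfolding hyperrectangles_def by (auto intro!: exI[of _ "\<lambda>_. {}"])
  then show ?thesis by blast
qed

theorem clt_constant_holds: "clt_constant CLT_const TYPE('a) TYPE('b)"
  unfolding clt_constant_def
proof (intro allI impI)
  fix n p q :: nat and M :: "'a measure" and N :: "'b measure" and X Y
  assume n: "1 \<le> n" and p1: "1 \<le> p" and q: "q \<in> {1, 2}" and M: "prob_space M" and N: "prob_space N"
    and iid: "iid M n p X" and cX: "centered M p (X 0)"
    and X2: "\<forall>j<p. integrable M (\<lambda>\<omega>. (X 0 \<omega> j)\<^sup>2) \<and> 0 < prob_space.variance M (\<lambda>\<omega>. X 0 \<omega> j)"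
    and fin: "max_psi_norm q M p (X 0) < \<top>" and \<rho>: "0 < smallest_eigenvalue (correlation_matrix M p (X 0))"
    and G: "gaussian_vector N p Y" and cY: "centered N p Y"
    and cov: "\<forall>i<p. \<forall>j<p. prob_space.expectation N (\<lambda>\<omega>. Y \<omega> i * Y \<omega> j) = prob_space.expectation M (\<lambda>\<omega>. X 0 \<omega> i * X 0 \<omega> j)"
  interpret M: prob_space M by fact
  interpret N: prob_space N by fact
  have p: "0 < p" using p1 by simp
  define \<rho> where "\<rho> = smallest_eigenvalue (correlation_matrix M p (X 0))"
  define \<nu> where "\<nu> = enn2real (max_psi_norm q M p (X 0))"
  define sd where "sd j = sqrt (M.variance (\<lambda>\<omega>. X 0 \<omega> j))" for j
  define sc where "sc x = (\<lambda>j\<in>{..<p}. x j / sd j)" for x :: "nat \<Rightarrow> real"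
  define K where "K i j = M.expectation (\<lambda>\<omega>. X 0 \<omega> i * X 0 \<omega> j)" for i j
  define \<Sigma> where "\<Sigma> i j = K i j / (sd i * sd j)" for i j
  have sd: "0 < sd j" if "j < p" for j using X2 that by (simp add: sd_def)
  have EX: "M.expectation (\<lambda>\<omega>. X 0 \<omega> j) = 0" if "j < p" for j using cX that by (simp add: centered_def)
  have EY: "N.expectation (\<lambda>\<omega>. Y \<omega> j) = 0" if "j < p" for j using cY that by (simp add: centered_def)
  have sd2: "sd j * sd j = K j j" if "j < p" for j
    using X2 that EX[OF that] by (simp add: sd_def K_def power2_eq_square[symmetric])
  have ind: "M.indep_vars (\<lambda>_. Rp p) X {..<n}" and same: "\<And>i. i < n \<Longrightarrow> distr M (Rp p) (X i) = distr M (Rp p) (X 0)"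
    using iid unfolding iid_def by blast+
  have Xm: "X i \<in> M \<rightarrow>\<^sub>M Rp p" if "i < n" for i using ind that by (auto simp: M.indep_vars_def)
  have X0m: "X 0 \<in> M \<rightarrow>\<^sub>M Rp p" using Xm n by simp
  have X0j[measurable]: "(\<lambda>\<omega>. X 0 \<omega> j) \<in> borel_measurable M" if "j < p" for j
    using measurable_compose[OF X0m component_Rp[OF that]] .
  have Ym: "Y \<in> N \<rightarrow>\<^sub>M Rp p" using G by (simp add: gaussian_vector_def)
  have Yj[measurable]: "(\<lambda>\<omega>. Y \<omega> j) \<in> borel_measurable N" if "j < p" for j
    using measurable_compose[OF Ym component_Rp[OF that]] .
  have scm: "sc \<in> Rp p \<rightarrow>\<^sub>M Rp p" unfolding sc_def by (intro restrict_Rp borel_measurable_divide) auto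
  have XX: "sc \<circ> X 0 \<in> M \<rightarrow>\<^sub>M Rp p" using X0m scm by (rule measurable_comp)
  have YY: "sc \<circ> Y \<in> N \<rightarrow>\<^sub>M Rp p" using Ym scm by (rule measurable_comp)
  define \<mu> where "\<mu> = distr M (Rp p) (sc \<circ> X 0)"
  define \<gamma> where "\<gamma> = distr N (Rp p) (sc \<circ> Y)"
  have l\<mu>: "law p \<mu>" and l\<gamma>: "law p \<gamma>" unfolding \<mu>_def \<gamma>_def by (intro law_distr M N XX YY)+
  have scj: "sc x j = x j / sd j" if "j < p" for x j using that by (simp add: sc_def)
  have cY2: "N.expectation (\<lambda>\<omega>. Y \<omega> i * Y \<omega> j) = K i j" if "i < p" "j < p" for i j
    using cov that by (simp add: K_def)
  have m\<mu>: "(\<integral>x. x j \<partial>\<mu>) = 0" if j: "j < p" for j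
    unfolding \<mu>_def using j EX[OF j] by (subst integral_distr[OF XX]) (auto simp: scj)
  have m\<gamma>: "(\<integral>x. x j \<partial>\<gamma>) = 0" if j: "j < p" for j
    unfolding \<gamma>_def using j EY[OF j] by (subst integral_distr[OF YY]) (auto simp: scj)
  have v\<mu>: "(\<integral>x. x i * x j \<partial>\<mu>) = \<Sigma> i j" if j: "i < p" "j < p" for i j
    unfolding \<mu>_def using j by (subst integral_distr[OF XX]) (auto simp: scj \<Sigma>_def K_def)
  have v\<gamma>: "(\<integral>x. x i * x j \<partial>\<gamma>) = \<Sigma> i j" if j: "i < p" "j < p" for i j
    unfolding \<gamma>_def using j cY2[OF j] by (subst integral_distr[OF YY]) (auto simp: scj \<Sigma>_def)
  have sym: "\<Sigma> i j = \<Sigma> j i" for i j by (simp add: \<Sigma>_def K_def mult.commute)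
  have one: "\<Sigma> j j = 1" if "j < p" for j using sd[OF that] unfolding \<Sigma>_def sd2[OF that, symmetric] by simp
  have cm: "correlation_matrix M p (X 0) = mat p p (\<lambda>(i, j). \<Sigma> i j)"
  proof (rule eq_matI)
    fix i j assume "i < dim_row (mat p p (\<lambda>(i, j). \<Sigma> i j))" "j < dim_col (mat p p (\<lambda>(i, j). \<Sigma> i j))"
    then have ij: "i < p" "j < p" by auto
    then show "correlation_matrix M p (X 0) $$ (i, j) = mat p p (\<lambda>(i, j). \<Sigma> i j) $$ (i, j)"
      by (simp add: correlation_matrix_def covariance_def EX \<Sigma>_def K_def sd_def real_sqrt_mult)
  qed (auto simp: correlation_matrix_def)
  have eig: "\<rho> * (\<Sum>j<p. (a j)\<^sup>2) \<le> qf p \<Sigma> a" for a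
    unfolding \<rho>_def cm by (rule smallest_eigenvalue_qf[OF sym p])
  have en: "ennreal \<nu> = max_psi_norm q M p (X 0)" using fin by (simp add: \<nu>_def)
  have psi: "1 / 2 \<le> \<nu>" "(\<integral>\<^sup>+ \<omega>. ennreal (exp (\<bar>X 0 \<omega> j / sd j\<bar> ^ q / (2 * \<nu>) ^ q)) \<partial>M) \<le> 2" if j: "j < p" for j
  proof -
    have m: "(\<lambda>\<omega>. X 0 \<omega> j / sd j) \<in> borel_measurable M" using j by measurable
    have i: "integrable M (\<lambda>\<omega>. (X 0 \<omega> j / sd j)\<^sup>2)" using X2 j by (simp add: power_divide)
    have e: "M.expectation (\<lambda>\<omega>. (X 0 \<omega> j / sd j)\<^sup>2) = 1"
    proof -
      have "M.expectation (\<lambda>\<omega>. (X 0 \<omega> j / sd j)\<^sup>2) = K j j / (sd j * sd j)"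
        by (simp add: power_divide power2_eq_square K_def)
      also have "\<dots> = 1" using sd[OF j] unfolding sd2[OF j, symmetric] by simp
      finally show ?thesis .
    qed
    have le: "psi_norm q M (\<lambda>\<omega>. X 0 \<omega> j / sd j) \<le> ennreal \<nu>"
      unfolding en max_psi_norm_def sd_def using j by (intro Max_ge) auto
    show "1 / 2 \<le> \<nu>" "(\<integral>\<^sup>+ \<omega>. ennreal (exp (\<bar>X 0 \<omega> j / sd j\<bar> ^ q / (2 * \<nu>) ^ q)) \<partial>M) \<le> 2"
      by (rule psi_norm_unit_variance[OF M m i e q le])+
  qed
  have E: "(\<integral>\<^sup>+x. ennreal (exp (\<bar>x j\<bar> ^ q / (2 * \<nu>) ^ q)) \<partial>\<mu>) \<le> 2" if j: "j < p" for j
    unfolding \<mu>_def using psi(2)[OF j] j by (subst nn_integral_distr[OF XX]) (auto simp: scj)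
  have char_fun: "char_fun p \<gamma> a = of_real (exp (- qf p \<Sigma> a / 2))" for a
  proof -
    have "char_fun p \<gamma> a = char_fun p (distr N (Rp p) Y) (\<lambda>j. a j / sd j)"
      unfolding \<gamma>_def char_fun_distr[OF YY] char_fun_distr[OF Ym] by (simp add: scj)
    also have "\<dots> = of_real (exp (- qf p (\<lambda>i j. N.expectation (\<lambda>\<omega>. Y \<omega> i * Y \<omega> j)) (\<lambda>j. a j / sd j) / 2))"
      by (rule gaussian_cf[OF N G cY])
    also have "qf p (\<lambda>i j. N.expectation (\<lambda>\<omega>. Y \<omega> i * Y \<omega> j)) (\<lambda>j. a j / sd j) = qf p \<Sigma> a"
      unfolding qf_def by (intro sum.cong refl) (simp add: cY2 \<Sigma>_def)
    finally show ?thesis .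
  qed
  define P where "P = distr M (Rp p) (normalized_sum n p X)"
  define Q where "Q = distr N (Rp p) Y"
  have Xij: "(\<lambda>\<omega>. X i \<omega> j) \<in> borel_measurable M" if "i < n" "j < p" for i j
    using measurable_compose[OF Xm[OF that(1)] component_Rp[OF that(2)]] .
  have nsm: "normalized_sum n p X \<in> M \<rightarrow>\<^sub>M Rp p" unfolding normalized_sum_def
    by (intro restrict_Rp borel_measurable_times borel_measurable_const borel_measurable_sum Xij) auto
  have lP: "law p P" and lQ: "law p Q" unfolding P_def Q_def by (intro law_distr M N nsm Ym)+
  have \<gamma>Q: "\<gamma> = distr Q (Rp p) sc" unfolding \<gamma>_def Q_def by (rule distr_distr[OF scm Ym, symmetric])
  have indS: "M.indep_vars (\<lambda>_. Rp p) (\<lambda>i. sc \<circ> X i) {..<n}"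
    by (rule M.indep_vars_compose[OF ind]) (rule scm)
  have sameS: "distr M (Rp p) (sc \<circ> X i) = \<mu>" if "i < n" for i
  proof -
    have "distr M (Rp p) (sc \<circ> X i) = distr (distr M (Rp p) (X i)) (Rp p) sc" by (rule distr_distr[OF scm Xm[OF that], symmetric])
    also have "\<dots> = \<mu>" unfolding same[OF that] \<mu>_def by (rule distr_distr[OF scm X0m])
    finally show ?thesis .
  qed
  have pwP: "scal p (1 / sqrt (real n)) (conv_pow p \<mu> n) = distr P (Rp p) sc"
  proof -
    have "conv_pow p \<mu> n = distr M (Rp p) (\<lambda>\<omega>. \<lambda>j\<in>{..<p}. \<Sum>i<n. (sc \<circ> X i) \<omega> j)"
      by (rule iid_sum_law[OF M indS sameS order_refl, symmetric])
    then have pwe: "conv_pow p \<mu> n = distr M (Rp p) (\<lambda>\<omega>. \<lambda>j\<in>{..<p}. \<Sum>i<n. (sc \<circ> X i) \<omega> j)" .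
    have Sm: "(\<lambda>\<omega>. \<lambda>j\<in>{..<p}. \<Sum>i<n. (sc \<circ> X i) \<omega> j) \<in> M \<rightarrow>\<^sub>M Rp p"
    proof (intro restrict_Rp borel_measurable_sum)
      fix j i assume "j < p" "i \<in> {..<n}"
      then show "(\<lambda>\<omega>. (sc \<circ> X i) \<omega> j) \<in> borel_measurable M"
        using Xij[of i j] by (simp add: scj borel_measurable_divide)
    qed
    have cm: "(\<lambda>x. \<lambda>j\<in>{..<p}. 1 / sqrt (real n) * x j) \<in> Rp p \<rightarrow>\<^sub>M Rp p"
      using scal_measurable[OF law_std_gauss[of p]] by (simp only: law_measurable[OF law_std_gauss])
    have "scal p (1 / sqrt (real n)) (conv_pow p \<mu> n) =
       distr M (Rp p) ((\<lambda>x. \<lambda>j\<in>{..<p}. 1 / sqrt (real n) * x j) \<circ> (\<lambda>\<omega>. \<lambda>j\<in>{..<p}. \<Sum>i<n. (sc \<circ> X i) \<omega> j))"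
      unfolding scal_def pwe by (rule distr_distr[OF cm Sm])
    also have "\<dots> = distr M (Rp p) (sc \<circ> normalized_sum n p X)"
      by (intro arg_cong[where f="distr M (Rp p)"])
         (auto simp: fun_eq_iff sc_def normalized_sum_def sum_divide_distrib mult.commute)
    also have "\<dots> = distr P (Rp p) sc" unfolding P_def by (rule distr_distr[OF scm nsm, symmetric])
    finally show ?thesis .
  qed
  have scbox: "measure (distr R (Rp p) sc) (pbox p (\<lambda>j. a j / sd j) (\<lambda>j. b j / sd j)) = measure R (pbox p a b)" if R: "law p R" for R a b
  proof -
    have scmR: "sc \<in> R \<rightarrow>\<^sub>M Rp p" unfolding law_measurable[OF R] by (rule scm)
    have "sc -` pbox p (\<lambda>j. a j / sd j) (\<lambda>j. b j / sd j) \<inter> space R = pbox p a b"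
    proof (rule Set.set_eqI)
      fix w
      have "sc w \<in> space (Rp p)" by (simp add: sc_def space_Rp)
      moreover have "in_box p (\<lambda>j. a j / sd j) (\<lambda>j. b j / sd j) (sc w) \<longleftrightarrow> in_box p a b w"
        unfolding in_box_def using sd by (simp add: scj divide_le_cancel) (metis order_less_asym)
      ultimately show "w \<in> sc -` pbox p (\<lambda>j. a j / sd j) (\<lambda>j. b j / sd j) \<inter> space R \<longleftrightarrow> w \<in> pbox p a b"
        unfolding law_space[OF R] pbox_def by auto
    qed
    then show ?thesis by (subst measure_distr[OF scmR box_sets]) simp
  qed
  define B where "B = CLT_const * \<nu> ^ 4 * Log (real (p * n)) ^ (if q = 1 then 6 else 4) * Log (real n) / (\<rho> powr (3 / 2) * sqrt (real n))"
  have boxes: "\<bar>measure P (pbox p a b) - measure Q (pbox p a b)\<bar> \<le> B" for a b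
  proof -
    have \<nu>: "1 / 2 \<le> \<nu>" by (rule psi(1)[OF p])
    have "\<bar>measure (scal p (1 / sqrt (real n)) (conv_pow p \<mu> n)) (pbox p (\<lambda>j. a j / sd j) (\<lambda>j. b j / sd j)) - measure \<gamma> (pbox p (\<lambda>j. a j / sd j) (\<lambda>j. b j / sd j))\<bar> \<le>
       2 * (200000000 * 8^5 * mom_const) * ((2 * \<nu>)^3 * Log (real (p * n)) ^ (if q = 1 then 6 else 4) * Log (real n) / (\<rho> powr (3/2) * sqrt (real n)))"
      by (rule law_clt[where \<Sigma>=\<Sigma>]) (use p l\<mu> l\<gamma> q \<nu> sym one \<rho> eig m\<mu> m\<gamma> v\<mu> v\<gamma> E char_fun n in \<open>auto simp: \<rho>_def[symmetric]\<close>)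
    also have "\<dots> \<le> B"
    proof -
      define T where "T = Log (real (p * n)) ^ (if q = 1 then 6 else 4) * Log (real n) / (\<rho> powr (3/2) * sqrt (real n))"
      have T: "0 \<le> T" unfolding T_def by (intro divide_nonneg_nonneg mult_nonneg_nonneg zero_le_power) (auto simp: Log_def)
      \<comment> \<open>as \<open>2 * \<nu> \<ge> 1\<close>, the fourth power dominates the third\<close>
      have "(2 * \<nu>) ^ 3 * 1 \<le> (2 * \<nu>) ^ 3 * (2 * \<nu>)" using \<nu> by (intro mult_left_mono) auto
      then have "(2 * \<nu>) ^ 3 \<le> 16 * \<nu> ^ 4" by (simp add: power_mult_distrib power4_eq_xxxx power3_eq_cube)
      then have "(2 * \<nu>) ^ 3 * T \<le> 16 * \<nu> ^ 4 * T" using T by (intro mult_right_mono)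
      then have "2 * (200000000 * 8^5 * mom_const) * ((2 * \<nu>) ^ 3 * T) \<le> 2 * (200000000 * 8^5 * mom_const) * (16 * \<nu> ^ 4 * T)" by (intro mult_left_mono) auto
      then show ?thesis by (simp add: B_def CLT_const_def T_def)
    qed
    finally show ?thesis unfolding pwP \<gamma>Q scbox[OF lP] scbox[OF lQ] .
  qed
  show "(SUP A\<in>hyperrectangles p. \<bar>measure M {\<omega> \<in> space M. normalized_sum n p X \<omega> \<in> A} - measure N {\<omega> \<in> space N. Y \<omega> \<in> A}\<bar>)
        \<le> CLT_const * (enn2real (max_psi_norm q M p (X 0))) ^ 4 * Log (real (p * n)) ^ (if q = 1 then 6 else 4) * Log (real n)
          / (smallest_eigenvalue (correlation_matrix M p (X 0)) powr (3 / 2) * sqrt (real n))"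
    unfolding \<nu>_def[symmetric] \<rho>_def[symmetric] B_def[symmetric]
  proof (rule cSUP_least[OF hyperrectangles_nonempty])
    fix A assume A: "A \<in> hyperrectangles p"
    have As: "A \<in> sets (Rp p)" by (rule hyperrectangle_measurable[OF A])
    have "measure M {\<omega> \<in> space M. normalized_sum n p X \<omega> \<in> A} = measure P A"
      unfolding P_def by (subst measure_distr[OF nsm As]) (simp add: vimage_def Int_def conj_commute)
    moreover have "measure N {\<omega> \<in> space N. Y \<omega> \<in> A} = measure Q A"
      unfolding Q_def by (subst measure_distr[OF Ym As]) (simp add: vimage_def Int_def conj_commute)
    ultimately show "\<bar>measure M {\<omega> \<in> space M. normalized_sum n p X \<omega> \<in> A} - measure N {\<omega> \<in> space N. Y \<omega> \<in> A}\<bar> \<le> B"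
      using hyperrectangle_limit(2)[OF lP lQ boxes A] by simp
  qed
qed

section \<open>Independence of the sample spaces\<close>

text \<open>The inequality depends on the joint law of \<open>X\<close> and on the law of \<open>Y\<close> only. These laws themselves, with
the coordinate maps as random vectors, live on the two sample types of the hypothesis.\<close>

lemma clt_constant_transfer:
  assumes C: "clt_constant C TYPE(nat \<Rightarrow> nat \<Rightarrow> real) TYPE(nat \<Rightarrow> real)"
  shows "clt_constant C TYPE('a) TYPE('b)"
  unfolding clt_constant_def
proof (intro allI impI)
  fix n p q :: nat and M :: "'a measure" and N :: "'b measure" and X Y
  assume n: "1 \<le> n" and p1: "1 \<le> p" and q: "q \<in> {1, 2}" and M: "prob_space M" and N: "prob_space N"
    and iid: "iid M n p X" and cX: "centered M p (X 0)"
    and X2: "\<forall>j<p. integrable M (\<lambda>\<omega>. (X 0 \<omega> j)\<^sup>2) \<and> 0 < prob_space.variance M (\<lambda>\<omega>. X 0 \<omega> j)"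
    and fin: "max_psi_norm q M p (X 0) < \<top>" and \<rho>: "0 < smallest_eigenvalue (correlation_matrix M p (X 0))"
    and G: "gaussian_vector N p Y" and cY: "centered N p Y"
    and cov: "\<forall>i<p. \<forall>j<p. prob_space.expectation N (\<lambda>\<omega>. Y \<omega> i * Y \<omega> j) = prob_space.expectation M (\<lambda>\<omega>. X 0 \<omega> i * X 0 \<omega> j)"
  interpret M: prob_space M by fact
  interpret N: prob_space N by fact
  have ind: "M.indep_vars (\<lambda>_. Rp p) X {..<n}" and same: "\<And>i. i < n \<Longrightarrow> distr M (Rp p) (X i) = distr M (Rp p) (X 0)"
    using iid unfolding iid_def by blast+
  have Xm: "X i \<in> M \<rightarrow>\<^sub>M Rp p" if "i < n" for i using ind that by (auto simp: M.indep_vars_def)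
  have Ym: "Y \<in> N \<rightarrow>\<^sub>M Rp p" using G by (simp add: gaussian_vector_def)
  define R where "R = (\<Pi>\<^sub>M i\<in>{..<n}. Rp p)"
  define T where "T \<omega> = (\<lambda>i\<in>{..<n}. X i \<omega>)" for \<omega>
  define M' where "M' = distr M R T"
  define X' where "X' = (\<lambda>(i :: nat) (\<omega> :: nat \<Rightarrow> nat \<Rightarrow> real). \<omega> i)"
  define N' where "N' = distr N (Rp p) Y"
  define Y' where "Y' = (\<lambda>y :: nat \<Rightarrow> real. y)"
  have Tm: "T \<in> M \<rightarrow>\<^sub>M R" unfolding T_def R_def by (intro measurable_restrict Xm) auto
  have M': "prob_space M'" unfolding M'_def by (rule M.prob_space_distr[OF Tm])
  have N': "prob_space N'" unfolding N'_def by (rule N.prob_space_distr[OF Ym])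
  interpret M': prob_space M' by fact
  interpret N': prob_space N' by fact
  have X'R: "X' i \<in> R \<rightarrow>\<^sub>M Rp p" if "i < n" for i
    unfolding X'_def R_def using that by (intro measurable_component_singleton) auto
  have X'm: "X' i \<in> M' \<rightarrow>\<^sub>M Rp p" if "i < n" for i unfolding M'_def using X'R[OF that] by simp
  have dX: "distr M' (Rp p) (X' i) = distr M (Rp p) (X i)" if "i < n" for i
    unfolding M'_def distr_distr[OF X'R[OF that] Tm] using that
    by (intro distr_cong) (auto simp: T_def X'_def)
  have Y'm: "Y' \<in> N' \<rightarrow>\<^sub>M Rp p" unfolding N'_def Y'_def by simp
  have dY: "distr N' (Rp p) Y' = distr N (Rp p) Y"
    unfolding N'_def Y'_def by (subst distr_distr) (auto simp: Ym comp_def)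
  have n0: "0 < n" using n by simp
  note X0 = Xm[OF n0] X'm[OF n0] dX[OF n0]
  have eX: "M'.expectation (\<lambda>\<omega>. g (X' 0 \<omega>)) = M.expectation (\<lambda>\<omega>. g (X 0 \<omega>))"
    "integrable M' (\<lambda>\<omega>. g (X' 0 \<omega>)) \<longleftrightarrow> integrable M (\<lambda>\<omega>. g (X 0 \<omega>))" if g: "g \<in> borel_measurable (Rp p)" for g :: "_ \<Rightarrow> real"
    unfolding integral_distr[OF X0(1) g, symmetric] integral_distr[OF X0(2) g, symmetric]
      integrable_distr_eq[OF X0(1) g, symmetric] integrable_distr_eq[OF X0(2) g, symmetric] X0(3) by (rule refl)+
  have eY: "N'.expectation (\<lambda>\<omega>. g (Y' \<omega>)) = N.expectation (\<lambda>\<omega>. g (Y \<omega>))"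
    "integrable N' (\<lambda>\<omega>. g (Y' \<omega>)) \<longleftrightarrow> integrable N (\<lambda>\<omega>. g (Y \<omega>))" if g: "g \<in> borel_measurable (Rp p)" for g :: "_ \<Rightarrow> real"
    unfolding integral_distr[OF Ym g, symmetric] integral_distr[OF Y'm g, symmetric]
      integrable_distr_eq[OF Ym g, symmetric] integrable_distr_eq[OF Y'm g, symmetric] dY by (rule refl)+
  have nX: "(\<integral>\<^sup>+\<omega>. g (X' 0 \<omega>) \<partial>M') = (\<integral>\<^sup>+\<omega>. g (X 0 \<omega>) \<partial>M)" if g: "g \<in> borel_measurable (Rp p)" for g
    using nn_integral_distr[OF X0(1), of g] nn_integral_distr[OF X0(2), of g] X0(3) g by simp
  have mean: "M'.expectation (\<lambda>\<omega>. X' 0 \<omega> j) = M.expectation (\<lambda>\<omega>. X 0 \<omega> j)" if "j < p" for j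
    by (rule eX(1)[OF component_Rp[OF that]])
  have var: "M'.variance (\<lambda>\<omega>. X' 0 \<omega> j) = M.variance (\<lambda>\<omega>. X 0 \<omega> j)" if "j < p" for j
    unfolding mean[OF that] by (rule eX(1)) (use that in measurable)
  have iid': "iid M' n p X'" unfolding iid_def
  proof (intro conjI allI impI)
    have "M'.indep_vars (\<lambda>_. Rp p) X' {..<n} \<longleftrightarrow>
       distr M' (\<Pi>\<^sub>M i\<in>{..<n}. Rp p) (\<lambda>x. \<lambda>i\<in>{..<n}. X' i x) = (\<Pi>\<^sub>M i\<in>{..<n}. distr M' (Rp p) (X' i))"
      by (rule M'.indep_vars_iff_distr_eq_PiM') (use n0 X'm in auto)
    moreover have "distr M (\<Pi>\<^sub>M i\<in>{..<n}. Rp p) (\<lambda>x. \<lambda>i\<in>{..<n}. X i x) = (\<Pi>\<^sub>M i\<in>{..<n}. distr M (Rp p) (X i))"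
      using ind by (subst (asm) M.indep_vars_iff_distr_eq_PiM') (use n0 Xm in auto)
    moreover have "distr M' (\<Pi>\<^sub>M i\<in>{..<n}. Rp p) (\<lambda>x. \<lambda>i\<in>{..<n}. X' i x) = distr M (\<Pi>\<^sub>M i\<in>{..<n}. Rp p) (\<lambda>x. \<lambda>i\<in>{..<n}. X i x)"
    proof -
      have "(\<lambda>x. \<lambda>i\<in>{..<n}. X' i x) \<in> R \<rightarrow>\<^sub>M (\<Pi>\<^sub>M i\<in>{..<n}. Rp p)" by (intro measurable_restrict X'R) auto
      from distr_distr[OF this Tm] show ?thesis unfolding M'_def
        by (simp add: comp_def T_def X'_def cong: restrict_cong)
    qed
    moreover have "(\<Pi>\<^sub>M i\<in>{..<n}. distr M' (Rp p) (X' i)) = (\<Pi>\<^sub>M i\<in>{..<n}. distr M (Rp p) (X i))"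
      by (rule PiM_cong) (auto simp: dX)
    ultimately show "M'.indep_vars (\<lambda>_. Rp p) X' {..<n}" by simp
    show "distr M' (Rp p) (X' i) = distr M' (Rp p) (X' 0)" if "i < n" for i
      unfolding dX[OF that] dX[OF n0] by (rule same[OF that])
  qed
  have cX': "centered M' p (X' 0)"
    using cX mean eX(2)[OF component_Rp] by (auto simp: centered_def)
  have X2': "\<forall>j<p. integrable M' (\<lambda>\<omega>. (X' 0 \<omega> j)\<^sup>2) \<and> 0 < M'.variance (\<lambda>\<omega>. X' 0 \<omega> j)"
  proof (intro allI impI conjI)
    fix j assume j: "j < p"
    show "integrable M' (\<lambda>\<omega>. (X' 0 \<omega> j)\<^sup>2)"
      by (subst eX(2)) (use X2 j in \<open>auto intro: borel_measurable_power component_Rp\<close>)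
    show "0 < M'.variance (\<lambda>\<omega>. X' 0 \<omega> j)" unfolding var[OF j] using X2 j by blast
  qed
  have psi: "psi_norm q M' (\<lambda>\<omega>. X' 0 \<omega> j / c) = psi_norm q M (\<lambda>\<omega>. X 0 \<omega> j / c)" if "j < p" for j c
  proof -
    have "(\<integral>\<^sup>+ \<omega>. ennreal (exp (\<bar>X' 0 \<omega> j / c\<bar> ^ q / t ^ q)) \<partial>M') = (\<integral>\<^sup>+ \<omega>. ennreal (exp (\<bar>X 0 \<omega> j / c\<bar> ^ q / t ^ q)) \<partial>M)" for t
      by (rule nX) (use that in measurable)
    then show ?thesis unfolding psi_norm_def by simp
  qed
  have mpsi: "max_psi_norm q M' p (X' 0) = max_psi_norm q M p (X 0)"
    unfolding max_psi_norm_def by (intro arg_cong[where f=Max] image_cong refl) (simp add: psi var)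
  have cm: "correlation_matrix M' p (X' 0) = correlation_matrix M p (X 0)"
  proof (rule eq_matI)
    fix i j assume "i < dim_row (correlation_matrix M p (X 0))" "j < dim_col (correlation_matrix M p (X 0))"
    then have ij: "i < p" "j < p" by (auto simp: correlation_matrix_def)
    have "covariance M' (\<lambda>\<omega>. X' 0 \<omega> i) (\<lambda>\<omega>. X' 0 \<omega> j) = covariance M (\<lambda>\<omega>. X 0 \<omega> i) (\<lambda>\<omega>. X 0 \<omega> j)"
      unfolding covariance_def mean[OF ij(1)] mean[OF ij(2)] by (rule eX(1)) (use ij in measurable)
    then show "correlation_matrix M' p (X' 0) $$ (i, j) = correlation_matrix M p (X 0) $$ (i, j)"
      using ij by (simp add: correlation_matrix_def var)
  qed (auto simp: correlation_matrix_def)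
  have lin: "(\<lambda>y. \<Sum>j<p. a j * y j) \<in> borel_measurable (Rp p)" for a :: "nat \<Rightarrow> real" by measurable
  have G': "gaussian_vector N' p Y'" unfolding gaussian_vector_def
  proof (intro conjI allI Y'm)
    fix a :: "nat \<Rightarrow> real"
    obtain m \<sigma> where "0 < \<sigma> \<and> distributed N lborel (\<lambda>\<omega>. \<Sum>j<p. a j * Y \<omega> j) (normal_density m \<sigma>) \<or> (AE \<omega> in N. (\<Sum>j<p. a j * Y \<omega> j) = m)"
      using G unfolding gaussian_vector_def by blast
    moreover have "distributed N' lborel (\<lambda>\<omega>. \<Sum>j<p. a j * Y' \<omega> j) (normal_density m \<sigma>)"
      if "distributed N lborel (\<lambda>\<omega>. \<Sum>j<p. a j * Y \<omega> j) (normal_density m \<sigma>)"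
    proof -
      have l': "(\<lambda>y. \<Sum>j<p. a j * y j) \<in> Rp p \<rightarrow>\<^sub>M lborel" using lin[of a] by simp
      have "distr N' lborel (\<lambda>\<omega>. \<Sum>j<p. a j * Y' \<omega> j) = distr N lborel (\<lambda>\<omega>. \<Sum>j<p. a j * Y \<omega> j)"
        unfolding N'_def Y'_def by (subst distr_distr[OF l' Ym]) (simp add: comp_def)
      moreover have "(\<lambda>\<omega>. \<Sum>j<p. a j * Y' \<omega> j) \<in> N' \<rightarrow>\<^sub>M lborel" unfolding N'_def Y'_def using l' by simp
      ultimately show ?thesis using that by (simp add: distributed_def)
    qed
    moreover have "AE \<omega> in N'. (\<Sum>j<p. a j * Y' \<omega> j) = m" if "AE \<omega> in N. (\<Sum>j<p. a j * Y \<omega> j) = m"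
      unfolding N'_def Y'_def
    proof (subst AE_distr_iff[OF Ym])
      show "{x \<in> space (Rp p). (\<Sum>j<p. a j * x j) = m} \<in> sets (Rp p)" using lin[of a] by measurable
    qed (rule that)
    ultimately show "\<exists>m \<sigma>. 0 < \<sigma> \<and> distributed N' lborel (\<lambda>\<omega>. \<Sum>j<p. a j * Y' \<omega> j) (normal_density m \<sigma>) \<or> (AE \<omega> in N'. (\<Sum>j<p. a j * Y' \<omega> j) = m)"
      by blast
  qed
  have cY': "centered N' p Y'"
    using cY eY(1)[OF component_Rp] eY(2)[OF component_Rp] by (auto simp: centered_def)
  have cov': "\<forall>i<p. \<forall>j<p. N'.expectation (\<lambda>\<omega>. Y' \<omega> i * Y' \<omega> j) = M'.expectation (\<lambda>\<omega>. X' 0 \<omega> i * X' 0 \<omega> j)"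
  proof (intro allI impI)
    fix i j assume ij: "i < p" "j < p"
    have g: "(\<lambda>x. x i * x j) \<in> borel_measurable (Rp p)" using ij by measurable
    show "N'.expectation (\<lambda>\<omega>. Y' \<omega> i * Y' \<omega> j) = M'.expectation (\<lambda>\<omega>. X' 0 \<omega> i * X' 0 \<omega> j)"
      unfolding eX(1)[OF g] eY(1)[OF g] using cov ij by blast
  qed
  have nsm: "normalized_sum n p X' \<in> R \<rightarrow>\<^sub>M Rp p" unfolding normalized_sum_def
  proof (intro restrict_Rp borel_measurable_times borel_measurable_const borel_measurable_sum)
    fix j i assume "j < p" "i \<in> {..<n}"
    then show "(\<lambda>\<omega>. X' i \<omega> j) \<in> borel_measurable R"
      using measurable_compose[OF X'R component_Rp] by simp
  qed
  have Sx: "measure M' {\<omega> \<in> space M'. normalized_sum n p X' \<omega> \<in> A} = measure M {\<omega> \<in> space M. normalized_sum n p X \<omega> \<in> A}"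
    if A: "A \<in> hyperrectangles p" for A
  proof -
    have S: "{\<omega> \<in> space R. normalized_sum n p X' \<omega> \<in> A} \<in> sets R"
      using measurable_sets[OF nsm hyperrectangle_measurable[OF A]] by (simp add: vimage_def Int_def conj_commute)
    have "T \<omega> \<in> space R" if "\<omega> \<in> space M" for \<omega> using measurable_space[OF Tm that] .
    moreover have "normalized_sum n p X' (T \<omega>) = normalized_sum n p X \<omega>" for \<omega>
      unfolding normalized_sum_def T_def X'_def by (intro restrict_ext) simp
    ultimately show ?thesis unfolding M'_def space_distr
      by (subst measure_distr[OF Tm S]) (intro arg_cong[where f="measure M"], auto)
  qed
  have Sy: "measure N' {\<omega> \<in> space N'. Y' \<omega> \<in> A} = measure N {\<omega> \<in> space N. Y \<omega> \<in> A}"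
    if A: "A \<in> hyperrectangles p" for A
  proof -
    have As: "A \<in> sets (Rp p)" by (rule hyperrectangle_measurable[OF A])
    then have "{\<omega> \<in> space N'. Y' \<omega> \<in> A} = A" using sets.sets_into_space[OF As] by (auto simp: N'_def Y'_def)
    then have "measure N' {\<omega> \<in> space N'. Y' \<omega> \<in> A} = measure N (Y -` A \<inter> space N)"
      unfolding N'_def using measure_distr[OF Ym As] by simp
    also have "Y -` A \<inter> space N = {\<omega> \<in> space N. Y \<omega> \<in> A}" by auto
    finally show ?thesis .
  qed
  have SUPeq: "(SUP A\<in>hyperrectangles p. \<bar>measure M {\<omega> \<in> space M. normalized_sum n p X \<omega> \<in> A} - measure N {\<omega> \<in> space N. Y \<omega> \<in> A}\<bar>) =
     (SUP A\<in>hyperrectangles p. \<bar>measure M' {\<omega> \<in> space M'. normalized_sum n p X' \<omega> \<in> A} - measure N' {\<omega> \<in> space N'. Y' \<omega> \<in> A}\<bar>)"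
    by (intro arg_cong[where f=Sup] image_cong refl) (simp add: Sx Sy)
  note C' = C[unfolded clt_constant_def, rule_format, OF n p1 q M' N' iid' cX' _ _ _ G' cY']
  show "(SUP A\<in>hyperrectangles p. \<bar>measure M {\<omega> \<in> space M. normalized_sum n p X \<omega> \<in> A} - measure N {\<omega> \<in> space N. Y \<omega> \<in> A}\<bar>)
        \<le> C * (enn2real (max_psi_norm q M p (X 0))) ^ 4 * Log (real (p * n)) ^ (if q = 1 then 6 else 4) * Log (real n)
          / (smallest_eigenvalue (correlation_matrix M p (X 0)) powr (3 / 2) * sqrt (real n))"
    unfolding SUPeq mpsi[symmetric] cm[symmetric]
    by (rule C') (use X2' fin \<rho> cov' in \<open>auto simp: mpsi cm\<close>)
qed

(* The first conjunct chooses C without reference to the type variables 'a and 'b (its sample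
   spaces carry every joint law of X and every law of Y); the second says that every such C
   also works over arbitrary sample types 'a and 'b. Hence C is absolute. *)
theorem theorem2p1:
  shows "(\<exists>C>0. clt_constant C TYPE(nat \<Rightarrow> nat \<Rightarrow> real) TYPE(nat \<Rightarrow> real)) \<and>
         (\<forall>C>0. clt_constant C TYPE(nat \<Rightarrow> nat \<Rightarrow> real) TYPE(nat \<Rightarrow> real) \<longrightarrow>
                clt_constant C TYPE('a) TYPE('b))"
proof (intro conjI allI impI)
  show "\<exists>C>0. clt_constant C TYPE(nat \<Rightarrow> nat \<Rightarrow> real) TYPE(nat \<Rightarrow> real)"
    by (intro exI[of _ CLT_const] conjI clt_constant_holds) (simp add: CLT_const_def)
qed (rule clt_constant_transfer)

end
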